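(* Let $\varphi:\mathbb T^d\to\mathbb T^d$ be the piecewise affine linear Bernoulli map, and $(X_n)$ the Markov process $X_{n+1}=\varphi(X_n)+\epsilon\zeta_{n+1}$, described in the context. Suppose the Cubes Assumption (stated in the context) holds and $\operatorname{supp}(K_\epsilon)\subseteq B(0,\epsilon)$. Moreover, assume that the Fourier coefficients of $K_\epsilon$ satisfy $$\sup_{|k|>c/\epsilon}|\hat K_\epsilon(k)|<1$$ for any $c>0$ and all sufficiently small $\epsilon>0$. Then there exists an explicit constant $C$ such that for every $\delta\in(0,1)$, $$\frac{d\ln\epsilon}{\ln p_{\min}}-C\bigl(1+|\ln(1-\delta)|\bigr)\le t_{\mathrm{dis}}(\delta)\le\frac{d\ln\epsilon}{\ln p_{\max}}+C\Bigl(1+\frac{|\ln\delta|}{\delta^2}\Bigr)$$ for all sufficiently small $\epsilon>0$. Here $p_{\min}$ and $p_{\max}$ are the measures of the smallest and largest domains $E_i$ on which $\varphi$ is affine linear.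
   Context: **Process.** $\mathbb T^d=\mathbb R^d/\mathbb Z^d$, $\Pi:\mathbb R^d\to\mathbb T^d$ is the canonical projection, and $\pi$ is Lebesgue (probability) measure on $\mathbb T^d$. For $x\in\mathbb T^d$, $\check x\in[0,1)^d$ is the unique point with $\Pi(\check x)=x$. For each $\epsilon>0$, $(\epsilon\zeta_n)_{n\ge1}$ are i.i.d. $\mathbb T^d$-valued random variables with mean $0$, independent of $X_0$, whose law has density $K_\epsilon$ with respect to $\pi$, and $X_{n+1}=\varphi(X_n)+\epsilon\zeta_{n+1}$. $B(0,\epsilon)$ is the ball of radius $\epsilon$ about $0$ in $\mathbb T^d$, and $\hat K_\epsilon(k)=\int_{\mathbb T^d}K_\epsilon(x)e^{-2\pi i k\cdot x}\,\pi(dx)$, $k\in\mathbb Z^d$. **Dissipation time.** $\dot L^2\subseteq L^2(\mathbb T^d,\pi)$ is the subspace of mean-zero functions, and $t_{\mathrm{dis}}(\delta)=\min\{n\in\mathbb N:\ \|\theta_n\|_{L^2}\le\delta\|\theta_0\|_{L^2}\text{ for all }\theta_0\in\dot L^2\}$, where $\theta_n(x)=\mathbf E(\theta_0(X_n)\mid X_0=x)$. **The map $\varphi$.** Let $M\ge2$, $\mathcal I=\{1,\dots,M\}$, and let $\check E_1,\dots,\check E_M$ be a partition of $[0,1)^d$; if $d=1$ each $\check E_i$ is an interval, if $d>1$ each $\check E_i$ is a $d$-dimensional cube with sides parallel to the coordinate axes. Let $p_i\in(0,1)$ be the Lebesgue measure of $\check E_i$, $p_{\min}=\min_ip_i$,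 $p_{\max}=\max_ip_i$. Assume $\check\varphi_i:\check E_i\to[0,1)^d$ are affine bijections $\check\varphi_i(\check x)=p_i^{-1/d}\check D_i\check x+\check e_i$ with $\check e_i\in\mathbb R^d$ and $\check D_i$ orthogonal matrices. Let $E_i=\Pi(\check E_i)$, $\varphi_i(x)=\Pi(\check\varphi_i(\check x))$ for $x\in E_i$, and $\varphi(x)=\varphi_i(x)$ if $x\in E_i$. **Cylinder sets.** $\mathcal T$ is the set of all finite tuples with entries in $\mathcal I$, including the empty tuple $\mathbf 0$. For $s=(s_0,\dots,s_{m-1})\in\mathcal T$, $|s|=m$ and $\mathcal C_s=\{x\in\mathbb T^d:\varphi^n(x)\in E_{s_n}\text{ for all }0\le n<|s|\}$; $\mathcal C_{\mathbf 0}=\mathbb T^d$. **Cubes Assumption.** (1) Each $\varphi_i:E_i\to\mathbb T^d$ is a bijection. (2) For every $\check x\in\partial[0,1]^d$ there exist $i\in\mathcal I$ and $\check y\in(0,1)^d$ such that $\check\varphi_i(\check y)=\check x$, where $\check\varphi_i$ here denotes the affine map on $\mathbb R^d$ given by the same formula. (3) If $d\ge2$, every cylinder set $\mathcal C_s$ is an axis-aligned cube.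
   Formalization: The Fourier condition is taken uniformly: for each c>0 there is ρ<1 with sup_{|k|>c/ε}|K̂_ε(k)| ≤ ρ for all small ε. Read for each ε separately it always holds and the upper bound fails, e.g. for K_ε uniform on B(0,e^{-1/ε}). C may depend on the map and the family K_ε. *)

theory Defs
  imports "HOL-Probability.Probability"
begin

section \<open>The torus\<close>

quotient_type (overloaded) 'n torus = "real^'n::finite" / "\<lambda>x y. \<forall>i. x $ i - y $ i \<in> \<int>"
  morphisms rep_torus torus_of
proof (rule equivpI)
  show "reflp (\<lambda>x y::real^'n. \<forall>i. x $ i - y $ i \<in> \<int>)"
    by (simp add: reflp_def)
  show "symp (\<lambda>x y::real^'n. \<forall>i. x $ i - y $ i \<in> \<int>)"
  proof (rule sympI, intro allI)
    fix x y :: "real^'n" and i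
    assume "\<forall>i. x $ i - y $ i \<in> \<int>"
    then have "- (x $ i - y $ i) \<in> \<int>" by (intro Ints_minus) auto
    then show "y $ i - x $ i \<in> \<int>" by simp
  qed
  show "transp (\<lambda>x y::real^'n. \<forall>i. x $ i - y $ i \<in> \<int>)"
  proof (rule transpI, intro allI)
    fix x y z :: "real^'n" and i
    assume "\<forall>i. x $ i - y $ i \<in> \<int>" "\<forall>i. y $ i - z $ i \<in> \<int>"
    then have "(x $ i - y $ i) + (y $ i - z $ i) \<in> \<int>" by (intro Ints_add) auto
    then show "x $ i - z $ i \<in> \<int>" by simp
  qed
qed

lemma torus_of_eq_iff: "torus_of x = torus_of y \<longleftrightarrow> (\<forall>i. x $ i - y $ i \<in> \<int>)"
  using torus.abs_eq_iff[of x y] by simp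

lemma torus_of_surj: obtains a where "torus_of a = x"
  using Quotient3_abs_rep[OF Quotient3_torus] by blast

lemma torus_rel_add:
  fixes a b c d :: "real^'n"
  assumes "\<And>i. a $ i - b $ i \<in> \<int>" "\<And>i. c $ i - d $ i \<in> \<int>"
  shows "(a + c) $ i - (b + d) $ i \<in> \<int>"
  using Ints_add[OF assms(1)[of i] assms(2)[of i]] by (simp add: algebra_simps)

lemma torus_rel_diff:
  fixes a b c d :: "real^'n"
  assumes "\<And>i. a $ i - b $ i \<in> \<int>" "\<And>i. c $ i - d $ i \<in> \<int>"
  shows "(a - c) $ i - (b - d) $ i \<in> \<int>"
  using Ints_diff[OF assms(1)[of i] assms(2)[of i]] by (simp add: algebra_simps)

lemma torus_rel_uminus:
  fixes a b :: "real^'n"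
  assumes "\<And>i. a $ i - b $ i \<in> \<int>"
  shows "(- a) $ i - (- b) $ i \<in> \<int>"
  using Ints_minus[OF assms[of i]] by simp

instantiation torus :: (finite) ab_group_add
begin

lift_definition zero_torus :: "'a torus" is 0 .

lift_definition plus_torus :: "'a torus \<Rightarrow> 'a torus \<Rightarrow> 'a torus" is "(+)"
  by (rule torus_rel_add)

lift_definition uminus_torus :: "'a torus \<Rightarrow> 'a torus" is uminus
  by (rule torus_rel_uminus)

lift_definition minus_torus :: "'a torus \<Rightarrow> 'a torus \<Rightarrow> 'a torus" is "(-)"
  by (rule torus_rel_diff)

instance
proof
  fix a b c :: "'a torus"
  show "a + b + c = a + (b + c)" by transfer (simp add: add.assoc)
  show "a + b = b + a" by transfer (simp add: add.commute)
  show "0 + a = a" by transfer simp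
  show "- a + a = 0" by transfer simp
  show "a - b = a + - b" by transfer simp
qed

end

instantiation torus :: (finite) metric_space
begin

definition dist_torus :: "'a torus \<Rightarrow> 'a torus \<Rightarrow> real" where
  "dist_torus x y = Inf {norm (a - b) | a b. torus_of a = x \<and> torus_of b = y}"

definition uniformity_torus :: "('a torus \<times> 'a torus) filter" where
  "uniformity_torus = (INF e\<in>{0<..}. principal {(x, y). dist x y < e})"

definition open_torus :: "'a torus set \<Rightarrow> bool" where
  "open_torus U \<longleftrightarrow> (\<forall>x\<in>U. \<forall>\<^sub>F (x', y) in uniformity. x' = x \<longrightarrow> y \<in> U)"

lemma dist_torus_lower:
  "torus_of a = x \<Longrightarrow> torus_of b = y \<Longrightarrow> dist x y \<le> norm (a - b)"
  unfolding dist_torus_def by (rule cInf_lower) (auto intro!: bdd_belowI[of _ 0])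

lemma dist_torus_approx:
  fixes x y :: "'a torus"
  assumes "0 < r"
  obtains a b where "torus_of a = x" "torus_of b = y" "norm (a - b) < dist x y + r"
proof -
  let ?S = "{norm (a - b) | a b. torus_of a = x \<and> torus_of b = y}"
  obtain a0 where "torus_of a0 = x" by (rule torus_of_surj)
  moreover obtain b0 where "torus_of b0 = y" by (rule torus_of_surj)
  ultimately have "?S \<noteq> {}" by blast
  moreover have "Inf ?S < dist x y + r" using assms by (simp add: dist_torus_def)
  ultimately obtain t where "t \<in> ?S" "t < dist x y + r"
    using cInf_lessD[of ?S "dist x y + r"] by blast
  then show ?thesis using that by auto
qed

instance
proof
  fix x y z :: "'a torus"
  show "dist x y = 0 \<longleftrightarrow> x = y"
  proof
    assume "x = y"
    obtain a where a: "torus_of a = x" by (rule torus_of_surj)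
    have "0 \<le> dist x x" unfolding dist_torus_def
      by (rule cInf_greatest) (use a in auto)
    with dist_torus_lower[OF a a] \<open>x = y\<close> show "dist x y = 0" by simp
  next
    assume d0: "dist x y = 0"
    obtain a where a: "torus_of a = x" by (rule torus_of_surj)
    obtain b where b: "torus_of b = y" by (rule torus_of_surj)
    have "a $ i - b $ i \<in> \<int>" for i
    proof (rule ccontr)
      let ?t = "a $ i - b $ i"
      assume nt: "?t \<notin> \<int>"
      define r where "r = min (frac ?t) (1 - frac ?t)"
      have "r > 0" unfolding r_def using nt frac_lt_1[of ?t] by simp
      then obtain a' b' where ab: "torus_of a' = x" "torus_of b' = y" "norm (a' - b') < r"
        using dist_torus_approx[of r x y] d0 by auto
      have "a $ i - a' $ i \<in> \<int>" "b $ i - b' $ i \<in> \<int>"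
        using ab a b torus_of_eq_iff[of a a'] torus_of_eq_iff[of b b'] by auto
      then have "(a $ i - a' $ i) - (b $ i - b' $ i) \<in> \<int>" by (rule Ints_diff)
      then obtain k where k: "?t - (a' $ i - b' $ i) = of_int k"
        by (auto elim!: Ints_cases simp: algebra_simps)
      have "\<bar>a' $ i - b' $ i\<bar> < r"
        using ab(3) component_le_norm_cart[of "a' - b'" i] by simp
      then have "\<bar>?t - of_int k\<bar> < r" using k by linarith
      moreover have "?t = of_int \<lfloor>?t\<rfloor> + frac ?t" by (simp add: frac_def)
      ultimately have *: "\<bar>of_int (\<lfloor>?t\<rfloor> - k) + frac ?t\<bar> < r" by simp
      show False
      proof (cases "\<lfloor>?t\<rfloor> - k \<ge> 0")
        case True
        then have "(of_int (\<lfloor>?t\<rfloor> - k) :: real) \<ge> 0" by (simp only: of_int_0_le_iff)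
        then show False using * frac_ge_0[of ?t] unfolding r_def by linarith
      next
        case False
        then have "\<lfloor>?t\<rfloor> - k \<le> -1" by simp
        then have "(of_int (\<lfloor>?t\<rfloor> - k) :: real) \<le> of_int (-1)" by (simp only: of_int_le_iff)
        then show False using * frac_lt_1[of ?t] unfolding r_def by simp
      qed
    qed
    then show "x = y" using a b torus_of_eq_iff by blast
  qed
  show "dist x y \<le> dist x z + dist y z"
  proof (rule field_le_epsilon)
    fix e :: real assume "0 < e"
    then have e: "e / 2 > 0" by simp
    obtain a c where 1: "torus_of a = x" "torus_of c = z" "norm (a - c) < dist x z + e / 2"
      by (rule dist_torus_approx[OF e])
    obtain b c' where 2: "torus_of b = y" "torus_of c' = z" "norm (b - c') < dist y z + e / 2"
      by (rule dist_torus_approx[OF e])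
    have "torus_of c = torus_of c'" using 1 2 by simp
    then have "torus_of (b + (c - c')) = y"
      unfolding 2(1)[symmetric] by (simp add: torus_of_eq_iff)
    then have "dist x y \<le> norm (a - (b + (c - c')))"
      by (intro dist_torus_lower 1)
    also have "\<dots> = norm ((a - c) - (b - c'))" by (simp add: algebra_simps)
    also have "\<dots> \<le> norm (a - c) + norm (b - c')" by (rule norm_triangle_ineq4)
    finally show "dist x y \<le> dist x z + dist y z + e" using 1(3) 2(3) by simp
  qed
qed (simp_all add: uniformity_torus_def open_torus_def)

end

definition unit_cube :: "(real^'n) set" where
  "unit_cube = {x. \<forall>i. 0 \<le> x $ i \<and> x $ i < 1}"

definition check :: "'n::finite torus \<Rightarrow> real^'n" where
  "check x = (THE y. y \<in> unit_cube \<and> torus_of y = x)"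

text \<open>The representative in \<open>[-1/2, 1/2)\<^sup>d\<close>, through which the mean of torus-valued noise
  concentrated near \<open>0\<close> is understood.\<close>

definition centered :: "'n::finite torus \<Rightarrow> real^'n" where
  "centered x = (THE y. (\<forall>i. - 1/2 \<le> y $ i \<and> y $ i < 1/2) \<and> torus_of y = x)"

lemma check_ex1: "\<exists>!y. y \<in> unit_cube \<and> torus_of y = x"
proof -
  obtain a where a: "torus_of a = x" by (rule torus_of_surj)
  show ?thesis
  proof (rule ex1I[of _ "\<chi> i. frac (a $ i)"], goal_cases)
    case 1
    have "frac t - t \<in> \<int>" for t :: real by (simp add: frac_def)
    then show ?case
      by (auto simp: unit_cube_def frac_lt_1 a[symmetric] torus_of_eq_iff)
  next
    case (2 y)
    then have y: "0 \<le> y $ i" "y $ i < 1" "a $ i - y $ i \<in> \<int>" for i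
      using 2 a torus_of_eq_iff[of a y] by (auto simp: unit_cube_def)
    have "frac (a $ i) = y $ i" for i
      using y[of i] by (subst frac_unique_iff) auto
    then show ?case by (simp add: vec_eq_iff)
  qed
qed

lemma check_in_unit_cube: "check x \<in> unit_cube"
  and torus_of_check: "torus_of (check x) = x"
  using theI'[OF check_ex1[of x]] by (auto simp: check_def)

lemma centered_ex1:
  "\<exists>!y. (\<forall>i. - 1/2 \<le> y $ i \<and> y $ i < 1/2) \<and> torus_of y = x"
proof -
  obtain a where a: "torus_of a = x" by (rule torus_of_surj)
  show ?thesis
  proof (rule ex1I[of _ "\<chi> i. frac (a $ i + 1/2) - 1/2"], goal_cases)
    case 1
    have "frac (t + 1/2) - 1/2 - t \<in> \<int>" for t :: real by (simp add: frac_def)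
    moreover have "frac (t + 1/2) - 1/2 < 1/2" for t :: real
      using frac_lt_1[of "t + 1/2"] by linarith
    ultimately show ?case
      by (auto simp: a[symmetric] torus_of_eq_iff)
  next
    case (2 y)
    then have y: "- 1/2 \<le> y $ i" "y $ i < 1/2" "a $ i - y $ i \<in> \<int>" for i
      using 2 a torus_of_eq_iff[of a y] by auto
    have "frac (a $ i + 1/2) = y $ i + 1/2" for i
      using y[of i] by (subst frac_unique_iff) auto
    then show ?case by (simp add: vec_eq_iff)
  qed
qed

definition torus_measure :: "'n::finite torus measure" where
  "torus_measure = distr (restrict_space lborel unit_cube) borel torus_of"

lemma torus_of_measurable: "torus_of \<in> borel_measurable borel"
proof (rule borel_measurable_continuous_onI)
  show "continuous_on UNIV (torus_of :: real^'n \<Rightarrow> _)"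
    unfolding continuous_on_iff
    by (auto intro!: exI order_le_less_trans[OF dist_torus_lower[OF refl refl]] simp: dist_norm)
qed

lemma unit_cube_bounds: "box 0 1 \<subseteq> (unit_cube :: (real^'n) set)" "unit_cube \<subseteq> cbox 0 (1 :: real^'n)"
  by (auto simp: unit_cube_def mem_box_cart less_imp_le)

lemma emeasure_unit_cube: "emeasure lborel (unit_cube :: (real^'n) set) = 1"
  and unit_cube_borel: "(unit_cube :: (real^'n) set) \<in> sets borel"
proof -
  have "(unit_cube :: (real^'n) set) = (\<Inter>i. {x. 0 \<le> x $ i} \<inter> {x. x $ i < 1})"
    by (auto simp: unit_cube_def)
  also have "\<dots> \<in> sets borel"
    by (intro sets.finite_INT sets.Int borel_closed borel_open closed_halfspace_component_ge_cart
        open_halfspace_component_lt_cart) auto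
  finally show b: "(unit_cube :: (real^'n) set) \<in> sets borel" .
  have "(\<Prod>b\<in>Basis. (1 - 0 :: real^'n) \<bullet> b) = 1"
    by (intro prod.neutral) (auto simp: Basis_vec_def inner_axis)
  moreover have "\<forall>b\<in>Basis. (0::real^'n) \<bullet> b \<le> 1 \<bullet> b"
    by (auto simp: Basis_vec_def inner_axis)
  ultimately have "emeasure lborel (box 0 (1::real^'n)) = 1" "emeasure lborel (cbox 0 (1::real^'n)) = 1"
    by (simp_all add: emeasure_lborel_box_eq emeasure_lborel_cbox_eq)
  moreover have "emeasure lborel (box 0 (1::real^'n)) \<le> emeasure lborel (unit_cube :: (real^'n) set)"
    "emeasure lborel (unit_cube :: (real^'n) set) \<le> emeasure lborel (cbox 0 (1::real^'n))"
    using b by (auto intro!: emeasure_mono unit_cube_bounds)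
  ultimately show "emeasure lborel (unit_cube :: (real^'n) set) = 1"
    by (simp add: antisym)
qed

lemma prob_space_torus_measure: "prob_space (torus_measure :: 'n::finite torus measure)"
  unfolding torus_measure_def
proof (rule prob_space.prob_space_distr)
  show "prob_space (restrict_space lborel (unit_cube :: (real^'n) set))"
    by (rule prob_space_restrict_space) (simp_all add: unit_cube_borel emeasure_unit_cube)
  show "torus_of \<in> restrict_space lborel unit_cube \<rightarrow>\<^sub>M (borel :: 'n torus measure)"
    by (rule measurable_restrict_space1) (simp add: torus_of_measurable)
qed

definition int_vec :: "int^'n \<Rightarrow> real^'n" where
  "int_vec k = (\<chi> i. of_int (k $ i))"

definition fourier_coeff :: "('n::finite torus \<Rightarrow> real) \<Rightarrow> int^'n \<Rightarrow> complex" where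
  "fourier_coeff K k =
     (\<integral>x. of_real (K x) * exp (- 2 * of_real pi * \<i> * of_real (int_vec k \<bullet> check x)) \<partial>torus_measure)"

section \<open>Piecewise affine linear Bernoulli maps\<close>

text \<open>Each side of a cube may independently contain or omit its end points.\<close>

definition axis_cube :: "(real^'n) set \<Rightarrow> bool" where
  "axis_cube S \<longleftrightarrow> (\<exists>J a l. l > 0 \<and> S = {x. \<forall>i. x $ i \<in> J i} \<and>
     (\<forall>i. is_interval (J i) \<and> closure (J i) = {a i..a i + l}))"

definition branch_measure :: "(nat \<Rightarrow> (real^'n) set) \<Rightarrow> nat \<Rightarrow> real" where
  "branch_measure E i = measure lborel (E i)"

definition p_min :: "nat \<Rightarrow> (nat \<Rightarrow> (real^'n) set) \<Rightarrow> real" where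
  "p_min M E = Min (branch_measure E ` {1..M})"

definition p_max :: "nat \<Rightarrow> (nat \<Rightarrow> (real^'n) set) \<Rightarrow> real" where
  "p_max M E = Max (branch_measure E ` {1..M})"

definition affine_branch ::
  "(nat \<Rightarrow> (real^'n) set) \<Rightarrow> (nat \<Rightarrow> real^'n^'n) \<Rightarrow> (nat \<Rightarrow> real^'n) \<Rightarrow> nat \<Rightarrow> real^'n \<Rightarrow> real^'n" where
  "affine_branch E D e i x =
     branch_measure E i powr (- 1 / real CARD('n)) *\<^sub>R (D i *v x) + e i"

definition bernoulli_data ::
  "nat \<Rightarrow> (nat \<Rightarrow> (real^'n) set) \<Rightarrow> (nat \<Rightarrow> real^'n^'n) \<Rightarrow> (nat \<Rightarrow> real^'n) \<Rightarrow> bool" where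
  "bernoulli_data M E D e \<longleftrightarrow>
     2 \<le> M \<and>
     disjoint_family_on E {1..M} \<and> (\<Union>i\<in>{1..M}. E i) = unit_cube \<and>
     (\<forall>i\<in>{1..M}.
        (CARD('n) = 1 \<longrightarrow> is_interval (E i)) \<and>
        (CARD('n) > 1 \<longrightarrow> axis_cube (E i)) \<and>
        0 < branch_measure E i \<and> branch_measure E i < 1 \<and>
        orthogonal_matrix (D i) \<and>
        bij_betw (affine_branch E D e i) (E i) unit_cube)"

definition torus_branch ::
  "(nat \<Rightarrow> (real^'n) set) \<Rightarrow> (nat \<Rightarrow> real^'n^'n) \<Rightarrow> (nat \<Rightarrow> real^'n) \<Rightarrow> nat \<Rightarrow> 'n::finite torus \<Rightarrow> 'n torus" where
  "torus_branch E D e i x = torus_of (affine_branch E D e i (check x))"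

definition bernoulli_map ::
  "nat \<Rightarrow> (nat \<Rightarrow> (real^'n) set) \<Rightarrow> (nat \<Rightarrow> real^'n^'n) \<Rightarrow> (nat \<Rightarrow> real^'n) \<Rightarrow> 'n::finite torus \<Rightarrow> 'n torus" where
  "bernoulli_map M E D e x =
     torus_branch E D e (THE i. i \<in> {1..M} \<and> x \<in> torus_of ` E i) x"

definition cylinder ::
  "nat \<Rightarrow> (nat \<Rightarrow> (real^'n) set) \<Rightarrow> (nat \<Rightarrow> real^'n^'n) \<Rightarrow> (nat \<Rightarrow> real^'n) \<Rightarrow> nat list \<Rightarrow> 'n::finite torus set" where
  "cylinder M E D e s =
     {x. \<forall>n<length s. (bernoulli_map M E D e ^^ n) x \<in> torus_of ` E (s ! n)}"

definition cubes_assumption ::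
  "nat \<Rightarrow> (nat \<Rightarrow> (real^'n) set) \<Rightarrow> (nat \<Rightarrow> real^'n^'n) \<Rightarrow> (nat \<Rightarrow> real^'n::finite) \<Rightarrow> bool" where
  "cubes_assumption M E D e \<longleftrightarrow>
     (\<forall>i\<in>{1..M}. bij_betw (torus_branch E D e i) (torus_of ` E i) UNIV) \<and>
     (\<forall>x\<in>frontier (cbox 0 1). \<exists>i\<in>{1..M}. \<exists>y\<in>box 0 1. affine_branch E D e i y = x) \<and>
     (CARD('n) \<ge> 2 \<longrightarrow> (\<forall>s\<in>lists {1..M}. axis_cube (check ` cylinder M E D e s)))"

section \<open>The Markov process and its dissipation time\<close>

text \<open>\<open>markov_chain \<phi> \<xi> x\<close> is the process started at \<open>x\<close>; since the noise is independent of
  the initial state, the conditional expectation \<open>E(\<theta>(X\<^sub>n) | X\<^sub>0 = x)\<close> is the plain expectation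
  of \<open>\<theta>\<close> along it.\<close>

primrec markov_chain ::
  "('n::finite torus \<Rightarrow> 'n torus) \<Rightarrow> (nat \<Rightarrow> 'w \<Rightarrow> 'n torus) \<Rightarrow> 'n torus \<Rightarrow> nat \<Rightarrow> 'w \<Rightarrow> 'n torus" where
  "markov_chain \<phi> \<xi> x 0 \<omega> = x"
| "markov_chain \<phi> \<xi> x (Suc n) \<omega> = \<phi> (markov_chain \<phi> \<xi> x n \<omega>) + \<xi> (Suc n) \<omega>"

definition noise_process ::
  "'w measure \<Rightarrow> (nat \<Rightarrow> 'w \<Rightarrow> 'n::finite torus) \<Rightarrow> ('n torus \<Rightarrow> real) \<Rightarrow> bool" where
  "noise_process P \<xi> K \<longleftrightarrow>
     prob_space P \<and>
     prob_space.indep_vars P (\<lambda>_. borel) \<xi> {1..} \<and>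
     (\<forall>x. 0 \<le> K x) \<and>
     (\<forall>n\<ge>1. distributed P torus_measure (\<xi> n) (\<lambda>x. ennreal (K x))) \<and>
     (\<forall>n\<ge>1. (\<integral>\<omega>. centered (\<xi> n \<omega>) \<partial>P) = 0)"

definition evolve ::
  "'w measure \<Rightarrow> ('n::finite torus \<Rightarrow> 'n torus) \<Rightarrow> (nat \<Rightarrow> 'w \<Rightarrow> 'n torus) \<Rightarrow> ('n torus \<Rightarrow> real) \<Rightarrow> nat \<Rightarrow> 'n torus \<Rightarrow> real" where
  "evolve P \<phi> \<xi> \<theta> n x = (\<integral>\<omega>. \<theta> (markov_chain \<phi> \<xi> x n \<omega>) \<partial>P)"

definition L2_norm :: "('n::finite torus \<Rightarrow> real) \<Rightarrow> real" where
  "L2_norm \<theta> = sqrt (\<integral>x. (\<theta> x)\<^sup>2 \<partial>torus_measure)"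

definition L2_mean_zero :: "('n::finite torus \<Rightarrow> real) set" where
  "L2_mean_zero = {\<theta> \<in> borel_measurable torus_measure.
     integrable torus_measure (\<lambda>x. (\<theta> x)\<^sup>2) \<and> (\<integral>x. \<theta> x \<partial>torus_measure) = 0}"

text \<open>Extended natural numbers make the minimum over the empty set \<open>\<infinity>\<close>.\<close>

definition dissipation_time ::
  "'w measure \<Rightarrow> ('n::finite torus \<Rightarrow> 'n torus) \<Rightarrow> (nat \<Rightarrow> 'w \<Rightarrow> 'n torus) \<Rightarrow> real \<Rightarrow> enat" where
  "dissipation_time P \<phi> \<xi> \<delta> =
     Inf (enat ` {n. \<forall>\<theta>\<in>L2_mean_zero. L2_norm (evolve P \<phi> \<xi> \<theta> n) \<le> \<delta> * L2_norm \<theta>})"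

text \<open>The bound on the Fourier coefficients beyond \<open>c / \<epsilon>\<close> is required uniformly in small \<open>\<epsilon>\<close>.
  For a single \<open>\<epsilon>\<close> it would say nothing: the Fourier coefficients of a probability density at
  nonzero frequencies have modulus below \<open>1\<close> and tend to \<open>0\<close>.\<close>

definition high_frequency_gap :: "(real \<Rightarrow> 'n::finite torus \<Rightarrow> real) \<Rightarrow> bool" where
  "high_frequency_gap K \<longleftrightarrow>
     (\<forall>c>0. \<exists>\<rho><1. \<forall>\<^sub>F \<epsilon> in at_right 0.
        (SUP k\<in>{k. norm (int_vec k) > c / \<epsilon>}. cmod (fourier_coeff (K \<epsilon>) k)) \<le> \<rho>)"

end

theory Submission
  imports Defs
begin

text \<open>
  The function \<open>x \<mapsto> E(\<theta>(X\<^sub>n) | X\<^sub>0 = x)\<close> is the \<open>n\<close>-th iterate of \<open>step = U K\<close>, applied to \<open>\<theta>\<close>, where \<open>K\<close>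
  averages over one noise variable and \<open>U\<close> is composition with the map (\<open>integral_markov_chain\<close>).
  As \<open>U\<close> preserves the \<open>L\<^sup>2\<close> norm, energy (the square of the norm) is lost only under \<open>K\<close>. In Fourier
  space \<open>K\<close> multiplies by \<open>multiplier \<nu> k\<close>. Frequencies above \<open>c / \<epsilon>\<close> lose energy at a fixed rate by
  the assumed gap, and since the noise has mean zero, \<open>|1 - multiplier \<nu> k|\<close> is bounded by a multiple of
  \<open>1 - |multiplier \<nu> k|\<^sup>2\<close> at all frequencies (\<open>multiplier_displacement_bound\<close>).

  Upper bound. Refine the partition of the torus into cylinders until their sides are about \<open>r\<close>, and
  let \<open>A\<^sub>r\<close> average over these cells. The map blows each cell up by a factor of at least
  \<open>1 / smax\<close>, where \<open>smin\<close> and \<open>smax\<close> are the side lengths of cubes of volume \<open>p_min\<close> and \<open>p_max\<close>, so \<open>A\<^sub>r U\<close>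
  is governed by averages over larger cells, and without noise the averages of a function of mean zero
  would vanish after about \<open>ln r / ln smax\<close> steps. The noise adds the error \<open>A\<^sub>r (K - 1) f\<close> in each step. It
  is small for two reasons that combine by Cauchy-Schwarz: \<open>A\<^sub>r\<close> projects to step functions on cells, which
  the noise changes only in layers of width \<open>\<epsilon>\<close> at the cell boundaries, and \<open>K - 1\<close> is controlled by
  the loss of energy. The result is a bound by \<open>sqrt (\<epsilon> / r)\<close> times the square root of the loss
  (\<open>norm_cell_average_displacement\<close>). Over the steps, in which \<open>r\<close> grows geometrically, these errors
  add up to a geometrically weighted sum of recent losses (\<open>norm_cell_average_steps\<close>). On the other hand,
  a function with small averages over cells of size \<open>\<epsilon>\<close> has mostly high frequencies and loses energy
  (\<open>norm_le_cell_average_loss\<close>). Hence for \<open>N\<close> close to \<open>ln \<epsilon> / ln smax\<close> the energy at each time \<open>N + m\<close> is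
  bounded by a geometrically weighted sum of the losses up to that time. Since no more than the
  initial energy can be lost, the energy at time \<open>N + k\<close> is at most a constant divided by \<open>k + 1\<close>
  (\<open>energy_decay\<close>), and \<open>k\<close> of order \<open>1 / \<delta>\<^sup>2\<close> suffices.

  Lower bound. The map expands by at most \<open>1 / smin\<close>. While \<open>\<epsilon>\<close> times \<open>(1 / smin)\<^sup>n\<close> is small, the process
  stays close to the deterministic orbit, except for starting points that come near a discontinuity; these
  have small measure. So a character of frequency \<open>1\<close> keeps a share of its norm close to \<open>1\<close>
  (\<open>norm_steps_character_ge\<close>).

  Cells are not treated as sets. Each cylinder is a similar image of the unit cube, and all
  estimates on cells are proved by recursion on the refinement, zooming into one cube of the
  first generation at a time and using that both sides scale in the same way.
\<close>

section \<open>Lebesgue measure and characters on the torus\<close>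

lemma torus_of_add: "torus_of (a + b) = torus_of a + torus_of b"
  by (simp add: plus_torus.abs_eq)

lemma torus_of_uminus: "torus_of (- a) = - torus_of a"
  by (simp add: uminus_torus.abs_eq)

lemma torus_of_0: "torus_of 0 = 0"
  by (simp add: zero_torus_def)

lemma check_torus_of: "y \<in> unit_cube \<Longrightarrow> check (torus_of y) = y"
  using check_ex1[of "torus_of y"] check_in_unit_cube torus_of_check by blast

lemma sets_torus_measure [measurable_cong, simp]: "sets torus_measure = sets borel"
  by (simp add: torus_measure_def)

lemma space_torus_measure [simp]: "space torus_measure = UNIV"
  by (simp add: torus_measure_def)

lemmas [measurable] = torus_of_measurable unit_cube_borel

interpretation torus: prob_space torus_measure
  by (rule prob_space_torus_measure)

lemma continuous_torus_of: "continuous_on UNIV (torus_of :: real^'n \<Rightarrow> 'n torus)"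
  unfolding continuous_on_iff
  by (auto intro!: exI order_le_less_trans[OF dist_torus_lower[OF refl refl]] simp: dist_norm)

lemma compact_torus: "compact (UNIV :: 'n::finite torus set)"
proof -
  have "compact (torus_of ` cbox 0 (1 :: real^'n))"
    by (intro compact_continuous_image continuous_on_subset[OF continuous_torus_of]) auto
  moreover have "torus_of ` cbox 0 (1 :: real^'n) = UNIV"
  proof -
    have "x \<in> torus_of ` cbox 0 1" for x :: "'n torus"
      using check_in_unit_cube[of x] unit_cube_bounds(2) torus_of_check[of x] by (metis image_eqI subsetD)
    then show ?thesis by blast
  qed
  ultimately show ?thesis by simp
qed

lemma check_measurable [measurable]: "check \<in> borel_measurable borel"
  unfolding borel_measurable_iff_halfspace_le
proof (intro ballI allI)
  fix b :: "real^'n" and a :: real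
  define C where "C = {x :: real^'n. x \<bullet> b \<le> a}"
  have C: "closed C" unfolding C_def by (simp add: closed_halfspace_component_le inner_commute[of _ b] closed_halfspace_le)
  define B where "B n = cbox 0 (\<chi> i. 1 - 1 / real (Suc n) :: real^'n)" for n
  have U: "unit_cube = (\<Union>n. B n)"
  proof (intro equalityI subsetI)
    fix x :: "real^'n" assume x: "x \<in> unit_cube"
    define m where "m = Min (range (\<lambda>i. 1 - x $ i))"
    have "m > 0" using x by (auto simp: m_def unit_cube_def)
    then obtain n where n: "1 / real (Suc n) < m" by (meson nat_approx_posE)
    have "m \<le> 1 - x $ i" for i by (auto simp: m_def)
    then have "x $ i \<le> 1 - 1 / real (Suc n)" for i using n by (smt (verit))
    then show "x \<in> (\<Union>n. B n)" using x by (auto simp: B_def mem_box_cart unit_cube_def intro!: exI[of _ n])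
  next
    fix x :: "real^'n" assume "x \<in> (\<Union>n. B n)"
    then obtain n where n: "\<And>i. 0 \<le> x $ i" "\<And>i. x $ i \<le> 1 - 1 / real (Suc n)"
      by (auto simp: B_def mem_box_cart)
    have "x $ i < 1" for i
    proof -
      have "1 / real (Suc n) > 0" by simp
      then show ?thesis using n(2)[of i] by linarith
    qed
    then show "x \<in> unit_cube" using n(1) by (auto simp: unit_cube_def)
  qed
  have "{w \<in> space borel. check w \<bullet> b \<le> a} = torus_of ` (C \<inter> unit_cube)"
  proof (intro equalityI subsetI)
    fix w :: "'n torus" assume "w \<in> {w \<in> space borel. check w \<bullet> b \<le> a}"
    then show "w \<in> torus_of ` (C \<inter> unit_cube)"
      using check_in_unit_cube[of w] by (intro image_eqI[of _ _ "check w"]) (auto simp: C_def torus_of_check)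
  qed (auto simp: C_def check_torus_of)
  also have "\<dots> = (\<Union>n. torus_of ` (C \<inter> B n))" unfolding U by blast
  also have "\<dots> \<in> sets borel"
  proof (intro sets.countable_UN subsetI, clarify)
    fix n
    have "compact (C \<inter> B n)" unfolding B_def by (rule closed_Int_compact[OF C compact_cbox])
    then have "compact (torus_of ` (C \<inter> B n))"
      by (rule compact_continuous_image[rotated]) (rule continuous_on_subset[OF continuous_torus_of], simp)
    then show "torus_of ` (C \<inter> B n) \<in> sets borel" by (intro borel_closed compact_imp_closed)
  qed
  finally show "{w \<in> space borel. check w \<bullet> b \<le> a} \<in> sets borel" .
qed

lemma torus_add_measurable:
  "(\<lambda>p. fst p + snd p :: 'n::finite torus) \<in> borel_measurable (borel \<Otimes>\<^sub>M borel)"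
proof -
  have "(\<lambda>p. torus_of (check (fst p) + check (snd p)) :: 'n torus) \<in> borel_measurable (borel \<Otimes>\<^sub>M borel)"
    by measurable
  then show ?thesis by (simp add: torus_of_add torus_of_check)
qed

lemma torus_add_measurable' [measurable (raw)]:
  fixes f g :: "'a \<Rightarrow> 'n::finite torus"
  assumes [measurable]: "f \<in> borel_measurable M" "g \<in> borel_measurable M"
  shows "(\<lambda>x. f x + g x) \<in> borel_measurable M"
  using measurable_compose[OF measurable_Pair[OF assms] torus_add_measurable] by simp

lemma nn_integral_torus:
  assumes [measurable]: "f \<in> borel_measurable borel"
  shows "(\<integral>\<^sup>+x. f x \<partial>torus_measure) = (\<integral>\<^sup>+y. f (torus_of y) * indicator unit_cube y \<partial>lborel)"
  unfolding torus_measure_def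
  by (subst nn_integral_distr) (auto simp: nn_integral_restrict_space measurable_restrict_space1)

lemma nn_integral_lborel_shift:
  fixes f :: "real^'n \<Rightarrow> ennreal"
  assumes [measurable]: "f \<in> borel_measurable borel"
  shows "(\<integral>\<^sup>+y. f y \<partial>lborel) = (\<integral>\<^sup>+y. f (a + y) \<partial>lborel)"
proof -
  have "(\<integral>\<^sup>+y. f y \<partial>lborel) = (\<integral>\<^sup>+y. f y \<partial>distr lborel borel ((+) a))"
    by (simp add: lborel_distr_plus)
  then show ?thesis by (simp add: nn_integral_distr)
qed

text \<open>Translation by \<open>a\<close> cuts \<open>a + [0, 1)\<^sup>d\<close> by the unit lattice into \<open>2\<^sup>d\<close> pieces, one for each
  vector of zeros and ones, and the lattice translations put them together again to \<open>[0, 1)\<^sup>d\<close>.\<close>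

lemma nn_integral_torus_shift:
  fixes f :: "'n::finite torus \<Rightarrow> ennreal"
  assumes [measurable]: "f \<in> borel_measurable borel"
  shows "(\<integral>\<^sup>+x. f (x + w) \<partial>torus_measure) = (\<integral>\<^sup>+x. f x \<partial>torus_measure)"
proof -
  define a where "a = check w"
  have a: "0 \<le> a $ i" "a $ i < 1" for i using check_in_unit_cube[of w] by (auto simp: a_def unit_cube_def)
  define v :: "'n set \<Rightarrow> real^'n" where "v A = (\<chi> i. if i \<in> A then 1 else 0)" for A
  have vp: "torus_of (v A + y) = torus_of y" for A y
    by (auto simp: torus_of_eq_iff v_def)
  have one: "(\<Sum>A\<in>UNIV. indicator unit_cube (y - v A)) = (1::ennreal)"
    if y: "\<And>i. 0 \<le> y $ i" "\<And>i. y $ i < 2" for y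
  proof -
    define A0 where "A0 = {i. 1 \<le> y $ i}"
    have "y - v A \<in> unit_cube \<longleftrightarrow> A = A0" for A
    proof
      assume "y - v A \<in> unit_cube"
      then have *: "0 \<le> y $ i - (if i \<in> A then 1 else 0)" "y $ i - (if i \<in> A then 1 else 0) < 1" for i
        by (auto simp: unit_cube_def v_def)
      show "A = A0"
      proof (rule set_eqI)
        fix i show "i \<in> A \<longleftrightarrow> i \<in> A0" using *[of i] by (auto simp: A0_def split: if_splits)
      qed
    next
      assume "A = A0" then show "y - v A \<in> unit_cube"
        using y by (auto simp: unit_cube_def v_def A0_def not_le algebra_simps)
    qed
    then have "(\<Sum>A\<in>UNIV. indicator unit_cube (y - v A)) = (\<Sum>A\<in>UNIV. if A = A0 then 1 else (0::ennreal))"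
      by (intro sum.cong) (auto simp: indicator_def)
    then show ?thesis by simp
  qed
  have one': "(\<Sum>A\<in>UNIV. indicator unit_cube (v A + y - a)) = (1::ennreal)" if "y \<in> unit_cube" for y
  proof -
    have "bij (\<lambda>A :: 'n set. - A)" by (rule o_bij[of uminus]) auto
    then have "(\<Sum>A\<in>UNIV. indicator unit_cube (v A + y - a)) = (\<Sum>A\<in>UNIV. indicator unit_cube (v (- A) + y - a) :: ennreal)"
      by (rule sum.reindex_bij_betw[symmetric])
    also have "\<dots> = (\<Sum>A\<in>UNIV. indicator unit_cube ((y - a + (\<chi> i. 1)) - v A))"
    proof (intro sum.cong refl)
      fix A show "indicator unit_cube (v (- A) + y - a) = (indicator unit_cube ((y - a + (\<chi> i. 1)) - v A) :: ennreal)"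
        by (rule arg_cong[where f = "indicator unit_cube"]) (auto simp: v_def vec_eq_iff)
    qed
    also have "(\<Sum>A\<in>UNIV. indicator unit_cube ((y - a + (\<chi> i. 1)) - v A)) = (1::ennreal)"
    proof (rule one)
      fix i show "0 \<le> (y - a + (\<chi> i. 1)) $ i" "(y - a + (\<chi> i. 1)) $ i < 2"
        using that a[of i] by (auto simp: unit_cube_def dest!: spec[of _ i])
    qed
    finally show ?thesis by simp
  qed
  have [measurable]: "(\<lambda>x. f (x + w)) \<in> borel_measurable borel" by measurable
  have m: "(\<lambda>x. f (torus_of x)) \<in> borel_measurable borel" by measurable
  have "(\<integral>\<^sup>+x. f (x + w) \<partial>torus_measure)
      = (\<integral>\<^sup>+y. f (torus_of (a + y)) * indicator unit_cube y \<partial>lborel)"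
    by (simp add: nn_integral_torus torus_of_add a_def torus_of_check add.commute)
  also have "\<dots> = (\<integral>\<^sup>+y. f (torus_of y) * indicator unit_cube (y - a) \<partial>lborel)"
    by (subst (2) nn_integral_lborel_shift[of _ a]) auto
  also have "\<dots> = (\<integral>\<^sup>+y. (\<Sum>A\<in>UNIV. f (torus_of y) * indicator unit_cube (y - a) * indicator unit_cube (y - v A)) \<partial>lborel)"
  proof (intro nn_integral_cong)
    fix y :: "real^'n"
    have "indicator unit_cube (y - a) * (\<Sum>A\<in>UNIV. indicator unit_cube (y - v A)) = (indicator unit_cube (y - a) :: ennreal)"
    proof (cases "y - a \<in> unit_cube")
      case True
      then have "0 \<le> y $ i" "y $ i < 2" for i using a[of i] by (auto simp: unit_cube_def dest!: spec[of _ i])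
      then show ?thesis by (simp add: one)
    qed simp
    then show "f (torus_of y) * indicator unit_cube (y - a) = (\<Sum>A\<in>UNIV. f (torus_of y) * indicator unit_cube (y - a) * indicator unit_cube (y - v A))"
      by (simp only: sum_distrib_left[symmetric] mult.assoc)
  qed
  also have "\<dots> = (\<Sum>A\<in>UNIV. \<integral>\<^sup>+y. f (torus_of y) * indicator unit_cube (y - a) * indicator unit_cube (y - v A) \<partial>lborel)"
    by (intro nn_integral_sum) measurable
  also have "\<dots> = (\<Sum>A\<in>UNIV. \<integral>\<^sup>+y. f (torus_of y) * indicator unit_cube (v A + y - a) * indicator unit_cube y \<partial>lborel)"
  proof (intro sum.cong refl, goal_cases)
    case (1 A) show ?case by (subst nn_integral_lborel_shift[of _ "v A"]) (auto simp: vp)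
  qed
  also have "\<dots> = (\<integral>\<^sup>+y. (\<Sum>A\<in>UNIV. f (torus_of y) * indicator unit_cube (v A + y - a) * indicator unit_cube y) \<partial>lborel)"
    by (intro nn_integral_sum[symmetric]) measurable
  also have "\<dots> = (\<integral>\<^sup>+y. f (torus_of y) * indicator unit_cube y \<partial>lborel)"
  proof (intro nn_integral_cong)
    fix y :: "real^'n"
    show "(\<Sum>A\<in>UNIV. f (torus_of y) * indicator unit_cube (v A + y - a) * indicator unit_cube y) = f (torus_of y) * indicator unit_cube y"
    proof (cases "y \<in> unit_cube")
      case True then show ?thesis using one'[OF True]
        by (simp only: sum_distrib_left[symmetric] sum_distrib_right[symmetric] mult.assoc) simp
    qed simp
  qed
  finally show ?thesis by (simp add: nn_integral_torus)
qed

lemma distr_torus_shift: "distr torus_measure borel (\<lambda>x. x + w) = torus_measure"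
proof (rule measure_eqI)
  fix S assume "S \<in> sets (distr torus_measure borel (\<lambda>x. x + w))"
  then have [measurable]: "S \<in> sets borel" by simp
  have "emeasure (distr torus_measure borel (\<lambda>x. x + w)) S = (\<integral>\<^sup>+x. indicator S x \<partial>distr torus_measure borel (\<lambda>x. x + w))"
    by simp
  also have "\<dots> = (\<integral>\<^sup>+x. indicator S (x + w) \<partial>torus_measure)"
    by (subst nn_integral_distr) auto
  also have "\<dots> = emeasure torus_measure S"
    using nn_integral_torus_shift[of "indicator S" w] by simp
  finally show "emeasure (distr torus_measure borel (\<lambda>x. x + w)) S = emeasure torus_measure S" .
qed simp

lemma integral_torus_shift:
  fixes f :: "'n::finite torus \<Rightarrow> 'b::{banach, second_countable_topology}"
  assumes [measurable]: "f \<in> borel_measurable borel"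
  shows "(\<integral>x. f (x + w) \<partial>torus_measure) = (\<integral>x. f x \<partial>torus_measure)"
proof -
  have "(\<integral>x. f x \<partial>torus_measure) = (\<integral>x. f x \<partial>distr torus_measure borel (\<lambda>x. x + w))"
    by (simp add: distr_torus_shift)
  also have "\<dots> = (\<integral>x. f (x + w) \<partial>torus_measure)" by (subst integral_distr) auto
  finally show ?thesis by simp
qed

lemma torus_prob_UNIV [simp]: "measure torus_measure UNIV = 1"
  using torus.prob_space by simp

definition character :: "int^'n \<Rightarrow> 'n::finite torus \<Rightarrow> complex" where
  "character k x = cis (2 * pi * (int_vec k \<bullet> check x))"

lemma cis_2pi_Ints: "t \<in> \<int> \<Longrightarrow> cis (2 * pi * t) = 1"
  by (auto elim!: Ints_cases simp: cis.ctr complex_eq_iff cos_int_2pin sin_int_2pin)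

lemma character_torus_of: "character k (torus_of y) = cis (2 * pi * (int_vec k \<bullet> y))"
proof -
  have "\<forall>i. y $ i - check (torus_of y) $ i \<in> \<int>"
    using torus_of_eq_iff[of y "check (torus_of y)"] torus_of_check by metis
  then have "int_vec k \<bullet> (y - check (torus_of y)) \<in> \<int>"
    unfolding inner_vec_def by (intro Ints_sum) (auto simp: int_vec_def intro!: Ints_mult)
  then have "cis (2 * pi * (int_vec k \<bullet> (y - check (torus_of y)))) = 1" by (rule cis_2pi_Ints)
  moreover have "cis (2 * pi * (int_vec k \<bullet> y)) = cis (2 * pi * (int_vec k \<bullet> (y - check (torus_of y)))) * character k (torus_of y)"
    by (simp add: character_def cis_mult inner_diff_right algebra_simps)
  ultimately show ?thesis by simp
qed

lemma character_add: "character k (x + y) = character k x * character k y"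
proof -
  have "character k (torus_of (check x + check y)) = character k x * character k y"
    unfolding character_torus_of by (simp add: character_def cis_mult inner_add_right algebra_simps)
  then show ?thesis by (simp add: torus_of_add torus_of_check)
qed

lemma character_0 [simp]: "character 0 x = 1"
  by (simp add: character_def int_vec_def inner_vec_def)

lemma character_mult: "character k x * character l x = character (k + l) x"
  by (simp add: character_def cis_mult int_vec_def inner_vec_def algebra_simps sum.distrib)

lemma character_cnj: "cnj (character k x) = character (- k) x"
  by (simp add: character_def cis_cnj int_vec_def inner_vec_def sum_negf)

lemma norm_character [simp]: "norm (character k x) = 1"
  by (simp add: character_def)

lemma character_lipschitz:
  "norm (character k x - character k y) \<le> 2 * pi * norm (int_vec k) * dist x y"
proof (rule field_le_epsilon)
  fix r :: real assume r: "r > 0"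
  define L where "L = 2 * pi * norm (int_vec k)"
  have L: "L \<ge> 0" by (simp add: L_def)
  have "r / (L + 1) > 0" using r L by simp
  then obtain a b where ab: "torus_of a = x" "torus_of b = y" "norm (a - b) < dist x y + r / (L + 1)"
    by (rule dist_torus_approx)
  have "character k x = character k y * cis (2 * pi * (int_vec k \<bullet> (a - b)))"
    by (simp add: ab(1,2)[symmetric] character_torus_of cis_mult inner_diff_right algebra_simps)
  then have "norm (character k x - character k y) = norm (character k y * (cis (2 * pi * (int_vec k \<bullet> (a - b))) - 1))"
    by (simp add: algebra_simps)
  also have "\<dots> = norm (cis (2 * pi * (int_vec k \<bullet> (a - b))) - 1)" by (simp add: norm_mult)
  also have "\<dots> \<le> \<bar>2 * pi * (int_vec k \<bullet> (a - b))\<bar>"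
    using iexp_approx1[of "2 * pi * (int_vec k \<bullet> (a - b))" 0] by (simp add: cis_conv_exp)
  also have "\<dots> \<le> L * norm (a - b)"
    using Cauchy_Schwarz_ineq2[of "int_vec k" "a - b"] by (simp add: abs_mult L_def mult.assoc)
  also have "\<dots> \<le> L * (dist x y + r / (L + 1))" using ab(3) L by (intro mult_left_mono) auto
  also have "\<dots> \<le> L * dist x y + r"
  proof -
    have "L * (r / (L + 1)) \<le> r" using L r by (simp add: field_simps)
    then show ?thesis by (simp add: algebra_simps)
  qed
  finally show "norm (character k x - character k y) \<le> 2 * pi * norm (int_vec k) * dist x y + r" by (simp add: L_def)
qed

lemma continuous_character: "continuous_on UNIV (character k)"
proof (rule lipschitz_on_continuous_on)
  show "(2 * pi * norm (int_vec k))-lipschitz_on UNIV (character k)"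
    by (rule lipschitz_onI) (auto simp: dist_norm character_lipschitz)
qed

lemma character_measurable [measurable]: "character k \<in> borel_measurable borel"
  by (rule borel_measurable_continuous_onI) (rule continuous_character)

text \<open>A suitable translation multiplies the character by \<open>-1\<close> and leaves the integral unchanged.\<close>

lemma integral_character_nonzero:
  fixes k :: "int^'n::finite"
  assumes "k \<noteq> 0"
  shows "(\<integral>x. character k x \<partial>torus_measure) = 0"
proof -
  obtain i where i: "k $ i \<noteq> 0" using assms by (auto simp: vec_eq_iff)
  define z where "z = torus_of (axis i (1 / (2 * real_of_int (k $ i))) :: real^'n)"
  have "character k z = cis pi"
    using i by (simp add: z_def character_torus_of inner_axis int_vec_def)
  then have z: "character k z = -1" by simp
  have "(\<integral>x. character k x \<partial>torus_measure) = (\<integral>x. character k (x + z) \<partial>torus_measure)"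
    by (rule integral_torus_shift[symmetric]) simp
  also have "\<dots> = - (\<integral>x. character k x \<partial>torus_measure)" by (simp add: character_add z)
  finally show ?thesis by simp
qed

lemma integral_character_cnj:
  "(\<integral>x. character k x * cnj (character l x) \<partial>torus_measure) = (if k = l then 1 else 0)"
proof -
  have "k + - l = 0 \<longleftrightarrow> k = l" "character 0 = (\<lambda>x :: 'a torus. 1)" by auto
  then show ?thesis
    by (auto simp: character_cnj character_mult integral_character_nonzero)
qed

section \<open>Bounded functions in the Hilbert space of the torus\<close>

text \<open>Bounded Borel functions stand for \<open>L\<^sup>2\<close> throughout: they are integrable against every probability
  measure, so that averaging over the noise and composition with the map are defined at every
  point, and inequalities for them extend to \<open>L\<^sup>2\<close> by truncation.\<close>

definition bounded_borel :: "('a::topological_space \<Rightarrow> 'b::real_normed_vector) \<Rightarrow> bool" where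
  "bounded_borel f \<longleftrightarrow> f \<in> borel_measurable borel \<and> (\<exists>B. \<forall>x. norm (f x) \<le> B)"

lemma bounded_borelI: "f \<in> borel_measurable borel \<Longrightarrow> (\<And>x. norm (f x) \<le> B) \<Longrightarrow> bounded_borel f"
  by (auto simp: bounded_borel_def)

lemma bounded_borelD [measurable_dest]: "bounded_borel f \<Longrightarrow> f \<in> borel_measurable borel"
  by (simp add: bounded_borel_def)

lemma bounded_borelE:
  assumes "bounded_borel f" obtains B where "B > 0" "\<And>x. norm (f x) \<le> B"
proof -
  obtain B where "\<And>x. norm (f x) \<le> B" using assms by (auto simp: bounded_borel_def)
  then have "norm (f x) \<le> max B 1" for x by (simp add: le_max_iff_disj)
  then show ?thesis by (intro that[of "max B 1"]) auto
qed

lemma bounded_borel_diff_square_bound: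
  assumes "bounded_borel f" obtains C where "\<And>x y. (norm (f x - f y))\<^sup>2 \<le> C"
proof -
  obtain B where B: "\<And>x. norm (f x) \<le> B" using bounded_borelE[OF assms] by blast
  have "norm (f x - f y) \<le> 2 * B" for x y
    using norm_triangle_ineq4[of "f x" "f y"] B[of x] B[of y] by linarith
  then show ?thesis by (intro that[of "(2 * B)\<^sup>2"] power_mono) auto
qed

lemma bounded_borel_const [simp, intro]: "bounded_borel (\<lambda>_. c)"
  by (rule bounded_borelI[of _ "norm c"]) auto

lemma bounded_borel_add [simp, intro]:
  fixes f g :: "'a::topological_space \<Rightarrow> 'b::{real_normed_vector, second_countable_topology}"
  assumes "bounded_borel f" "bounded_borel g" shows "bounded_borel (\<lambda>x. f x + g x)"
proof -
  obtain B C where "\<And>x. norm (f x) \<le> B" "\<And>x. norm (g x) \<le> C"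
    using assms bounded_borelE by metis
  then show ?thesis using assms[THEN bounded_borelD]
    by (intro bounded_borelI[of _ "B + C"]) (auto intro!: norm_triangle_mono)
qed

lemma bounded_borel_diff [simp, intro]:
  fixes f g :: "'a::topological_space \<Rightarrow> 'b::{real_normed_vector, second_countable_topology}"
  assumes "bounded_borel f" "bounded_borel g" shows "bounded_borel (\<lambda>x. f x - g x)"
proof -
  obtain B C where "\<And>x. norm (f x) \<le> B" "\<And>x. norm (g x) \<le> C"
    using assms bounded_borelE by metis
  then show ?thesis using assms[THEN bounded_borelD]
    by (intro bounded_borelI[of _ "B + C"]) (auto intro!: norm_triangle_le_diff add_mono)
qed

lemma bounded_borel_mult [simp, intro]:
  fixes f g :: "'a::topological_space \<Rightarrow> 'b::{real_normed_algebra, second_countable_topology}"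
  assumes "bounded_borel f" "bounded_borel g" shows "bounded_borel (\<lambda>x. f x * g x)"
proof -
  obtain B C where BC: "B > 0" "\<And>x. norm (f x) \<le> B" "\<And>x. norm (g x) \<le> C"
    using assms bounded_borelE by metis
  have "norm (f x * g x) \<le> B * C" for x
    using BC order_trans[OF norm_ge_zero BC(2)] by (intro order_trans[OF norm_mult_ineq] mult_mono) auto
  then show ?thesis using assms[THEN bounded_borelD]
    by (intro bounded_borelI[of _ "B * C"]) auto
qed

lemma cnj_measurable [measurable]: "cnj \<in> borel_measurable borel"
  by (intro borel_measurable_continuous_onI continuous_intros)

lemma bounded_borel_cnj [simp, intro]: "bounded_borel f \<Longrightarrow> bounded_borel (\<lambda>x. cnj (f x))"
  using measurable_compose[OF _ cnj_measurable] unfolding bounded_borel_def by auto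

lemma bounded_borel_norm [simp, intro]: "bounded_borel f \<Longrightarrow> bounded_borel (\<lambda>x. norm (f x))"
  unfolding bounded_borel_def by auto

lemma bounded_borel_of_real [simp, intro]: "bounded_borel f \<Longrightarrow> bounded_borel (\<lambda>x. complex_of_real (f x))"
  unfolding bounded_borel_def by auto

lemma bounded_borel_Re_Im [simp, intro]:
  assumes "bounded_borel f"
  shows "bounded_borel (\<lambda>x. Re (f x))" "bounded_borel (\<lambda>x. Im (f x))"
  using assms abs_Re_le_cmod abs_Im_le_cmod unfolding bounded_borel_def by (auto, (meson order_trans)+)

lemma bounded_borel_power [simp, intro]: 
  fixes f :: "'a::topological_space \<Rightarrow> 'b::{real_normed_algebra_1, second_countable_topology}"
  shows "bounded_borel f \<Longrightarrow> bounded_borel (\<lambda>x. f x ^ n)"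
  by (induction n) auto

lemma bounded_borel_sum [intro]:
  fixes f :: "'i \<Rightarrow> 'a::topological_space \<Rightarrow> 'b::{real_normed_vector, second_countable_topology}"
  assumes "\<And>i. i \<in> I \<Longrightarrow> bounded_borel (f i)"
  shows "bounded_borel (\<lambda>x. \<Sum>i\<in>I. f i x)"
  using assms by (induction I rule: infinite_finite_induct) auto

lemma bounded_borel_compose:
  assumes "bounded_borel f" "h \<in> borel_measurable borel" shows "bounded_borel (\<lambda>x. f (h x))"
  using assms measurable_compose unfolding bounded_borel_def by blast

lemma bounded_borel_character [simp, intro]: "bounded_borel (character k)"
  by (rule bounded_borelI[of _ 1]) auto

lemma bounded_borel_indicator [simp, intro]: "S \<in> sets borel \<Longrightarrow> bounded_borel (indicat_real S)"
  by (rule bounded_borelI[of _ 1]) (auto simp: indicator_def)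

lemma bounded_borel_shift [intro]:
  fixes f :: "'n::finite torus \<Rightarrow> _"
  shows "bounded_borel f \<Longrightarrow> bounded_borel (\<lambda>x. f (x + w))" "bounded_borel f \<Longrightarrow> bounded_borel (\<lambda>x. f (w + x))"
  by (rule bounded_borel_compose[where h = "\<lambda>x. x + w"], assumption, measurable)
    (rule bounded_borel_compose[where h = "\<lambda>x. w + x"], assumption, measurable)

lemma (in finite_measure) integrable_bounded_borel:
  fixes f :: "'b::topological_space \<Rightarrow> 'c::{banach, second_countable_topology}"
  assumes "bounded_borel f" "h \<in> borel_measurable M"
  shows "integrable M (\<lambda>x. f (h x))"
proof -
  obtain B where "\<And>x. norm (f x) \<le> B" using assms bounded_borelE by metis
  then show ?thesis using measurable_compose[OF assms(2) bounded_borelD[OF assms(1)]]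
    by (intro integrable_const_bound[of _ B]) auto
qed

lemma integrable_torus [simp, intro]:
  fixes f :: "'n::finite torus \<Rightarrow> 'c::{banach, second_countable_topology}"
  shows "bounded_borel f \<Longrightarrow> integrable torus_measure f"
  using torus.integrable_bounded_borel[of f "\<lambda>x. x"] by simp

definition inner_L2 :: "('n::finite torus \<Rightarrow> complex) \<Rightarrow> ('n torus \<Rightarrow> complex) \<Rightarrow> complex" where
  "inner_L2 f g = (\<integral>x. f x * cnj (g x) \<partial>torus_measure)"

definition energy :: "('n::finite torus \<Rightarrow> complex) \<Rightarrow> real" where
  "energy f = (\<integral>x. (norm (f x))\<^sup>2 \<partial>torus_measure)"

definition norm_L2 :: "('n::finite torus \<Rightarrow> complex) \<Rightarrow> real" where
  "norm_L2 f = sqrt (energy f)"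

lemma energy_nonneg [simp]: "0 \<le> energy f"
  by (simp add: energy_def)

lemma norm_L2_nonneg [simp]: "0 \<le> norm_L2 f"
  by (simp add: norm_L2_def)

lemma norm_L2_square: "(norm_L2 f)\<^sup>2 = energy f"
  by (simp add: norm_L2_def)

lemma inner_L2_self: "inner_L2 f f = of_real (energy f)"
proof -
  have "(\<lambda>x. f x * cnj (f x)) = (\<lambda>x. complex_of_real ((norm (f x))\<^sup>2))"
    by (simp add: complex_norm_square [symmetric])
  then show ?thesis by (simp only: inner_L2_def energy_def integral_complex_of_real)
qed

lemma energy_mono:
  assumes "bounded_borel f" "bounded_borel g" "\<And>x. norm (f x) \<le> norm (g x)"
  shows "energy f \<le> energy g"
  unfolding energy_def using assms by (intro integral_mono) (auto intro: power_mono)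

lemma energy_shift:
  assumes "bounded_borel f" shows "energy (\<lambda>x. f (x + w)) = energy f"
  unfolding energy_def using bounded_borelD[OF assms]
  by (intro integral_torus_shift[of "\<lambda>x. (norm (f x))\<^sup>2"]) measurable

lemma energy_cmult: "energy (\<lambda>x. c * f x) = (norm c)\<^sup>2 * energy f"
  by (simp add: energy_def norm_mult power_mult_distrib)

lemma norm_L2_minus: "norm_L2 (\<lambda>x. f x - g x) = norm_L2 (\<lambda>x. g x - f x)"
  by (simp add: norm_L2_def energy_def norm_minus_commute)

text \<open>Cauchy-Schwarz, from the nonnegative quadratic polynomial \<open>t \<mapsto> \<integral>(|f| - t|g|)\<^sup>2\<close>.\<close>

lemma integral_norm_product_le:
  assumes f: "bounded_borel f" and g: "bounded_borel g"
  shows "(\<integral>x. norm (f x) * norm (g x) \<partial>torus_measure) \<le> norm_L2 f * norm_L2 g"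
proof -
  define a where "a = (\<integral>x. norm (f x) * norm (g x) \<partial>torus_measure)"
  have a0: "a \<ge> 0" by (simp add: a_def)
  have quad: "2 * t * a \<le> energy f + t\<^sup>2 * energy g" for t
  proof -
    have "0 \<le> (\<integral>x. (norm (f x) - t * norm (g x))\<^sup>2 \<partial>torus_measure)" by simp
    also have "\<dots> = (\<integral>x. (norm (f x))\<^sup>2 - 2 * t * (norm (f x) * norm (g x)) + t\<^sup>2 * (norm (g x))\<^sup>2 \<partial>torus_measure)"
      by (simp add: power2_eq_square algebra_simps)
    also have "\<dots> = energy f - 2 * t * a + t\<^sup>2 * energy g"
      using f g by (simp add: energy_def a_def)
    finally show ?thesis by simp
  qed
  have "a\<^sup>2 \<le> energy f * energy g"
  proof (cases "energy g = 0")
    case True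
    have "a = 0"
    proof (rule ccontr)
      assume "a \<noteq> 0"
      then show False using quad[of "(energy f + 1) / a"] True energy_nonneg[of f] by simp
    qed
    then show ?thesis by simp
  next
    case False
    then have G: "energy g > 0" using energy_nonneg[of g] by linarith
    have "2 * (a / energy g) * a \<le> energy f + (a / energy g)\<^sup>2 * energy g" by (rule quad)
    then show ?thesis using G by (simp add: field_simps power2_eq_square)
  qed
  then have "sqrt (a\<^sup>2) \<le> sqrt (energy f * energy g)" by (rule real_sqrt_le_mono)
  then show ?thesis using a0 by (simp add: a_def norm_L2_def real_sqrt_mult)
qed

lemma inner_L2_Cauchy_Schwarz:
  assumes "bounded_borel f" "bounded_borel g"
  shows "norm (inner_L2 f g) \<le> norm_L2 f * norm_L2 g"
proof -
  have "norm (inner_L2 f g) \<le> (\<integral>x. norm (f x * cnj (g x)) \<partial>torus_measure)"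
    unfolding inner_L2_def by (rule integral_norm_bound)
  then show ?thesis using integral_norm_product_le[OF assms] by (simp add: norm_mult)
qed

lemma inner_L2_diff_left:
  assumes "bounded_borel f" "bounded_borel g" "bounded_borel h"
  shows "inner_L2 (\<lambda>x. f x - g x) h = inner_L2 f h - inner_L2 g h"
  unfolding inner_L2_def using assms by (simp add: left_diff_distrib)

lemma inner_L2_diff_right:
  assumes "bounded_borel f" "bounded_borel g" "bounded_borel h"
  shows "inner_L2 h (\<lambda>x. f x - g x) = inner_L2 h f - inner_L2 h g"
  unfolding inner_L2_def using assms by (simp add: right_diff_distrib)

lemma norm_L2_triangle:
  assumes "bounded_borel f" "bounded_borel g"
  shows "norm_L2 (\<lambda>x. f x + g x) \<le> norm_L2 f + norm_L2 g"
proof -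
  have "energy (\<lambda>x. f x + g x) \<le> (\<integral>x. (norm (f x))\<^sup>2 + 2 * (norm (f x) * norm (g x)) + (norm (g x))\<^sup>2 \<partial>torus_measure)"
    unfolding energy_def
  proof (intro integral_mono)
    fix x
    have "(norm (f x + g x))\<^sup>2 \<le> (norm (f x) + norm (g x))\<^sup>2"
      by (intro power_mono norm_triangle_ineq) auto
    then show "(norm (f x + g x))\<^sup>2 \<le> (norm (f x))\<^sup>2 + 2 * (norm (f x) * norm (g x)) + (norm (g x))\<^sup>2"
      by (simp add: power2_eq_square algebra_simps)
  qed (use assms in \<open>auto intro!: bounded_borel_add bounded_borel_mult\<close>)
  also have "\<dots> = energy f + 2 * (\<integral>x. norm (f x) * norm (g x) \<partial>torus_measure) + energy g"
    using assms by (simp add: energy_def)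
  also have "\<dots> \<le> (norm_L2 f + norm_L2 g)\<^sup>2"
    using integral_norm_product_le[OF assms] by (simp add: power2_sum norm_L2_square)
  finally have "sqrt (energy (\<lambda>x. f x + g x)) \<le> sqrt ((norm_L2 f + norm_L2 g)\<^sup>2)" by (rule real_sqrt_le_mono)
  then show ?thesis by (simp add: norm_L2_def)
qed

lemma norm_L2_triangle_diff:
  assumes "bounded_borel f" "bounded_borel g"
  shows "norm_L2 f \<le> norm_L2 g + norm_L2 (\<lambda>x. f x - g x)"
  using norm_L2_triangle[of g "\<lambda>x. f x - g x"] assms by simp

text \<open>Through these limits quadratic inequalities pass from trigonometric polynomials to bounded functions.\<close>

lemma inner_L2_tendsto:
  assumes b: "\<And>n. bounded_borel (F n)" "\<And>n. bounded_borel (G n)" "bounded_borel f" "bounded_borel g"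
    and F: "(\<lambda>n. norm_L2 (\<lambda>x. F n x - f x)) \<longlonglongrightarrow> 0" and G: "(\<lambda>n. norm_L2 (\<lambda>x. G n x - g x)) \<longlonglongrightarrow> 0"
  shows "(\<lambda>n. inner_L2 (F n) (G n)) \<longlonglongrightarrow> inner_L2 f g"
proof -
  define u where "u n = norm_L2 (\<lambda>x. F n x - f x)" for n
  define v where "v n = norm_L2 (\<lambda>x. G n x - g x)" for n
  have *: "norm (inner_L2 (F n) (G n) - inner_L2 f g) \<le> u n * (norm_L2 g + v n) + norm_L2 f * v n" for n
  proof -
    have "inner_L2 (F n) (G n) - inner_L2 f g = inner_L2 (\<lambda>x. F n x - f x) (G n) + inner_L2 f (\<lambda>x. G n x - g x)"
      using b by (simp add: inner_L2_diff_left inner_L2_diff_right)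
    also have "norm \<dots> \<le> u n * norm_L2 (G n) + norm_L2 f * v n"
      using b unfolding u_def v_def
      by (intro norm_triangle_mono inner_L2_Cauchy_Schwarz) auto
    also have "\<dots> \<le> u n * (norm_L2 g + v n) + norm_L2 f * v n"
      using norm_L2_triangle_diff[of "G n" g] b by (intro add_mono mult_left_mono) (auto simp: u_def v_def)
    finally show ?thesis .
  qed
  have **: "(\<lambda>n. u n * (norm_L2 g + v n) + norm_L2 f * v n) \<longlonglongrightarrow> 0 * (norm_L2 g + 0) + norm_L2 f * 0"
    using F G unfolding u_def v_def by (intro tendsto_intros)
  have "(\<lambda>n. inner_L2 (F n) (G n) - inner_L2 f g) \<longlonglongrightarrow> 0"
    proof (rule Lim_null_comparison)
      show "\<forall>\<^sub>F n in sequentially. norm (inner_L2 (F n) (G n) - inner_L2 f g) \<le> u n * (norm_L2 g + v n) + norm_L2 f * v n"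
        by (rule always_eventually) (use * in blast)
      show "(\<lambda>n. u n * (norm_L2 g + v n) + norm_L2 f * v n) \<longlonglongrightarrow> 0" using ** by simp
    qed
  then show ?thesis by (simp add: LIM_zero_iff)
qed

lemma energy_tendsto:
  assumes "\<And>n. bounded_borel (F n)" "bounded_borel f" "(\<lambda>n. norm_L2 (\<lambda>x. F n x - f x)) \<longlonglongrightarrow> 0"
  shows "(\<lambda>n. energy (F n)) \<longlonglongrightarrow> energy f"
proof -
  have "(\<lambda>n. inner_L2 (F n) (F n)) \<longlonglongrightarrow> inner_L2 f f"
    by (rule inner_L2_tendsto[OF assms(1,1,2,2,3,3)])
  then have "(\<lambda>n. Re (inner_L2 (F n) (F n))) \<longlonglongrightarrow> Re (inner_L2 f f)" by (rule tendsto_Re)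
  then show ?thesis by (simp add: inner_L2_self)
qed

section \<open>Density of trigonometric polynomials\<close>

definition trig_poly :: "(int^'n) set \<Rightarrow> (int^'n \<Rightarrow> complex) \<Rightarrow> 'n::finite torus \<Rightarrow> complex" where
  "trig_poly F a x = (\<Sum>k\<in>F. a k * character k x)"

lemma bounded_borel_trig_poly [simp, intro]: "bounded_borel (trig_poly F a)"
  unfolding trig_poly_def by auto

lemma inner_L2_trig_poly:
  assumes "finite F"
  shows "inner_L2 (trig_poly F a) (trig_poly F b) = (\<Sum>k\<in>F. a k * cnj (b k))"
proof -
  have "inner_L2 (trig_poly F a) (trig_poly F b)
      = (\<integral>x. (\<Sum>k\<in>F. \<Sum>l\<in>F. a k * cnj (b l) * (character k x * cnj (character l x))) \<partial>torus_measure)"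
    unfolding inner_L2_def trig_poly_def by (simp add: sum_product mult_ac)
  also have "\<dots> = (\<Sum>k\<in>F. \<Sum>l\<in>F. a k * cnj (b l) * (\<integral>x. character k x * cnj (character l x) \<partial>torus_measure))"
    by (subst Bochner_Integration.integral_sum, force intro!: integrable_torus bounded_borel_sum bounded_borel_mult)+
       (simp del: mult.assoc)
  also have "\<dots> = (\<Sum>k\<in>F. \<Sum>l\<in>F. if k = l then a k * cnj (b l) else 0)"
    unfolding integral_character_cnj by (intro sum.cong) auto
  also have "\<dots> = (\<Sum>k\<in>F. a k * cnj (b k))" using assms by simp
  finally show ?thesis .
qed

lemma energy_trig_poly:
  assumes "finite F"
  shows "energy (trig_poly F a) = (\<Sum>k\<in>F. (norm (a k))\<^sup>2)"
proof -
  have "complex_of_real (energy (trig_poly F a)) = of_real (\<Sum>k\<in>F. (norm (a k))\<^sup>2)"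
    by (simp add: inner_L2_self[symmetric] inner_L2_trig_poly[OF assms] complex_mult_cnj cmod_power2)
  then show ?thesis by (simp only: of_real_eq_iff)
qed

lemma trig_poly_extend:
  assumes "finite G" "F \<subseteq> G"
  shows "trig_poly F a = trig_poly G (\<lambda>k. if k \<in> F then a k else 0)"
  using assms by (auto simp: trig_poly_def fun_eq_iff if_distribR sum.If_cases Int_absorb1 if_distrib[of "\<lambda>c. c * _"] cong: if_cong)

lemma trig_poly_shift: "trig_poly F a (x + z) = trig_poly F (\<lambda>k. a k * character k z) x"
  by (simp add: trig_poly_def character_add mult_ac)

lemma trig_poly_diff: "trig_poly F a x - trig_poly F b x = trig_poly F (\<lambda>k. a k - b k) x"
  by (simp add: trig_poly_def sum_subtractf left_diff_distrib)

lemma trig_poly_add: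
  assumes "finite F" "finite G"
  obtains c where "\<And>x. trig_poly F a x + trig_poly G b x = trig_poly (F \<union> G) c x"
proof
  fix x
  show "trig_poly F a x + trig_poly G b x
      = trig_poly (F \<union> G) (\<lambda>k. (if k \<in> F then a k else 0) + (if k \<in> G then b k else 0)) x"
    using assms trig_poly_extend[of "F \<union> G" F a] trig_poly_extend[of "F \<union> G" G b]
    by (simp add: trig_poly_def sum.distrib ring_distribs)
qed

lemma trig_poly_mult:
  assumes "finite F" "finite G"
  obtains H c where "finite H" "\<And>x. trig_poly F a x * trig_poly G b x = trig_poly H c x"
proof
  let ?s = "\<lambda>(k, l). k + l"
  let ?H = "?s ` (F \<times> G)"
  show fin: "finite ?H" using assms by simp
  fix x
  have "trig_poly F a x * trig_poly G b x = (\<Sum>(k, l)\<in>F \<times> G. a k * b l * character (k + l) x)"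
    by (simp add: trig_poly_def sum_product sum.cartesian_product character_mult[symmetric] mult_ac)
  also have "\<dots> = (\<Sum>m\<in>?H. \<Sum>p\<in>{p \<in> F \<times> G. ?s p = m}. (case p of (k, l) \<Rightarrow> a k * b l * character (k + l) x))"
    using assms fin by (intro sum.group[symmetric]) auto
  also have "\<dots> = (\<Sum>m\<in>?H. \<Sum>p\<in>{p \<in> F \<times> G. ?s p = m}. a (fst p) * b (snd p) * character m x)"
    by (intro sum.cong) auto
  also have "\<dots> = trig_poly ?H (\<lambda>m. \<Sum>p\<in>{p \<in> F \<times> G. ?s p = m}. a (fst p) * b (snd p)) x"
    by (simp add: trig_poly_def sum_distrib_right)
  finally show "trig_poly F a x * trig_poly G b x
      = trig_poly ?H (\<lambda>m. \<Sum>p\<in>{p \<in> F \<times> G. ?s p = m}. a (fst p) * b (snd p)) x" .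
qed

lemma trig_poly_cmult: "c * trig_poly F a x = trig_poly F (\<lambda>k. c * a k) x"
  by (simp add: trig_poly_def sum_distrib_left mult.assoc)

lemma characters_separate:
  assumes "x \<noteq> y" obtains k where "character k x \<noteq> character k y"
proof -
  have "\<not> (\<forall>i. check x $ i - check y $ i \<in> \<int>)"
    using assms torus_of_check[of x] torus_of_check[of y] torus_of_eq_iff[of "check x" "check y"] by auto
  then obtain i where i: "check x $ i - check y $ i \<notin> \<int>" by blast
  have "character (axis i 1) x \<noteq> character (axis i 1) y"
  proof
    assume eq: "character (axis i 1) x = character (axis i 1) y"
    have "character (axis i 1) z = cis (2 * pi * check z $ i)" for z
    proof -
      have "int_vec (axis i 1) = axis i 1" by (simp add: int_vec_def axis_def vec_eq_iff)
      then show ?thesis by (simp add: character_def inner_axis inner_commute[of "axis i 1"])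
    qed
    then have "cis (2 * pi * check x $ i) = cis (2 * pi * check y $ i)" using eq by simp
    then have "cis (2 * pi * check x $ i) / cis (2 * pi * check y $ i) = 1" by simp
    then have "cis (2 * pi * (check x $ i - check y $ i)) = 1"
      by (simp add: cis_divide algebra_simps)
    then have "cos (2 * pi * (check x $ i - check y $ i)) = 1" by (simp add: complex_eq_iff)
    then obtain m where "2 * pi * (check x $ i - check y $ i) = of_int m * 2 * pi"
      by (auto simp: cos_one_2pi_int)
    then have "check x $ i - check y $ i = of_int m" by simp
    then show False using i by simp
  qed
  then show ?thesis by (rule that)
qed

text \<open>Stone-Weierstrass, applied to the real-valued functions that are trigonometric polynomials
  with complex coefficients.\<close>

lemma continuous_trig_approx:
  fixes f :: "'n::finite torus \<Rightarrow> real"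
  assumes f: "continuous_on UNIV f" and e: "e > 0"
  obtains F a where "finite F" "\<And>x. norm (complex_of_real (f x) - trig_poly F a x) < e"
proof -
  define R where "R = {g :: 'n torus \<Rightarrow> real. \<exists>F a. finite F \<and> (\<forall>x. complex_of_real (g x) = trig_poly F a x)}"
  interpret function_ring_on R UNIV
  proof
    show "compact (UNIV :: 'n torus set)" by (rule compact_torus)
  next
    fix g assume "g \<in> R"
    then obtain F a where *: "\<And>x. complex_of_real (g x) = trig_poly F a x" by (auto simp: R_def)
    have "continuous_on UNIV (\<lambda>x. Re (trig_poly F a x))"
      unfolding trig_poly_def
      by (intro continuous_intros continuous_on_subset[OF continuous_character]) auto
    then show "continuous_on UNIV g" using *[symmetric] by simp
  next
    fix g h assume "g \<in> R" "h \<in> R"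
    then obtain F a G b where *: "finite F" "finite G" "\<And>x. complex_of_real (g x) = trig_poly F a x"
      "\<And>x. complex_of_real (h x) = trig_poly G b x" by (auto simp: R_def)
    obtain c where "\<And>x. trig_poly F a x + trig_poly G b x = trig_poly (F \<union> G) c x"
      using trig_poly_add[OF *(1,2)] by blast
    then show "(\<lambda>x. g x + h x) \<in> R" using * by (auto simp: R_def)
    obtain H c' where "finite H" "\<And>x. trig_poly F a x * trig_poly G b x = trig_poly H c' x"
      using trig_poly_mult[OF *(1,2)] by blast
    then show "(\<lambda>x. g x * h x) \<in> R" using * by (auto simp: R_def)
  next
    fix c show "(\<lambda>_. c) \<in> R"
      unfolding R_def by (auto intro!: exI[of _ "{0}"] exI[of _ "\<lambda>_. complex_of_real c"] simp: trig_poly_def)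
  next
    fix x y :: "'n torus" assume "x \<noteq> y"
    then obtain k where k: "character k x \<noteq> character k y" by (rule characters_separate)
    have single: "c * character l z = trig_poly {l} (\<lambda>_. c) z" for c l and z :: "'n torus"
      by (simp add: trig_poly_def)
    have ReIm: "complex_of_real (Re (character k z)) = 1/2 * character k z + 1/2 * character (- k) z"
      "complex_of_real (Im (character k z)) = - \<i>/2 * character k z + \<i>/2 * character (- k) z" for z
      unfolding character_cnj[symmetric] by (auto simp: complex_eq_iff)
    have in_R: "g \<in> R" if "\<And>z. complex_of_real (g z) = c * character k z + d * character (- k) z" for g c d
    proof -
      obtain c' where "\<And>x :: 'n torus. trig_poly {k} (\<lambda>_. c) x + trig_poly {- k} (\<lambda>_. d) x = trig_poly ({k} \<union> {- k}) c' x"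
        using trig_poly_add[of "{k}" "{- k}" "\<lambda>_. c" "\<lambda>_. d"] by blast
      then show ?thesis using that unfolding R_def single by (auto intro!: exI[of _ "{k} \<union> {- k}"])
    qed
    have "Re (character k x) \<noteq> Re (character k y) \<or> Im (character k x) \<noteq> Im (character k y)"
      using k by (auto simp: complex_eq_iff)
    then show "\<exists>f\<in>R. f x \<noteq> f y"
      using in_R[OF ReIm(1)] in_R[OF ReIm(2)] by (elim disjE) (rule bexI, assumption, assumption)+
  qed
  obtain g where "g \<in> R" "\<And>x. \<bar>f x - g x\<bar> < e"
    using Stone_Weierstrass_basic[OF f e] by auto
  then obtain F a where F: "finite F" "\<And>x. complex_of_real (g x) = trig_poly F a x" by (auto simp: R_def)
  have "norm (complex_of_real (f x) - trig_poly F a x) < e" for x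
    using \<open>\<And>x. \<bar>f x - g x\<bar> < e\<close>[of x] unfolding F(2)[symmetric] of_real_diff[symmetric] norm_of_real .
  then show ?thesis using F(1) that by blast
qed

definition trig_approximable :: "('n::finite torus \<Rightarrow> complex) \<Rightarrow> bool" where
  "trig_approximable f \<longleftrightarrow> (\<forall>e>0. \<exists>F a. finite F \<and> norm_L2 (\<lambda>x. f x - trig_poly F a x) < e)"

lemma norm_L2_le_bound:
  assumes "bounded_borel f" "\<And>x. norm (f x) \<le> c"
  shows "norm_L2 f \<le> c"
proof -
  have c: "c \<ge> 0" using assms(2) norm_ge_zero order_trans by blast
  have "energy f \<le> (\<integral>x. c\<^sup>2 \<partial>(torus_measure :: 'a torus measure))"
    unfolding energy_def using assms by (intro integral_mono) (auto intro: power_mono)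
  then show ?thesis using c by (simp add: norm_L2_def real_le_lsqrt)
qed

lemma trig_approximable_limit:
  assumes f: "bounded_borel f"
    and "\<And>e. e > 0 \<Longrightarrow> \<exists>g. bounded_borel g \<and> trig_approximable g \<and> norm_L2 (\<lambda>x. f x - g x) < e"
  shows "trig_approximable f"
  unfolding trig_approximable_def
proof (intro allI impI)
  fix e :: real assume "e > 0"
  then obtain g where g: "bounded_borel g" "trig_approximable g" "norm_L2 (\<lambda>x. f x - g x) < e / 2"
    using assms(2)[of "e / 2"] by auto
  then obtain F a where F: "finite F" "norm_L2 (\<lambda>x. g x - trig_poly F a x) < e / 2"
    using \<open>e > 0\<close> unfolding trig_approximable_def by (meson half_gt_zero)
  have "norm_L2 (\<lambda>x. f x - trig_poly F a x) = norm_L2 (\<lambda>x. (f x - g x) + (g x - trig_poly F a x))" by simp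
  also have "\<dots> \<le> norm_L2 (\<lambda>x. f x - g x) + norm_L2 (\<lambda>x. g x - trig_poly F a x)"
    using f g(1) by (intro norm_L2_triangle) auto
  finally show "\<exists>F a. finite F \<and> norm_L2 (\<lambda>x. f x - trig_poly F a x) < e"
    using g F by (intro exI[of _ F] exI[of _ a]) auto
qed

lemma trig_approximable_add:
  assumes "bounded_borel f" "bounded_borel g" "trig_approximable f" "trig_approximable g"
  shows "trig_approximable (\<lambda>x. f x + g x)"
  unfolding trig_approximable_def
proof (intro allI impI)
  fix e :: real assume "e > 0"
  then obtain F a G b where F: "finite F" "norm_L2 (\<lambda>x. f x - trig_poly F a x) < e / 2"
    and G: "finite G" "norm_L2 (\<lambda>x. g x - trig_poly G b x) < e / 2"
    using assms(3,4) unfolding trig_approximable_def by (meson half_gt_zero)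
  obtain c where c: "\<And>x. trig_poly F a x + trig_poly G b x = trig_poly (F \<union> G) c x"
    using trig_poly_add[OF F(1) G(1)] by blast
  have "norm_L2 (\<lambda>x. f x + g x - trig_poly (F \<union> G) c x)
      = norm_L2 (\<lambda>x. (f x - trig_poly F a x) + (g x - trig_poly G b x))"
    unfolding c[symmetric] by (simp only: add_diff_add)
  also have "\<dots> \<le> norm_L2 (\<lambda>x. f x - trig_poly F a x) + norm_L2 (\<lambda>x. g x - trig_poly G b x)"
    using assms by (intro norm_L2_triangle) auto
  finally show "\<exists>F a. finite F \<and> norm_L2 (\<lambda>x. f x + g x - trig_poly F a x) < e"
    using F G by (intro exI[of _ "F \<union> G"] exI[of _ c]) auto
qed

lemma norm_L2_cmult: "norm_L2 (\<lambda>x. c * f x) = norm c * norm_L2 f"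
  by (simp add: norm_L2_def energy_cmult real_sqrt_mult)

lemma trig_approximable_cmult:
  assumes "trig_approximable f" shows "trig_approximable (\<lambda>x. c * f x)"
  unfolding trig_approximable_def
proof (intro allI impI)
  fix e :: real assume "e > 0"
  then have "e / (norm c + 1) > 0" by (simp add: add_nonneg_pos)
  then obtain F a where F: "finite F" "norm_L2 (\<lambda>x. f x - trig_poly F a x) < e / (norm c + 1)"
    using assms unfolding trig_approximable_def by blast
  have "norm_L2 (\<lambda>x. c * f x - trig_poly F (\<lambda>k. c * a k) x) = norm c * norm_L2 (\<lambda>x. f x - trig_poly F a x)"
    by (simp add: trig_poly_cmult[symmetric] norm_L2_cmult right_diff_distrib[symmetric])
  also have "\<dots> \<le> norm c * (e / (norm c + 1))" using F by (intro mult_left_mono) auto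
  also have "\<dots> < e" using \<open>e > 0\<close> by (simp add: field_simps add_pos_nonneg)
  finally show "\<exists>F a. finite F \<and> norm_L2 (\<lambda>x. c * f x - trig_poly F a x) < e" using F by blast
qed

lemma trig_approximable_const: "trig_approximable (\<lambda>_. c)"
proof -
  have "(\<lambda>x :: 'a torus. c - trig_poly {0} (\<lambda>_. c) x) = (\<lambda>_. 0)" by (simp add: trig_poly_def)
  then have "norm_L2 (\<lambda>x :: 'a torus. c - trig_poly {0} (\<lambda>_. c) x) = 0" by (simp add: norm_L2_def energy_def)
  then show ?thesis unfolding trig_approximable_def by (metis finite.emptyI finite.insertI)
qed

lemma trig_approximable_sum:
  assumes "\<And>i. i \<in> I \<Longrightarrow> bounded_borel (f i)" "\<And>i. i \<in> I \<Longrightarrow> trig_approximable (f i)"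
  shows "trig_approximable (\<lambda>x. \<Sum>i\<in>I. f i x)"
  using assms
proof (induction I rule: infinite_finite_induct)
  case (insert i I)
  then show ?case by (simp, intro trig_approximable_add bounded_borel_sum) auto
qed (simp_all add: trig_approximable_const)

lemma trig_approximable_continuous:
  assumes "continuous_on UNIV f"
  shows "trig_approximable (\<lambda>x. complex_of_real (f x))"
  unfolding trig_approximable_def
proof (intro allI impI)
  fix e :: real assume "e > 0"
  then obtain F a where F: "finite F" "\<And>x. norm (complex_of_real (f x) - trig_poly F a x) < e / 2"
    using continuous_trig_approx[OF assms, of "e / 2"] by auto
  have [measurable]: "f \<in> borel_measurable borel" by (rule borel_measurable_continuous_onI[OF assms])
  note [measurable] = bounded_borelD[OF bounded_borel_trig_poly]
  have "(\<lambda>x. complex_of_real (f x) - trig_poly F a x) \<in> borel_measurable borel" by measurable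
  then have "norm_L2 (\<lambda>x. complex_of_real (f x) - trig_poly F a x) \<le> e / 2"
    using F(2)
    by (intro norm_L2_le_bound bounded_borelI[of _ "e / 2"]) (auto simp: less_imp_le)
  then show "\<exists>F a. finite F \<and> norm_L2 (\<lambda>x. complex_of_real (f x) - trig_poly F a x) < e"
    using F(1) \<open>e > 0\<close> by (intro exI[of _ F] exI[of _ a]) auto
qed

lemma norm_L2_dominated_convergence:
  fixes g :: "nat \<Rightarrow> 'n::finite torus \<Rightarrow> complex"
  assumes "\<And>n. bounded_borel (g n)" "bounded_borel f" "\<And>n x. norm (g n x - f x) \<le> B"
    and "\<And>x. (\<lambda>n. g n x) \<longlonglongrightarrow> f x"
  shows "(\<lambda>n. norm_L2 (\<lambda>x. f x - g n x)) \<longlonglongrightarrow> 0"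
proof -
  note [measurable] = assms(1,2)[THEN bounded_borelD]
  have "(\<lambda>n. \<integral>x. (norm (f x - g n x))\<^sup>2 \<partial>torus_measure) \<longlonglongrightarrow> (\<integral>x. 0 \<partial>(torus_measure :: 'n torus measure))"
  proof (rule integral_dominated_convergence[where w = "\<lambda>_. B\<^sup>2"])
    show "AE x in torus_measure. (\<lambda>n. (norm (f x - g n x))\<^sup>2) \<longlonglongrightarrow> 0"
    proof (rule AE_I2)
      fix x
      have "(\<lambda>n. (norm (f x - g n x))\<^sup>2) \<longlonglongrightarrow> (norm (f x - f x))\<^sup>2"
        by (intro tendsto_intros assms(4))
      then show "(\<lambda>n. (norm (f x - g n x))\<^sup>2) \<longlonglongrightarrow> 0" by simp
    qed
    show "AE x in torus_measure. norm ((norm (f x - g n x))\<^sup>2) \<le> B\<^sup>2" for n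
      using assms(3) by (auto simp: norm_minus_commute intro!: power_mono AE_I2)
  qed (auto intro!: measurable_compose[OF _ borel_measurable_power] simp del: power2_eq_square)
  then have "(\<lambda>n. sqrt (energy (\<lambda>x. f x - g n x))) \<longlonglongrightarrow> sqrt 0"
    by (intro tendsto_real_sqrt) (simp add: energy_def)
  then show ?thesis by (simp add: norm_L2_def)
qed

lemma trig_approximable_sequence:
  fixes g :: "nat \<Rightarrow> 'n::finite torus \<Rightarrow> complex"
  assumes "\<And>n. bounded_borel (g n)" "bounded_borel f" "\<And>n x. norm (g n x - f x) \<le> B"
    and "\<And>x. (\<lambda>n. g n x) \<longlonglongrightarrow> f x" and "\<And>n. trig_approximable (g n)"
  shows "trig_approximable f"
proof (rule trig_approximable_limit)
  fix e :: real assume "e > 0"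
  then have "\<forall>\<^sub>F n in sequentially. norm_L2 (\<lambda>x. f x - g n x) < e"
    using norm_L2_dominated_convergence[OF assms(1-4)] by (simp add: order_tendstoD)
  then obtain n where "norm_L2 (\<lambda>x. f x - g n x) < e" by (auto simp: eventually_sequentially)
  then show "\<exists>g. bounded_borel g \<and> trig_approximable g \<and> norm_L2 (\<lambda>x. f x - g x) < e"
    using assms by blast
qed fact

lemma borel_sigma_closed: "sets borel = sigma_sets UNIV (Collect closed)"
  by (simp add: borel_eq_closed)

text \<open>The indicator of a closed set is a pointwise limit of continuous functions of the distance to
  it, and the approximable indicators form a Dynkin system.\<close>

lemma trig_approximable_indicator:
  assumes "S \<in> sets (borel :: 'n::finite torus measure)"
  shows "trig_approximable (\<lambda>x. of_real (indicat_real S x))"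
proof -
  have 1: "Int_stable (Collect closed :: 'n torus set set)" by (auto simp: Int_stable_def)
  have 2: "Collect closed \<subseteq> Pow (UNIV :: 'n torus set)" by simp
  have 3: "S \<in> sigma_sets UNIV (Collect closed)" using assms by (simp add: borel_sigma_closed)
  have meas: "A \<in> sets borel" if "A \<in> sigma_sets UNIV (Collect closed)" for A :: "'n torus set"
    using that by (simp add: borel_sigma_closed)
  have bb: "bounded_borel (\<lambda>x. complex_of_real (indicat_real A x))" if "A \<in> sets borel" for A :: "'n torus set"
    using that by auto
  from 1 2 3 show ?thesis
  proof (induction S rule: sigma_sets_induct_disjoint)
    case (basic C)
    then have C: "closed C" by simp
    show ?case
    proof (cases "C = {}")
      case True then show ?thesis by (simp add: trig_approximable_const)
    next
      case False
      define g where "g n x = max 0 (1 - real n * infdist x C)" for n x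
      have g01: "0 \<le> g n x" "g n x \<le> 1" for n x by (auto simp: g_def infdist_nonneg)
      have cont: "continuous_on UNIV (g n)" for n
        unfolding g_def by (intro continuous_intros)
      have lim: "(\<lambda>n. g n x) \<longlonglongrightarrow> indicat_real C x" for x
      proof (cases "x \<in> C")
        case True then show ?thesis by (simp add: g_def)
      next
        case False
        then have "infdist x C > 0"
          using C \<open>C \<noteq> {}\<close> in_closed_iff_infdist_zero[of C x] infdist_nonneg[of x C] by force
        then obtain N where N: "1 < real N * infdist x C" using reals_Archimedean3 by blast
        have "g n x = 0" if "n \<ge> N" for n
        proof -
          have "real N * infdist x C \<le> real n * infdist x C" using that by (intro mult_right_mono infdist_nonneg) auto
          then show ?thesis using N by (simp add: g_def)
        qed
        then show ?thesis using False by (intro tendsto_eventually) (auto simp: eventually_sequentially)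
      qed
      show ?thesis
      proof (rule trig_approximable_sequence[where g = "\<lambda>n x. of_real (g n x)" and B = 2])
        show "bounded_borel (\<lambda>x. complex_of_real (g n x))" for n
          using borel_measurable_continuous_onI[OF cont[of n]] g01[of n]
          by (intro bounded_borel_of_real bounded_borelI[of _ 1]) auto
        show "norm (complex_of_real (g n x) - of_real (indicat_real C x)) \<le> 2" for n x
          unfolding of_real_diff[symmetric] norm_of_real using g01[of n x] by (auto simp: indicator_def)
        show "(\<lambda>n. complex_of_real (g n x)) \<longlonglongrightarrow> of_real (indicat_real C x)" for x
          by (intro tendsto_of_real lim)
      qed (use C in \<open>auto intro: trig_approximable_continuous cont bb\<close>)
    qed
  next
    case empty then show ?case by (simp add: trig_approximable_const)
  next
    case (compl A)
    have "(\<lambda>x. complex_of_real (indicat_real (UNIV - A) x)) = (\<lambda>x. 1 + (- 1) * of_real (indicat_real A x))"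
      by (auto simp: indicator_def)
    moreover have "A \<in> sets borel" using compl(1) by (rule meas)
    ultimately show ?case
      by (simp only:) (intro trig_approximable_add trig_approximable_const trig_approximable_cmult compl bounded_borel_mult bounded_borel_const bb)
  next
    case (union A)
    then have A: "A i \<in> sets borel" for i using meas by blast
    have ind: "(\<Sum>i<n. complex_of_real (indicat_real (A i) x)) = of_real (indicat_real (\<Union>i<n. A i) x)" for n x
    proof -
      have "disjoint_family_on A {..<n}" using union(1) by (rule disjoint_family_on_mono[OF subset_UNIV])
      then show ?thesis
        by (subst indicator_UN_disjoint) auto
    qed
    show ?case
    proof (rule trig_approximable_sequence[where g = "\<lambda>n x. \<Sum>i<n. of_real (indicat_real (A i) x)" and B = 2])
      show "(\<lambda>n. \<Sum>i<n. complex_of_real (indicat_real (A i) x)) \<longlonglongrightarrow> of_real (indicat_real (\<Union> (range A)) x)" for x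
      proof -
        have "(\<lambda>n. indicat_real (\<Union>i<n. A i) x) \<longlonglongrightarrow> indicat_real (\<Union>i. A i) x"
          by (rule LIMSEQ_indicator_UN)
        then show ?thesis unfolding ind by (intro tendsto_of_real)
      qed
      show "norm ((\<Sum>i<n. complex_of_real (indicat_real (A i) x)) - of_real (indicat_real (\<Union> (range A)) x)) \<le> 2" for n x
        unfolding ind of_real_diff[symmetric] norm_of_real by (auto simp: indicator_def)
    qed (use A union in \<open>auto intro!: trig_approximable_sum bounded_borel_sum bb\<close>)
  qed
qed

text \<open>Rounding the values down to multiples of \<open>1 / m\<close> gives a finite combination of indicators.\<close>

lemma trig_approximable_real:
  fixes f :: "'n::finite torus \<Rightarrow> real"
  assumes f: "bounded_borel f"
  shows "trig_approximable (\<lambda>x. complex_of_real (f x))"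
proof (rule trig_approximable_limit)
  fix e :: real assume e: "e > 0"
  obtain n where n: "1 / real (Suc n) < e" using nat_approx_posE[OF e] by blast
  define m where "m = real (Suc n)"
  have m: "m > 0" by (simp add: m_def)
  note [measurable] = bounded_borelD[OF f]
  obtain B where B: "B > 0" "\<And>x. norm (f x) \<le> B" using bounded_borelE[OF f] by blast
  define J where "J = {\<lfloor>- m * B\<rfloor>..\<lfloor>m * B\<rfloor>}"
  define S where "S j = {x. \<lfloor>m * f x\<rfloor> = j}" for j
  have S: "S j \<in> sets borel" for j unfolding S_def by measurable
  define g where "g x = (\<Sum>j\<in>J. (of_int j / of_real m) * complex_of_real (indicat_real (S j) x))" for x
  have g: "g x = of_real (of_int \<lfloor>m * f x\<rfloor> / m)" for x
  proof -
    have "- B \<le> f x" "f x \<le> B" using B(2)[of x] by auto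
    then have "m * (- B) \<le> m * f x" "m * f x \<le> m * B" using m by (intro mult_left_mono; simp)+
    then have "- m * B \<le> m * f x" "m * f x \<le> m * B" by auto
    then have "\<lfloor>m * f x\<rfloor> \<in> J" unfolding J_def by (auto intro: floor_mono)
    have "g x = (\<Sum>j\<in>J. if j = \<lfloor>m * f x\<rfloor> then of_int j / of_real m else 0)"
      unfolding g_def by (intro sum.cong) (auto simp: S_def indicator_def)
    also have "\<dots> = of_real (of_int \<lfloor>m * f x\<rfloor> / m)" using \<open>\<lfloor>m * f x\<rfloor> \<in> J\<close> by (simp add: J_def)
    finally show ?thesis .
  qed
  have bg: "bounded_borel g" unfolding g_def
    by (intro bounded_borel_sum bounded_borel_mult bounded_borel_const bounded_borel_of_real bounded_borel_indicator S)
  have "trig_approximable g" unfolding g_def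
    by (intro trig_approximable_sum trig_approximable_cmult trig_approximable_indicator
        bounded_borel_mult bounded_borel_const bounded_borel_of_real bounded_borel_indicator S)
  moreover have "norm_L2 (\<lambda>x. complex_of_real (f x) - g x) \<le> 1 / m"
  proof (rule norm_L2_le_bound)
    fix x
    have "\<bar>m * f x - of_int \<lfloor>m * f x\<rfloor>\<bar> \<le> 1" by linarith
    then have "\<bar>m * (f x - of_int \<lfloor>m * f x\<rfloor> / m)\<bar> \<le> 1" using m by (simp add: right_diff_distrib)
    then have "\<bar>f x - of_int \<lfloor>m * f x\<rfloor> / m\<bar> \<le> 1 / m" using m by (simp add: abs_mult field_simps)
    then show "norm (complex_of_real (f x) - g x) \<le> 1 / m"
      unfolding g of_real_diff[symmetric] norm_of_real .
  qed (use f bg in auto)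
  ultimately show "\<exists>g. bounded_borel g \<and> trig_approximable g \<and> norm_L2 (\<lambda>x. complex_of_real (f x) - g x) < e"
    using bg n by (intro exI[of _ g]) (auto simp: m_def)
qed (use f in auto)

theorem trig_polys_dense:
  assumes f: "bounded_borel f"
  obtains F a where "\<And>n. finite (F n)" "(\<lambda>n. norm_L2 (\<lambda>x. trig_poly (F n) (a n) x - f x)) \<longlonglongrightarrow> 0"
proof -
  have "(\<lambda>x. complex_of_real (Re (f x)) + \<i> * complex_of_real (Im (f x))) = f"
    by (auto simp: complex_eq_iff)
  moreover have "trig_approximable (\<lambda>x. complex_of_real (Re (f x)) + \<i> * complex_of_real (Im (f x)))"
    using f by (intro trig_approximable_add trig_approximable_cmult trig_approximable_real bounded_borel_mult) auto
  ultimately have "trig_approximable f" by simp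
  then have "\<exists>F a. finite F \<and> norm_L2 (\<lambda>x. f x - trig_poly F a x) < 1 / real (Suc n)" for n
    by (simp add: trig_approximable_def)
  then obtain F a where F: "\<And>n. finite (F n)" "\<And>n. norm_L2 (\<lambda>x. f x - trig_poly (F n) (a n) x) < 1 / real (Suc n)"
    by metis
  have "(\<lambda>n. norm_L2 (\<lambda>x. trig_poly (F n) (a n) x - f x)) \<longlonglongrightarrow> 0"
  proof (rule Lim_null_comparison)
    show "\<forall>\<^sub>F n in sequentially. norm (norm_L2 (\<lambda>x. trig_poly (F n) (a n) x - f x)) \<le> 1 / real (Suc n)"
      using F(2) by (intro always_eventually) (simp add: norm_L2_minus[of _ f] less_imp_le)
  qed (rule LIMSEQ_inverse_real_of_nat[unfolded inverse_eq_divide])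
  then show ?thesis using F(1) that by blast
qed

section \<open>Averaging over the noise\<close>

definition conv :: "'n::finite torus measure \<Rightarrow> ('n torus \<Rightarrow> complex) \<Rightarrow> 'n torus \<Rightarrow> complex" where
  "conv \<nu> f x = (\<integral>z. f (x + z) \<partial>\<nu>)"

definition loss :: "'n::finite torus measure \<Rightarrow> ('n torus \<Rightarrow> complex) \<Rightarrow> real" where
  "loss \<nu> f = energy f - energy (conv \<nu> f)"

definition multiplier :: "'n::finite torus measure \<Rightarrow> int^'n \<Rightarrow> complex" where
  "multiplier \<nu> k = (\<integral>z. character k z \<partial>\<nu>)"

text \<open>The case in which \<open>c\<close> is the mean is the Jensen inequality for the square. The case of
  a value of the averaged function itself gives the bound on the lost energy.\<close>

lemma (in prob_space) integral_norm_diff_square: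
  fixes u :: "'a \<Rightarrow> complex"
  assumes [measurable]: "u \<in> borel_measurable M" and B: "\<And>x. norm (u x) \<le> B"
  shows "(\<integral>x. (norm (u x - c))\<^sup>2 \<partial>M) = (\<integral>x. (norm (u x))\<^sup>2 \<partial>M) - 2 * Re (cnj c * (\<integral>x. u x \<partial>M)) + (norm c)\<^sup>2"
proof -
  have i1: "integrable M u" using B by (intro integrable_const_bound[of _ B]) auto
  have i2: "integrable M (\<lambda>x. (norm (u x))\<^sup>2)"
    using B by (intro integrable_const_bound[of _ "B\<^sup>2"]) (auto intro!: power_mono)
  have "(norm (u x - c))\<^sup>2 = (norm (u x))\<^sup>2 - 2 * Re (cnj c * u x) + (norm c)\<^sup>2" for x
    unfolding cmod_power2 by (simp add: power2_eq_square algebra_simps)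
  then have "(\<integral>x. (norm (u x - c))\<^sup>2 \<partial>M) = (\<integral>x. (norm (u x))\<^sup>2 - 2 * Re (cnj c * u x) + (norm c)\<^sup>2 \<partial>M)"
    by simp
  also have "\<dots> = (\<integral>x. (norm (u x))\<^sup>2 \<partial>M) - 2 * (\<integral>x. Re (cnj c * u x) \<partial>M) + (norm c)\<^sup>2"
    using i1 i2 by (simp add: prob_space)
  also have "(\<integral>x. Re (cnj c * u x) \<partial>M) = Re (cnj c * (\<integral>x. u x \<partial>M))"
    using i1 by (simp del: complex_cnj_mult times_complex.sel)
  finally show ?thesis .
qed

lemma (in prob_space) norm_integral_square_le:
  fixes u :: "'a \<Rightarrow> complex"
  assumes "u \<in> borel_measurable M" and "\<And>x. norm (u x) \<le> B"
  shows "(norm (\<integral>x. u x \<partial>M))\<^sup>2 \<le> (\<integral>x. (norm (u x))\<^sup>2 \<partial>M)"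
proof -
  let ?m = "\<integral>x. u x \<partial>M"
  have "0 \<le> (\<integral>x. (norm (u x - ?m))\<^sup>2 \<partial>M)" by simp
  also have "\<dots> = (\<integral>x. (norm (u x))\<^sup>2 \<partial>M) - 2 * Re (cnj ?m * ?m) + (norm ?m)\<^sup>2"
    by (rule integral_norm_diff_square[OF assms])
  also have "Re (cnj ?m * ?m) = (norm ?m)\<^sup>2"
    unfolding cmod_power2 by (simp add: power2_eq_square)
  finally show ?thesis by simp
qed

locale torus_prob = prob_space \<nu> for \<nu> :: "'n::finite torus measure" +
  assumes sets_noise [measurable_cong, simp]: "sets \<nu> = sets borel"
begin

lemma space_noise [simp]: "space \<nu> = UNIV"
  using sets_eq_imp_space_eq[OF sets_noise] by simp

lemma measure_noise_UNIV [simp]: "measure \<nu> UNIV = 1"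
  using prob_space by simp

sublocale torus_pair: pair_sigma_finite torus_measure \<nu> ..

lemma integrable_noise:
  fixes f :: "'n torus \<Rightarrow> 'c::{banach, second_countable_topology}"
  assumes "bounded_borel f" shows "integrable \<nu> f" "integrable \<nu> (\<lambda>z. f (x + z))"
proof -
  have *: "(\<lambda>z. z) \<in> borel_measurable \<nu>" "(\<lambda>z. x + z) \<in> borel_measurable \<nu>" by measurable
  show "integrable \<nu> f" using integrable_bounded_borel[OF assms *(1)] by simp
  show "integrable \<nu> (\<lambda>z. f (x + z))" by (rule integrable_bounded_borel[OF assms *(2)])
qed

lemma Fubini_bounded:
  fixes h :: "'n torus \<Rightarrow> 'n torus \<Rightarrow> 'c::{banach, second_countable_topology}"
  assumes h: "case_prod h \<in> borel_measurable (borel \<Otimes>\<^sub>M borel)" and B: "\<And>x z. norm (h x z) \<le> B"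
  shows "(\<integral>x. (\<integral>z. h x z \<partial>\<nu>) \<partial>torus_measure) = (\<integral>z. (\<integral>x. h x z \<partial>torus_measure) \<partial>\<nu>)"
proof (rule torus_pair.Fubini_integral[symmetric])
  interpret P: pair_prob_space torus_measure \<nu> ..
  have "case_prod h \<in> borel_measurable (torus_measure \<Otimes>\<^sub>M \<nu>)"
    using h by (simp cong: measurable_cong_sets sets_pair_measure_cong)
  then show "integrable (torus_measure \<Otimes>\<^sub>M \<nu>) (case_prod h)"
    using B by (intro P.integrable_const_bound[of _ B]) auto
qed

lemma measurable_integral_noise:
  fixes h :: "'n torus \<Rightarrow> 'n torus \<Rightarrow> 'c::{banach, second_countable_topology}"
  assumes h: "case_prod h \<in> borel_measurable (borel \<Otimes>\<^sub>M borel)"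
  shows "(\<lambda>x. \<integral>z. h x z \<partial>\<nu>) \<in> borel_measurable borel"
proof (rule borel_measurable_lebesgue_integral)
  show "case_prod h \<in> borel_measurable (borel \<Otimes>\<^sub>M \<nu>)"
    using h by (simp cong: measurable_cong_sets sets_pair_measure_cong)
qed

lemma bounded_borel_conv [simp, intro]:
  assumes "bounded_borel f" shows "bounded_borel (conv \<nu> f)"
proof -
  obtain B where B: "B > 0" "\<And>x. norm (f x) \<le> B" using bounded_borelE[OF assms] by blast
  note [measurable] = bounded_borelD[OF assms]
  have "norm (conv \<nu> f x) \<le> B" for x
  proof -
    have "norm (conv \<nu> f x) \<le> (\<integral>z. norm (f (x + z)) \<partial>\<nu>)" unfolding conv_def by (rule integral_norm_bound)
    also have "\<dots> \<le> (\<integral>z. B \<partial>\<nu>)" using assms B by (intro integral_mono) (auto intro!: integrable_noise)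
    finally show ?thesis by (simp add: prob_space)
  qed
  moreover have "conv \<nu> f \<in> borel_measurable borel"
    unfolding conv_def by (rule measurable_integral_noise) measurable
  ultimately show ?thesis by (intro bounded_borelI)
qed

lemma conv_diff:
  assumes "bounded_borel f" "bounded_borel g"
  shows "conv \<nu> (\<lambda>x. f x - g x) x = conv \<nu> f x - conv \<nu> g x"
  unfolding conv_def by (intro Bochner_Integration.integral_diff integrable_noise assms)

lemma integral_conv:
  assumes "bounded_borel f"
  shows "(\<integral>x. conv \<nu> f x \<partial>torus_measure) = (\<integral>x. f x \<partial>torus_measure)"
proof -
  obtain B where B: "\<And>x. norm (f x) \<le> B" using bounded_borelE[OF assms] by blast
  note [measurable] = bounded_borelD[OF assms]
  have "(\<integral>x. conv \<nu> f x \<partial>torus_measure) = (\<integral>z. (\<integral>x. f (x + z) \<partial>torus_measure) \<partial>\<nu>)"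
    unfolding conv_def by (rule Fubini_bounded[of _ B]) (measurable, rule B)
  then show ?thesis by (simp add: integral_torus_shift prob_space)
qed

lemma integral_noise_energy:
  assumes "bounded_borel f"
  shows "(\<integral>x. (\<integral>z. (norm (f (x + z)))\<^sup>2 \<partial>\<nu>) \<partial>torus_measure) = energy f"
proof -
  obtain B where B: "\<And>x. norm (f x) \<le> B" using bounded_borelE[OF assms] by blast
  note [measurable] = bounded_borelD[OF assms]
  have "(\<integral>x. (\<integral>z. (norm (f (x + z)))\<^sup>2 \<partial>\<nu>) \<partial>torus_measure) = (\<integral>z. energy (\<lambda>x. f (x + z)) \<partial>\<nu>)"
    unfolding energy_def using B by (intro Fubini_bounded[of _ "B\<^sup>2"]) (measurable, auto intro!: power_mono)
  then show ?thesis using assms by (simp add: energy_shift prob_space)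
qed

lemma bounded_borel_integral_noise:
  fixes f :: "'n torus \<Rightarrow> complex"
  assumes "bounded_borel f"
  shows "bounded_borel (\<lambda>x. \<integral>z. (norm (f (x + z)))\<^sup>2 \<partial>\<nu>)" "bounded_borel (\<lambda>x. \<integral>z. (norm (f (x + z) - f x))\<^sup>2 \<partial>\<nu>)"
proof -
  obtain B where B: "\<And>x. norm (f x) \<le> B" using bounded_borelE[OF assms] by blast
  note [measurable] = bounded_borelD[OF assms]
  obtain C where C: "\<And>x y. (norm (f x - f y))\<^sup>2 \<le> C" using bounded_borel_diff_square_bound[OF assms] by blast
  have *: "norm (\<integral>z. u z \<partial>\<nu>) \<le> C" if "u \<in> borel_measurable borel" "\<And>z. \<bar>u z\<bar> \<le> C" for u and C :: real
  proof -
    have "norm (\<integral>z. u z \<partial>\<nu>) \<le> (\<integral>z. norm (u z) \<partial>\<nu>)" by (rule integral_norm_bound)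
    also have "\<dots> \<le> (\<integral>z. C \<partial>\<nu>)"
      using that order_trans[OF abs_ge_zero that(2)] by (intro integral_mono integrable_const_bound[of _ C]) auto
    finally show ?thesis by (simp add: prob_space)
  qed
  show "bounded_borel (\<lambda>x. \<integral>z. (norm (f (x + z)))\<^sup>2 \<partial>\<nu>)"
    using B by (intro bounded_borelI[of _ "B\<^sup>2"] measurable_integral_noise *) (measurable, auto intro!: power_mono)
  show "bounded_borel (\<lambda>x. \<integral>z. (norm (f (x + z) - f x))\<^sup>2 \<partial>\<nu>)"
    using C by (intro bounded_borelI[of _ C] measurable_integral_noise *) auto
qed

lemma energy_conv_le:
  assumes "bounded_borel f" shows "energy (conv \<nu> f) \<le> energy f"
proof -
  obtain B where B: "\<And>x. norm (f x) \<le> B" using bounded_borelE[OF assms] by blast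
  note [measurable] = bounded_borelD[OF assms]
  have "energy (conv \<nu> f) \<le> (\<integral>x. (\<integral>z. (norm (f (x + z)))\<^sup>2 \<partial>\<nu>) \<partial>torus_measure)"
    unfolding energy_def
  proof (intro integral_mono)
    show "(norm (conv \<nu> f x))\<^sup>2 \<le> (\<integral>z. (norm (f (x + z)))\<^sup>2 \<partial>\<nu>)" for x
      unfolding conv_def using B by (intro norm_integral_square_le[of _ B]) auto
  qed (use assms bounded_borel_integral_noise in auto)
  then show ?thesis by (simp add: integral_noise_energy assms)
qed

lemma norm_L2_conv_le: "bounded_borel f \<Longrightarrow> norm_L2 (conv \<nu> f) \<le> norm_L2 f"
  by (simp add: norm_L2_def energy_conv_le)

lemma loss_nonneg: "bounded_borel f \<Longrightarrow> 0 \<le> loss \<nu> f"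
  by (simp add: loss_def energy_conv_le)

text \<open>Both the lost energy and the displacement caused by the noise are controlled by how much a
  function changes under the translations that the noise performs.\<close>

lemma integral_variation:
  assumes f: "bounded_borel f" and c: "AE z in \<nu>. energy (\<lambda>x. f (x + z) - f x) \<le> c"
  shows "(\<integral>x. (\<integral>z. (norm (f (x + z) - f x))\<^sup>2 \<partial>\<nu>) \<partial>torus_measure) \<le> c"
proof -
  note [measurable] = bounded_borelD[OF f]
  obtain C where C: "\<And>x y. (norm (f x - f y))\<^sup>2 \<le> C" using bounded_borel_diff_square_bound[OF f] by blast
  have "(\<integral>x. (\<integral>z. (norm (f (x + z) - f x))\<^sup>2 \<partial>\<nu>) \<partial>torus_measure) = (\<integral>z. energy (\<lambda>x. f (x + z) - f x) \<partial>\<nu>)"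
    unfolding energy_def using C by (intro Fubini_bounded[of _ C]) auto
  also have "\<dots> \<le> c"
  proof (cases "integrable \<nu> (\<lambda>z. energy (\<lambda>x. f (x + z) - f x))")
    case True
    then have "(\<integral>z. energy (\<lambda>x. f (x + z) - f x) \<partial>\<nu>) \<le> (\<integral>z. c \<partial>\<nu>)"
      using c by (intro integral_mono_AE) auto
    then show ?thesis by (simp add: prob_space)
  next
    case False
    have "c \<ge> 0"
    proof (rule ccontr)
      assume "\<not> 0 \<le> c"
      then have "\<not> energy (\<lambda>x. f (x + z) - f x) \<le> c" for z
        using energy_nonneg[of "\<lambda>x. f (x + z) - f x"] by linarith
      then have "AE z in \<nu>. False" using c by simp
      then show False by simp
    qed
    then show ?thesis using False by (simp add: not_integrable_integral_eq)
  qed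
  finally show ?thesis .
qed

lemma loss_le_variation:
  assumes f: "bounded_borel f" and c: "AE z in \<nu>. energy (\<lambda>x. f (x + z) - f x) \<le> c"
  shows "loss \<nu> f \<le> c"
proof -
  obtain B where B: "\<And>x. norm (f x) \<le> B" using bounded_borelE[OF f] by blast
  note [measurable] = bounded_borelD[OF f]
  have "(\<integral>z. (norm (f (x + z)))\<^sup>2 \<partial>\<nu>) - (norm (conv \<nu> f x))\<^sup>2 \<le> (\<integral>z. (norm (f (x + z) - f x))\<^sup>2 \<partial>\<nu>)" for x
  proof -
    have "2 * Re (cnj (f x) * conv \<nu> f x) \<le> (norm (f x))\<^sup>2 + (norm (conv \<nu> f x))\<^sup>2"
    proof -
      have "Re (cnj (f x) * conv \<nu> f x) \<le> norm (f x) * norm (conv \<nu> f x)"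
        using complex_Re_le_cmod[of "cnj (f x) * conv \<nu> f x"] by (simp add: norm_mult)
      moreover have "0 \<le> (norm (f x) - norm (conv \<nu> f x))\<^sup>2" by simp
      ultimately show ?thesis by (simp add: power2_diff)
    qed
    then show ?thesis
      using integral_norm_diff_square[of "\<lambda>z. f (x + z)" B "f x"] B by (simp add: conv_def)
  qed
  then have "(\<integral>x. (\<integral>z. (norm (f (x + z)))\<^sup>2 \<partial>\<nu>) - (norm (conv \<nu> f x))\<^sup>2 \<partial>torus_measure)
      \<le> (\<integral>x. (\<integral>z. (norm (f (x + z) - f x))\<^sup>2 \<partial>\<nu>) \<partial>torus_measure)"
    using f bounded_borel_integral_noise by (intro integral_mono integrable_torus bounded_borel_diff) auto
  also have "\<dots> \<le> c" by (rule integral_variation[OF f c])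
  also have "(\<integral>x. (\<integral>z. (norm (f (x + z)))\<^sup>2 \<partial>\<nu>) - (norm (conv \<nu> f x))\<^sup>2 \<partial>torus_measure)
      = (\<integral>x. (\<integral>z. (norm (f (x + z)))\<^sup>2 \<partial>\<nu>) \<partial>torus_measure) - (\<integral>x. (norm (conv \<nu> f x))\<^sup>2 \<partial>torus_measure)"
    using f bounded_borel_integral_noise[OF f] by (intro Bochner_Integration.integral_diff) auto
  also have "\<dots> = loss \<nu> f" unfolding integral_noise_energy[OF f] by (simp add: loss_def energy_def)
  finally show ?thesis .
qed

lemma energy_conv_diff_le_variation:
  assumes f: "bounded_borel f" and c: "AE z in \<nu>. energy (\<lambda>x. f (x + z) - f x) \<le> c"
  shows "energy (\<lambda>x. conv \<nu> f x - f x) \<le> c"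
proof -
  obtain B where B: "\<And>x. norm (f x) \<le> B" using bounded_borelE[OF f] by blast
  note [measurable] = bounded_borelD[OF f]
  have B2: "norm (f x - f y) \<le> 2 * B" for x y
    using norm_triangle_ineq4[of "f x" "f y"] B[of x] B[of y] by linarith
  have "(norm (conv \<nu> f x - f x))\<^sup>2 \<le> (\<integral>z. (norm (f (x + z) - f x))\<^sup>2 \<partial>\<nu>)" for x
  proof -
    have "conv \<nu> f x - f x = (\<integral>z. f (x + z) - f x \<partial>\<nu>)"
      unfolding conv_def using f by (simp add: integrable_noise prob_space)
    then show ?thesis using norm_integral_square_le[of "\<lambda>z. f (x + z) - f x" "2 * B"] B2 by simp
  qed
  then have "energy (\<lambda>x. conv \<nu> f x - f x) \<le> (\<integral>x. (\<integral>z. (norm (f (x + z) - f x))\<^sup>2 \<partial>\<nu>) \<partial>torus_measure)"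
    unfolding energy_def using f bounded_borel_integral_noise by (intro integral_mono integrable_torus) auto
  also have "\<dots> \<le> c" by (rule integral_variation[OF f c])
  finally show ?thesis .
qed

lemma norm_multiplier_le: "norm (multiplier \<nu> k) \<le> 1"
proof -
  have "norm (multiplier \<nu> k) \<le> (\<integral>z. norm (character k z) \<partial>\<nu>)"
    unfolding multiplier_def by (rule integral_norm_bound)
  then show ?thesis by simp
qed

lemma conv_trig_poly: "conv \<nu> (trig_poly F a) = trig_poly F (\<lambda>k. a k * multiplier \<nu> k)"
proof
  fix x
  have "conv \<nu> (trig_poly F a) x = (\<integral>z. (\<Sum>k\<in>F. (a k * character k x) * character k z) \<partial>\<nu>)"
    unfolding conv_def trig_poly_def by (simp add: character_add mult.assoc)
  also have "\<dots> = (\<Sum>k\<in>F. (a k * character k x) * multiplier \<nu> k)"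
    unfolding multiplier_def by (subst Bochner_Integration.integral_sum) (auto intro!: integrable_noise)
  finally show "conv \<nu> (trig_poly F a) x = trig_poly F (\<lambda>k. a k * multiplier \<nu> k) x"
    by (simp add: trig_poly_def mult_ac)
qed

lemma loss_trig_poly:
  assumes "finite F"
  shows "loss \<nu> (trig_poly F a) = (\<Sum>k\<in>F. (1 - (norm (multiplier \<nu> k))\<^sup>2) * (norm (a k))\<^sup>2)"
  by (simp add: loss_def conv_trig_poly energy_trig_poly[OF assms] norm_mult power_mult_distrib
      sum_subtractf[symmetric] algebra_simps)

lemma conv_tendsto:
  assumes "\<And>n. bounded_borel (F n)" "bounded_borel f" "(\<lambda>n. norm_L2 (\<lambda>x. F n x - f x)) \<longlonglongrightarrow> 0"
  shows "(\<lambda>n. norm_L2 (\<lambda>x. conv \<nu> (F n) x - conv \<nu> f x)) \<longlonglongrightarrow> 0"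
proof (rule Lim_null_comparison[OF _ assms(3)])
  have "norm_L2 (\<lambda>x. conv \<nu> (F n) x - conv \<nu> f x) \<le> norm_L2 (\<lambda>x. F n x - f x)" for n
  proof -
    have "conv \<nu> (\<lambda>x. F n x - f x) = (\<lambda>x. conv \<nu> (F n) x - conv \<nu> f x)"
      by (rule ext) (intro conv_diff assms)
    then show ?thesis using norm_L2_conv_le[of "\<lambda>x. F n x - f x"] assms by simp
  qed
  then show "\<forall>\<^sub>F n in sequentially. norm (norm_L2 (\<lambda>x. conv \<nu> (F n) x - conv \<nu> f x)) \<le> norm_L2 (\<lambda>x. F n x - f x)"
    by (intro always_eventually) auto
qed

lemma loss_tendsto:
  assumes "\<And>n. bounded_borel (F n)" "bounded_borel f" "(\<lambda>n. norm_L2 (\<lambda>x. F n x - f x)) \<longlonglongrightarrow> 0"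
  shows "(\<lambda>n. loss \<nu> (F n)) \<longlonglongrightarrow> loss \<nu> f"
  unfolding loss_def using assms
  by (intro tendsto_diff energy_tendsto conv_tendsto bounded_borel_conv)

text \<open>If the multiplier differs from \<open>1\<close> by no more than its modulus does, up to a factor, then
  the displacement by the noise is invisible unless energy is lost both in \<open>f\<close> and in the function
  it is tested with. On trigonometric polynomials this is the Cauchy-Schwarz inequality with the
  weights \<open>1 - |multiplier|\<^sup>2\<close>.\<close>

lemma inner_displacement_le_loss:
  assumes B: "\<And>k. norm (multiplier \<nu> k - 1) \<le> B * (1 - (norm (multiplier \<nu> k))\<^sup>2)" "B \<ge> 0"
    and f: "bounded_borel f" and g: "bounded_borel g"
  shows "(norm (inner_L2 (\<lambda>x. conv \<nu> f x - f x) g))\<^sup>2 \<le> B\<^sup>2 * (loss \<nu> f * loss \<nu> g)"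
proof -
  obtain F a where F: "\<And>n. finite (F n)" "(\<lambda>n. norm_L2 (\<lambda>x. trig_poly (F n) (a n) x - f x)) \<longlonglongrightarrow> 0"
    using trig_polys_dense[OF f] by blast
  obtain G b where G: "\<And>n. finite (G n)" "(\<lambda>n. norm_L2 (\<lambda>x. trig_poly (G n) (b n) x - g x)) \<longlonglongrightarrow> 0"
    using trig_polys_dense[OF g] by blast
  define f' where "f' n = trig_poly (F n) (a n)" for n
  define g' where "g' n = trig_poly (G n) (b n)" for n
  have bb: "bounded_borel (f' n)" "bounded_borel (g' n)" for n by (auto simp: f'_def g'_def)
  have lim: "(\<lambda>n. norm_L2 (\<lambda>x. f' n x - f x)) \<longlonglongrightarrow> 0" "(\<lambda>n. norm_L2 (\<lambda>x. g' n x - g x)) \<longlonglongrightarrow> 0"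
    using F(2) G(2) by (simp_all add: f'_def g'_def)
  have poly: "(norm (inner_L2 (\<lambda>x. conv \<nu> (f' n) x - f' n x) (g' n)))\<^sup>2 \<le> B\<^sup>2 * (loss \<nu> (f' n) * loss \<nu> (g' n))" for n
  proof -
    define H where "H = F n \<union> G n"
    have H: "finite H" using F(1) G(1) by (simp add: H_def)
    define a' where "a' k = (if k \<in> F n then a n k else 0)" for k
    define b' where "b' k = (if k \<in> G n then b n k else 0)" for k
    have fg: "f' n = trig_poly H a'" "g' n = trig_poly H b'"
      unfolding f'_def g'_def a'_def b'_def using H by (auto intro!: trig_poly_extend simp: H_def)
    define w where "w k = sqrt (1 - (norm (multiplier \<nu> k))\<^sup>2)" for k
    have w2: "(w k)\<^sup>2 = 1 - (norm (multiplier \<nu> k))\<^sup>2" for k using norm_multiplier_le by (simp add: w_def power_le_one)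
    have "inner_L2 (\<lambda>x. conv \<nu> (f' n) x - f' n x) (g' n) = (\<Sum>k\<in>H. (a' k * multiplier \<nu> k - a' k) * cnj (b' k))"
      unfolding fg conv_trig_poly trig_poly_diff by (rule inner_L2_trig_poly[OF H])
    also have "norm \<dots> \<le> (\<Sum>k\<in>H. norm ((a' k * multiplier \<nu> k - a' k) * cnj (b' k)))" by (rule norm_sum)
    also have "\<dots> \<le> (\<Sum>k\<in>H. B * ((w k * norm (a' k)) * (w k * norm (b' k))))"
    proof (intro sum_mono)
      fix k
      have "a' k * multiplier \<nu> k - a' k = a' k * (multiplier \<nu> k - 1)" by (simp add: algebra_simps)
      then have "norm ((a' k * multiplier \<nu> k - a' k) * cnj (b' k)) = norm (multiplier \<nu> k - 1) * (norm (a' k) * norm (b' k))"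
        by (simp add: norm_mult)
      also have "\<dots> \<le> (B * (w k)\<^sup>2) * (norm (a' k) * norm (b' k))"
        unfolding w2 by (intro mult_right_mono B) auto
      finally show "norm ((a' k * multiplier \<nu> k - a' k) * cnj (b' k)) \<le> B * ((w k * norm (a' k)) * (w k * norm (b' k)))"
        by (simp add: power2_eq_square mult_ac)
    qed
    also have "\<dots> = B * (\<Sum>k\<in>H. (w k * norm (a' k)) * (w k * norm (b' k)))" by (simp add: sum_distrib_left)
    finally have "(norm (inner_L2 (\<lambda>x. conv \<nu> (f' n) x - f' n x) (g' n)))\<^sup>2
        \<le> (B * (\<Sum>k\<in>H. (w k * norm (a' k)) * (w k * norm (b' k))))\<^sup>2"
      by (intro power_mono) auto
    also have "\<dots> \<le> B\<^sup>2 * ((\<Sum>k\<in>H. (w k * norm (a' k))\<^sup>2) * (\<Sum>k\<in>H. (w k * norm (b' k))\<^sup>2))"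
      unfolding power_mult_distrib[of B] by (intro mult_left_mono Cauchy_Schwarz_ineq_sum) auto
    also have "\<dots> = B\<^sup>2 * (loss \<nu> (f' n) * loss \<nu> (g' n))"
      unfolding fg loss_trig_poly[OF H] by (simp add: power_mult_distrib w2)
    finally show ?thesis .
  qed
  have d: "(\<lambda>n. norm_L2 (\<lambda>x. (conv \<nu> (f' n) x - f' n x) - (conv \<nu> f x - f x))) \<longlonglongrightarrow> 0"
  proof (rule Lim_null_comparison)
    have "norm_L2 (\<lambda>x. (conv \<nu> (f' n) x - f' n x) - (conv \<nu> f x - f x))
        \<le> norm_L2 (\<lambda>x. conv \<nu> (f' n) x - conv \<nu> f x) + norm_L2 (\<lambda>x. f' n x - f x)" for n
    proof -
      have "(\<lambda>x. (conv \<nu> (f' n) x - f' n x) - (conv \<nu> f x - f x))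
          = (\<lambda>x. (conv \<nu> (f' n) x - conv \<nu> f x) + (f x - f' n x))" by auto
      then show ?thesis
        using norm_L2_triangle[of "\<lambda>x. conv \<nu> (f' n) x - conv \<nu> f x" "\<lambda>x. f x - f' n x"] bb f
        by (simp add: norm_L2_minus[of f])
    qed
    then show "\<forall>\<^sub>F n in sequentially. norm (norm_L2 (\<lambda>x. (conv \<nu> (f' n) x - f' n x) - (conv \<nu> f x - f x)))
        \<le> norm_L2 (\<lambda>x. conv \<nu> (f' n) x - conv \<nu> f x) + norm_L2 (\<lambda>x. f' n x - f x)"
      by (intro always_eventually) auto
    show "(\<lambda>n. norm_L2 (\<lambda>x. conv \<nu> (f' n) x - conv \<nu> f x) + norm_L2 (\<lambda>x. f' n x - f x)) \<longlonglongrightarrow> 0"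
      using tendsto_add[OF conv_tendsto[OF bb(1) f lim(1)] lim(1)] by simp
  qed
  have inner: "(\<lambda>n. inner_L2 (\<lambda>x. conv \<nu> (f' n) x - f' n x) (g' n)) \<longlonglongrightarrow> inner_L2 (\<lambda>x. conv \<nu> f x - f x) g"
    using bb f g lim(2) d by (intro inner_L2_tendsto) auto
  show ?thesis
  proof (rule LIMSEQ_le)
    show "(\<lambda>n. (norm (inner_L2 (\<lambda>x. conv \<nu> (f' n) x - f' n x) (g' n)))\<^sup>2)
        \<longlonglongrightarrow> (norm (inner_L2 (\<lambda>x. conv \<nu> f x - f x) g))\<^sup>2"
      by (intro tendsto_intros inner)
    show "(\<lambda>n. B\<^sup>2 * (loss \<nu> (f' n) * loss \<nu> (g' n))) \<longlonglongrightarrow> B\<^sup>2 * (loss \<nu> f * loss \<nu> g)"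
      by (intro tendsto_intros loss_tendsto bb f g lim)
  qed (use poly in auto)
qed

end

section \<open>Invariance of Lebesgue measure under similarities\<close>

(* Keeps transposed matrices in the form in which orthogonality cancels them. *)
declare transpose_matrix_vector [simp del]

lemma norm_orthogonal_matrix_mult:
  fixes Q :: "real^'n^'n"
  assumes "orthogonal_matrix Q" shows "norm (Q *v x) = norm x"
proof -
  have "orthogonal_transformation ((*v) Q)"
    using assms by (simp add: orthogonal_transformation_matrix)
  then show ?thesis by (rule orthogonal_transformation_norm)
qed

lemma matrix_mult_measurable [measurable]:
  fixes Q :: "real^'n^'m"
  shows "(\<lambda>x. Q *v x) \<in> borel_measurable borel"
  by (intro borel_measurable_continuous_onI matrix_vector_mult_linear_continuous_on)

text \<open>Weil's uniqueness argument: testing \<open>indicator A x * indicator B (x + Q y)\<close> with the unit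
  ball \<open>A\<close>, the two orders of integration give \<open>|A|\<close> times the measure of the preimage of \<open>B\<close> and
  \<open>|A|\<close> times the measure of \<open>B\<close>, as \<open>Q\<close> maps balls to balls.\<close>

lemma distr_lborel_orthogonal:
  fixes Q :: "real^'n^'n"
  assumes Q: "orthogonal_matrix Q"
  shows "distr lborel borel (\<lambda>x. Q *v x) = lborel"
proof (rule measure_eqI)
  fix B assume "B \<in> sets (distr lborel borel (\<lambda>x. Q *v x))"
  then have [measurable]: "B \<in> sets borel" by simp
  let ?A = "ball (0 :: real^'n) 1"
  have [measurable]: "?A \<in> sets borel" by simp
  have QT: "Q *v (transpose Q *v x) = x" "transpose Q *v (Q *v x) = x" for x
    using Q by (simp_all add: matrix_vector_mul_assoc orthogonal_matrix_def)
  have QT': "orthogonal_matrix (transpose Q)" using Q by simp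
  define m where "m = emeasure lborel ((\<lambda>x. Q *v x) -` B)"
  have 1: "(\<integral>\<^sup>+y. indicator B (x + Q *v y) \<partial>lborel) = m" for x
  proof -
    have "(\<integral>\<^sup>+y. indicator B (Q *v y) \<partial>lborel) = (\<integral>\<^sup>+y. indicator B (Q *v (transpose Q *v x + y)) \<partial>lborel)"
      by (rule nn_integral_lborel_shift[where f = "\<lambda>y. indicator B (Q *v y)"]) measurable
    also have "(\<lambda>y. indicator B (Q *v (transpose Q *v x + y)) :: ennreal) = (\<lambda>y. indicator B (x + Q *v y))"
      by (simp add: matrix_vector_right_distrib QT)
    also have "(\<integral>\<^sup>+y. indicator B (Q *v y) \<partial>lborel) = (\<integral>\<^sup>+y. indicator ((\<lambda>x. Q *v x) -` B) y \<partial>lborel)"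
      by (intro nn_integral_cong) (simp add: indicator_def)
    also have "\<dots> = m" unfolding m_def
      by (rule nn_integral_indicator) (use measurable_sets[OF matrix_mult_measurable[of Q], of B] in simp)
    finally show ?thesis by simp
  qed
  have 2: "(\<integral>\<^sup>+y. indicator ?A (x - Q *v y) \<partial>lborel) = emeasure lborel ?A" for x
  proof -
    have eq: "indicator ?A (x - Q *v y) = (indicator ?A (y - transpose Q *v x) :: ennreal)" for y
    proof -
      have "norm (x - Q *v y) = norm (transpose Q *v (x - Q *v y))"
        by (simp only: norm_orthogonal_matrix_mult[OF QT'])
      also have "\<dots> = norm (transpose Q *v x - y)" by (simp add: matrix_vector_mult_diff_distrib QT)
      finally show ?thesis by (simp add: indicator_def norm_minus_commute)
    qed
    have "(\<integral>\<^sup>+y. indicator ?A (y - transpose Q *v x) \<partial>lborel) = (\<integral>\<^sup>+y. indicator ?A (transpose Q *v x + y - transpose Q *v x) \<partial>lborel)"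
    proof (rule nn_integral_lborel_shift[where f = "\<lambda>y. indicator ?A (y - transpose Q *v x)"])
      have "(\<lambda>y. y - transpose Q *v x) \<in> borel_measurable borel" "indicator ?A \<in> borel_measurable borel"
        by measurable
      then show "(\<lambda>y. indicator ?A (y - transpose Q *v x) :: ennreal) \<in> borel_measurable borel"
        by (rule measurable_compose)
    qed
    then show ?thesis by (simp add: eq)
  qed
  have meas: "(\<lambda>(x, y). indicator ?A x * indicator B (x + Q *v y) :: ennreal) \<in> borel_measurable (lborel \<Otimes>\<^sub>M lborel)"
    "(\<lambda>(x, y). indicator ?A (x - Q *v y) * indicator B x :: ennreal) \<in> borel_measurable (lborel \<Otimes>\<^sub>M lborel)"
    by measurable
  have "emeasure lborel ?A * m = (\<integral>\<^sup>+x. (\<integral>\<^sup>+y. indicator ?A x * indicator B (x + Q *v y) \<partial>lborel) \<partial>lborel)"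
    by (simp add: nn_integral_cmult 1 nn_integral_multc)
  also have "\<dots> = (\<integral>\<^sup>+y. (\<integral>\<^sup>+x. indicator ?A x * indicator B (x + Q *v y) \<partial>lborel) \<partial>lborel)"
    using lborel_pair.Fubini'[OF meas(1)] by simp
  also have "\<dots> = (\<integral>\<^sup>+y. (\<integral>\<^sup>+x. indicator ?A (x - Q *v y) * indicator B x \<partial>lborel) \<partial>lborel)"
  proof (rule nn_integral_cong)
    fix y :: "real^'n"
    have "(\<integral>\<^sup>+x. indicator ?A (x - Q *v y) * indicator B x \<partial>lborel)
        = (\<integral>\<^sup>+x. indicator ?A (Q *v y + x - Q *v y) * indicator B (Q *v y + x) \<partial>lborel)"
      by (rule nn_integral_lborel_shift[where f = "\<lambda>x. indicator ?A (x - Q *v y) * indicator B x"]) measurable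
    then show "(\<integral>\<^sup>+x. indicator ?A x * indicator B (x + Q *v y) \<partial>lborel)
        = (\<integral>\<^sup>+x. indicator ?A (x - Q *v y) * indicator B x \<partial>lborel)" by (simp add: add.commute)
  qed
  also have "\<dots> = (\<integral>\<^sup>+x. (\<integral>\<^sup>+y. indicator ?A (x - Q *v y) * indicator B x \<partial>lborel) \<partial>lborel)"
    using lborel_pair.Fubini'[OF meas(2)] by simp
  also have "\<dots> = emeasure lborel ?A * emeasure lborel B"
    by (simp add: nn_integral_multc 2 nn_integral_cmult)
  finally have eq: "emeasure lborel ?A * m = emeasure lborel ?A * emeasure lborel B" .
  have "emeasure lborel ?A \<noteq> 0" "emeasure lborel ?A \<noteq> \<infinity>"
    using emeasure_bounded_finite[of ?A] content_ball_pos[of 1 "0 :: real^'n"]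
    by (auto simp: measure_def)
  with eq have "m = emeasure lborel B" by (simp add: ennreal_mult_cancel_left)
  then show "emeasure (distr lborel borel (\<lambda>x. Q *v x)) B = emeasure lborel B"
    by (simp add: emeasure_distr m_def)
qed simp

lemma lborel_similarity:
  fixes Q :: "real^'n^'n"
  assumes Q: "orthogonal_matrix Q" and c: "c > 0"
  shows "lborel = density (distr lborel borel (\<lambda>x. t + c *\<^sub>R (Q *v x))) (\<lambda>_. ennreal (c ^ CARD('n)))"
proof -
  have "distr lborel borel (\<lambda>x. t + c *\<^sub>R (Q *v x)) = distr (distr lborel borel (\<lambda>x. Q *v x)) borel (\<lambda>x. t + c *\<^sub>R x)"
    by (subst distr_distr) (auto simp: comp_def)
  also have "\<dots> = distr lborel borel (\<lambda>x. t + c *\<^sub>R x)" by (simp add: distr_lborel_orthogonal[OF Q])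
  finally show ?thesis using lborel_affine[of c t] c by simp
qed

section \<open>Piecewise affine Bernoulli maps\<close>

lemma integral_torus:
  fixes f :: "'n::finite torus \<Rightarrow> 'c::{banach, second_countable_topology}"
  assumes [measurable]: "f \<in> borel_measurable borel"
  shows "(\<integral>x. f x \<partial>torus_measure) = (\<integral>y. indicator unit_cube y *\<^sub>R f (torus_of y) \<partial>lborel)"
  unfolding torus_measure_def
  by (subst integral_distr) (auto simp: integral_restrict_space measurable_restrict_space1)

locale bernoulli =
  fixes M :: nat and E :: "nat \<Rightarrow> (real^'n::finite) set" and D :: "nat \<Rightarrow> real^'n^'n" and e :: "nat \<Rightarrow> real^'n"
  assumes data: "bernoulli_data M E D e"
begin

abbreviation p :: "nat \<Rightarrow> real" where "p \<equiv> branch_measure E"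
abbreviation \<phi> :: "'n torus \<Rightarrow> 'n torus" where "\<phi> \<equiv> bernoulli_map M E D e"

definition side :: "nat \<Rightarrow> real" where
  "side i = p i powr (1 / real CARD('n))"

text \<open>The inverse of the affine branch on all of space. It maps the unit cube onto \<open>E i\<close> and
  contracts lengths by \<open>side i\<close>, and \<open>\<psi> i\<close> is the same map on the torus.\<close>

definition chart :: "nat \<Rightarrow> real^'n \<Rightarrow> real^'n" where
  "chart i y = side i *\<^sub>R (transpose (D i) *v (y - e i))"

definition branch :: "'n torus \<Rightarrow> nat" where
  "branch x = (THE i. i \<in> {1..M} \<and> check x \<in> E i)"

definition \<psi> :: "nat \<Rightarrow> 'n torus \<Rightarrow> 'n torus" where
  "\<psi> i x = torus_of (chart i (check x))"

lemma p_bounds: "i \<in> {1..M} \<Longrightarrow> 0 < p i" "i \<in> {1..M} \<Longrightarrow> p i < 1"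
  using data by (auto simp: bernoulli_data_def)

lemma M_ge: "2 \<le> M" using data by (simp add: bernoulli_data_def)

lemma side_bounds: assumes "i \<in> {1..M}" shows "0 < side i" "side i < 1"
  using p_bounds[OF assms] powr_less_mono2[of "1 / real CARD('n)" "p i" 1] by (auto simp: side_def)

lemma side_power: assumes "i \<in> {1..M}" shows "side i ^ CARD('n) = p i"
  using p_bounds[OF assms] by (simp add: side_def powr_realpow[symmetric] powr_powr)

lemma affine_branch_eq:
  "i \<in> {1..M} \<Longrightarrow> affine_branch E D e i x = (1 / side i) *\<^sub>R (D i *v x) + e i"
  using p_bounds by (simp add: affine_branch_def side_def powr_minus_divide)

lemma D_orth: "i \<in> {1..M} \<Longrightarrow> orthogonal_matrix (D i)"
  using data by (auto simp: bernoulli_data_def)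

lemma affine_branch_chart:
  assumes i: "i \<in> {1..M}"
  shows "affine_branch E D e i (chart i y) = y" "chart i (affine_branch E D e i y) = y"
proof -
  have QT: "D i *v (transpose (D i) *v x) = x" "transpose (D i) *v (D i *v x) = x" for x
    using D_orth[OF i] by (simp_all add: matrix_vector_mul_assoc orthogonal_matrix_def)
  show "affine_branch E D e i (chart i y) = y" "chart i (affine_branch E D e i y) = y"
    using side_bounds[OF i]
    by (simp_all add: affine_branch_eq[OF i] chart_def matrix_vector_mult_scaleR QT)
qed

lemma E_subset: "i \<in> {1..M} \<Longrightarrow> E i \<subseteq> unit_cube"
  using data by (auto simp: bernoulli_data_def)

lemma affine_branch_in_cube_iff:
  assumes i: "i \<in> {1..M}"
  shows "affine_branch E D e i x \<in> unit_cube \<longleftrightarrow> x \<in> E i"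
proof
  have bij: "bij_betw (affine_branch E D e i) (E i) unit_cube"
    using data i by (auto simp: bernoulli_data_def)
  show "x \<in> E i \<Longrightarrow> affine_branch E D e i x \<in> unit_cube" using bij by (auto simp: bij_betw_def)
  assume "affine_branch E D e i x \<in> unit_cube"
  then obtain x' where x': "x' \<in> E i" "affine_branch E D e i x' = affine_branch E D e i x"
    using bij unfolding bij_betw_def by (metis imageE)
  then have "chart i (affine_branch E D e i x') = chart i (affine_branch E D e i x)" by simp
  then have "x' = x" using affine_branch_chart(2)[OF i] by simp
  then show "x \<in> E i" using x' by simp
qed

lemma chart_in_E_iff: "i \<in> {1..M} \<Longrightarrow> chart i y \<in> E i \<longleftrightarrow> y \<in> unit_cube"
  using affine_branch_in_cube_iff[of i "chart i y"] affine_branch_chart(1)[of i y] by simp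

lemma branch_unique: "i \<in> {1..M} \<Longrightarrow> check x \<in> E i \<Longrightarrow> branch x = i"
proof -
  assume i: "i \<in> {1..M}" "check x \<in> E i"
  have "E i \<inter> E j = {}" if "j \<in> {1..M}" "i \<noteq> j" for j
    using data i(1) that unfolding bernoulli_data_def disjoint_family_on_def by blast
  then show "branch x = i" unfolding branch_def using i by (intro the_equality) blast+
qed

lemma branch_in: "branch x \<in> {1..M}" and check_in_branch: "check x \<in> E (branch x)"
proof -
  have "check x \<in> (\<Union>i\<in>{1..M}. E i)" using data check_in_unit_cube[of x] by (simp add: bernoulli_data_def)
  then obtain i where i: "i \<in> {1..M}" "check x \<in> E i" by blast
  then show "branch x \<in> {1..M}" "check x \<in> E (branch x)" using branch_unique[OF i] by auto
qed

lemma \<phi>_eq: "\<phi> x = torus_of (affine_branch E D e (branch x) (check x))"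
proof -
  have "x \<in> torus_of ` E i \<longleftrightarrow> check x \<in> E i" if "i \<in> {1..M}" for i
    using E_subset[OF that] check_torus_of torus_of_check by (metis (no_types, lifting) image_iff subsetD)
  then have "(THE i. i \<in> {1..M} \<and> x \<in> torus_of ` E i) = branch x"
    unfolding branch_def by (intro arg_cong[where f = The]) (auto simp: fun_eq_iff)
  then show ?thesis by (simp add: bernoulli_map_def torus_branch_def)
qed

lemma check_\<phi>: "check (\<phi> x) = affine_branch E D e (branch x) (check x)"
  unfolding \<phi>_eq using affine_branch_in_cube_iff[OF branch_in] check_in_branch
  by (intro check_torus_of) auto

lemma check_\<psi>: "i \<in> {1..M} \<Longrightarrow> check (\<psi> i x) = chart i (check x)"
  unfolding \<psi>_def using chart_in_E_iff[of i "check x"] check_in_unit_cube E_subset[of i]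
  by (intro check_torus_of) auto

lemma branch_\<psi>: "i \<in> {1..M} \<Longrightarrow> branch (\<psi> i x) = i"
  by (rule branch_unique) (auto simp: check_\<psi> chart_in_E_iff check_in_unit_cube)

lemma \<phi>_\<psi>: "i \<in> {1..M} \<Longrightarrow> \<phi> (\<psi> i x) = x"
  by (simp add: \<phi>_eq branch_\<psi> check_\<psi> affine_branch_chart torus_of_check)

lemma branch_affine_measurable [measurable]: "affine_branch E D e i \<in> borel_measurable borel"
  unfolding affine_branch_def by measurable

lemma chart_measurable [measurable]: "chart i \<in> borel_measurable borel"
  unfolding chart_def by measurable

lemma E_borel [measurable]: assumes i: "i \<in> {1..M}" shows "E i \<in> sets borel"
proof -
  have "E i = affine_branch E D e i -` unit_cube \<inter> space borel"
    using affine_branch_in_cube_iff[OF i] by auto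
  also have "\<dots> \<in> sets borel" by measurable
  finally show ?thesis .
qed

lemma \<psi>_measurable [measurable]: "\<psi> i \<in> borel_measurable borel"
  unfolding \<psi>_def by measurable

lemma branch_measurable [measurable]: "branch \<in> measurable borel (count_space UNIV)"
proof -
  have "branch -` {i} \<inter> space borel \<in> sets borel" for i
  proof (cases "i \<in> {1..M}")
    case True
    note [measurable] = E_borel[OF True]
    have "branch -` {i} \<inter> space borel = {x \<in> space borel. check x \<in> E i}"
      using branch_unique[OF True] check_in_branch by auto
    also have "\<dots> \<in> sets borel" by measurable
    finally show ?thesis .
  next
    case False
    then have "branch -` {i} \<inter> space borel = {}" using branch_in by auto
    then show ?thesis by simp
  qed
  then show ?thesis by (simp add: measurable_count_space_eq2_countable)
qed

lemma \<phi>_measurable [measurable]: "\<phi> \<in> borel_measurable borel"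
proof -
  have "(\<lambda>x. torus_of (affine_branch E D e (branch x) (check x))) \<in> borel_measurable borel"
    by (rule measurable_compose_countable[OF _ branch_measurable]) measurable
  then show ?thesis by (simp add: \<phi>_eq[abs_def])
qed

text \<open>Change of variables in each \<open>E i\<close>, whose volume is \<open>p i\<close>. All statements about the map below
  rest on this self-similarity of the measure.\<close>

lemma integral_branches:
  fixes f :: "'n torus \<Rightarrow> 'c::{banach, second_countable_topology}"
  assumes f: "bounded_borel f"
  shows "(\<integral>x. f x \<partial>torus_measure) = (\<Sum>i\<in>{1..M}. p i *\<^sub>R (\<integral>x. f (\<psi> i x) \<partial>torus_measure))"
proof -
  note [measurable] = bounded_borelD[OF f]
  obtain B where B: "\<And>x. norm (f x) \<le> B" using bounded_borelE[OF f] by blast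
  have cube: "emeasure lborel (unit_cube :: (real^'n) set) < \<infinity>" by (simp add: emeasure_unit_cube)
  have int: "integrable lborel (\<lambda>y. indicator (E i) y *\<^sub>R f (torus_of y))" if i: "i \<in> {1..M}" for i
  proof (rule integrableI_bounded_set[where A = "E i" and B = B])
    note [measurable] = E_borel[OF i]
    show "(\<lambda>y. indicator (E i) y *\<^sub>R f (torus_of y)) \<in> borel_measurable lborel" "E i \<in> sets lborel" by measurable
    show "emeasure lborel (E i) < \<infinity>"
      using emeasure_mono[OF E_subset[OF i], of lborel] cube by (auto simp: order_le_less_trans)
  qed (auto simp: indicator_def B)
  have "(\<integral>x. f x \<partial>torus_measure) = (\<integral>y. indicator unit_cube y *\<^sub>R f (torus_of y) \<partial>lborel)"
    by (rule integral_torus) measurable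
  also have "\<dots> = (\<integral>y. (\<Sum>i\<in>{1..M}. indicator (E i) y *\<^sub>R f (torus_of y)) \<partial>lborel)"
  proof (intro Bochner_Integration.integral_cong refl)
    fix y :: "real^'n"
    have "indicat_real unit_cube y = (\<Sum>i\<in>{1..M}. indicat_real (E i) y)"
      using data unfolding bernoulli_data_def by (metis finite_atLeastAtMost indicator_UN_disjoint)
    then show "indicat_real unit_cube y *\<^sub>R f (torus_of y) = (\<Sum>i\<in>{1..M}. indicat_real (E i) y *\<^sub>R f (torus_of y))"
      by (simp add: scaleR_sum_left)
  qed
  also have "\<dots> = (\<Sum>i\<in>{1..M}. \<integral>y. indicator (E i) y *\<^sub>R f (torus_of y) \<partial>lborel)"
    by (rule Bochner_Integration.integral_sum) (use int in auto)
  also have "\<dots> = (\<Sum>i\<in>{1..M}. p i *\<^sub>R (\<integral>x. f (\<psi> i x) \<partial>torus_measure))"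
  proof (intro sum.cong refl)
    fix i assume i: "i \<in> {1..M}"
    note [measurable] = E_borel[OF i]
    have QT: "orthogonal_matrix (transpose (D i))" using D_orth[OF i] by simp
    have "chart i = (\<lambda>x. (- (side i *\<^sub>R (transpose (D i) *v e i))) + side i *\<^sub>R (transpose (D i) *v x))"
      by (auto simp: chart_def matrix_vector_mult_diff_distrib scaleR_diff_right)
    then have lb: "(lborel :: (real^'n) measure) = density (distr lborel borel (chart i)) (\<lambda>_. ennreal (p i))"
      using lborel_similarity[OF QT side_bounds(1)[OF i], of "- (side i *\<^sub>R (transpose (D i) *v e i))"]
      by (simp only: side_power[OF i])
    have "(\<integral>y. indicator (E i) y *\<^sub>R f (torus_of y) \<partial>lborel)
        = (\<integral>y. indicator (E i) y *\<^sub>R f (torus_of y) \<partial>density (distr lborel borel (chart i)) (\<lambda>_. ennreal (p i)))"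
      using lb by simp
    also have "\<dots> = (\<integral>y. p i *\<^sub>R (indicator (E i) y *\<^sub>R f (torus_of y)) \<partial>distr lborel borel (chart i))"
      using p_bounds[OF i] by (subst integral_density) auto
    also have "\<dots> = (\<integral>y. p i *\<^sub>R (indicator (E i) (chart i y) *\<^sub>R f (torus_of (chart i y))) \<partial>lborel)"
      by (subst integral_distr) auto
    also have "\<dots> = p i *\<^sub>R (\<integral>y. indicator (E i) (chart i y) *\<^sub>R f (torus_of (chart i y)) \<partial>lborel)"
      by (simp del: scaleR_scaleR)
    also have "(\<integral>y. indicator (E i) (chart i y) *\<^sub>R f (torus_of (chart i y)) \<partial>lborel)
        = (\<integral>y. indicator unit_cube y *\<^sub>R f (\<psi> i (torus_of y)) \<partial>lborel)"
      by (intro Bochner_Integration.integral_cong refl) (auto simp: indicator_def chart_in_E_iff[OF i] \<psi>_def check_torus_of)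
    also have "\<dots> = (\<integral>x. f (\<psi> i x) \<partial>torus_measure)"
      by (rule integral_torus[symmetric]) measurable
    finally show "(\<integral>y. indicator (E i) y *\<^sub>R f (torus_of y) \<partial>lborel) = p i *\<^sub>R (\<integral>x. f (\<psi> i x) \<partial>torus_measure)" .
  qed
  finally show ?thesis .
qed

lemma sum_p: "(\<Sum>i\<in>{1..M}. p i) = 1"
  using integral_branches[of "\<lambda>_. 1 :: real"] by simp

lemma bounded_borel_\<psi> [simp, intro]: "bounded_borel f \<Longrightarrow> bounded_borel (\<lambda>x. f (\<psi> i x))"
  by (rule bounded_borel_compose[where h = "\<psi> i"]) measurable

lemma bounded_borel_\<phi> [simp, intro]: "bounded_borel f \<Longrightarrow> bounded_borel (\<lambda>x. f (\<phi> x))"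
  by (rule bounded_borel_compose[where h = \<phi>]) measurable

lemma integral_\<phi>:
  fixes f :: "'n torus \<Rightarrow> 'c::{banach, second_countable_topology}"
  assumes f: "bounded_borel f"
  shows "(\<integral>x. f (\<phi> x) \<partial>torus_measure) = (\<integral>x. f x \<partial>torus_measure)"
proof -
  have "(\<integral>x. f (\<phi> x) \<partial>torus_measure) = (\<Sum>i\<in>{1..M}. p i *\<^sub>R (\<integral>x. f x \<partial>torus_measure))"
    using integral_branches[OF bounded_borel_\<phi>[OF f]] by (simp add: \<phi>_\<psi>)
  then show ?thesis by (simp add: scaleR_sum_left[symmetric] sum_p[simplified])
qed

lemma energy_\<phi>: "bounded_borel f \<Longrightarrow> energy (\<lambda>x. f (\<phi> x)) = energy f"
  unfolding energy_def by (rule integral_\<phi>[of "\<lambda>x. (norm (f x))\<^sup>2"]) auto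

lemma energy_branches: "bounded_borel f \<Longrightarrow> energy f = (\<Sum>i\<in>{1..M}. p i * energy (\<lambda>x. f (\<psi> i x)))"
  unfolding energy_def using integral_branches[of "\<lambda>x. (norm (f x))\<^sup>2"] by auto

lemma inner_L2_branches:
  "bounded_borel f \<Longrightarrow> bounded_borel g \<Longrightarrow>
    inner_L2 f g = (\<Sum>i\<in>{1..M}. p i *\<^sub>R inner_L2 (\<lambda>x. f (\<psi> i x)) (\<lambda>x. g (\<psi> i x)))"
  unfolding inner_L2_def using integral_branches[of "\<lambda>x. f x * cnj (g x)"] by auto

end

section \<open>Averages over cells of prescribed size\<close>

lemma measure_torus_le_box:
  fixes S :: "'n::finite torus set"
  assumes [measurable]: "S \<in> sets borel" and S: "\<And>x. x \<in> S \<Longrightarrow> check x \<in> cbox a b" and ab: "\<And>i. a $ i \<le> b $ i"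
  shows "measure torus_measure S \<le> (\<Prod>i\<in>UNIV. b $ i - a $ i)"
proof -
  have "emeasure torus_measure S = (\<integral>\<^sup>+x. indicator S x \<partial>torus_measure)" by simp
  also have "\<dots> = (\<integral>\<^sup>+y. indicator S (torus_of y) * indicator unit_cube y \<partial>lborel)"
    by (rule nn_integral_torus) measurable
  also have "\<dots> \<le> (\<integral>\<^sup>+y. indicator (cbox a b) y \<partial>lborel)"
    using S check_torus_of by (intro nn_integral_mono) (fastforce simp: indicator_def)
  also have "\<dots> = emeasure lborel (cbox a b)" by simp
  finally have "measure torus_measure S \<le> measure lborel (cbox a b)"
    unfolding measure_def by (rule enn2real_mono) (use emeasure_lborel_cbox_finite[of a b] in \<open>simp add: less_top\<close>)
  also have "\<dots> = (\<Prod>i\<in>UNIV. b $ i - a $ i)"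
  proof (rule content_cbox_cart)
    have "a \<in> cbox a b" using ab by (simp add: mem_box_cart)
    then show "cbox a b \<noteq> {}" by blast
  qed
  finally show ?thesis .
qed

definition away_from_faces :: "real \<Rightarrow> 'n::finite torus \<Rightarrow> bool" where
  "away_from_faces \<rho> x \<longleftrightarrow> (\<forall>i. \<rho> \<le> check x $ i \<and> check x $ i \<le> 1 - \<rho>)"

lemma away_from_faces_measurable [measurable]: "Measurable.pred borel (away_from_faces \<rho>)"
  unfolding away_from_faces_def by measurable

lemma measure_near_faces:
  assumes "\<rho> > 0"
  shows "measure torus_measure {x :: 'n::finite torus. \<not> away_from_faces \<rho> x} \<le> 2 * real CARD('n) * \<rho>"
proof -
  have prod: "(\<Prod>j\<in>UNIV. if j = i then \<rho> else 1) = \<rho>" for i :: 'n by simp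
  have triv: "measure torus_measure S \<le> \<rho>" if "\<not> \<rho> \<le> 1" for S :: "'n torus set"
    using torus.prob_le_1[of S] that by linarith
  have low: "measure torus_measure {x :: 'n torus. check x $ i < \<rho>} \<le> \<rho>" for i
  proof (cases "\<rho> \<le> 1")
    case True
    have "measure torus_measure {x :: 'n torus. check x $ i < \<rho>}
        \<le> (\<Prod>j\<in>UNIV. (\<chi> j. if j = i then \<rho> else 1) $ j - (\<chi> j. (0 :: real)) $ j)"
    proof (rule measure_torus_le_box)
      show "{x :: 'n torus. check x $ i < \<rho>} \<in> sets borel" by measurable
      show "check x \<in> cbox (\<chi> j. 0) (\<chi> j. if j = i then \<rho> else 1)"
        if "x \<in> {x :: 'n torus. check x $ i < \<rho>}" for x
        using check_in_unit_cube[of x] that by (simp add: mem_box_cart unit_cube_def less_imp_le)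
    qed (use assms in auto)
    then show ?thesis by (simp add: prod)
  qed (rule triv)
  have high: "measure torus_measure {x :: 'n torus. 1 - \<rho> < check x $ i} \<le> \<rho>" for i
  proof (cases "\<rho> \<le> 1")
    case True
    have "measure torus_measure {x :: 'n torus. 1 - \<rho> < check x $ i}
        \<le> (\<Prod>j\<in>UNIV. (\<chi> j. (1 :: real)) $ j - (\<chi> j. if j = i then 1 - \<rho> else 0) $ j)"
    proof (rule measure_torus_le_box)
      show "{x :: 'n torus. 1 - \<rho> < check x $ i} \<in> sets borel" by measurable
      show "check x \<in> cbox (\<chi> j. if j = i then 1 - \<rho> else 0) (\<chi> j. 1)"
        if "x \<in> {x :: 'n torus. 1 - \<rho> < check x $ i}" for x
        using check_in_unit_cube[of x] that by (simp add: mem_box_cart unit_cube_def less_imp_le)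
    qed (use assms in auto)
    also have "\<dots> = (\<Prod>j\<in>UNIV. if j = i then \<rho> else 1)" by (intro prod.cong) auto
    finally show ?thesis by (simp add: prod)
  qed (rule triv)
  have "{x :: 'n torus. \<not> away_from_faces \<rho> x} = (\<Union>i\<in>UNIV. {x. check x $ i < \<rho>} \<union> {x. 1 - \<rho> < check x $ i})"
    by (auto simp: away_from_faces_def not_le)
  also have "measure torus_measure \<dots> \<le> (\<Sum>i\<in>UNIV. measure torus_measure ({x :: 'n torus. check x $ i < \<rho>} \<union> {x. 1 - \<rho> < check x $ i}))"
    by (rule torus.finite_measure_subadditive_finite) (auto, measurable)
  also have "\<dots> \<le> (\<Sum>i\<in>(UNIV :: 'n set). \<rho> + \<rho>)"
  proof (intro sum_mono)
    fix i :: 'n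
    have "measure torus_measure ({x :: 'n torus. check x $ i < \<rho>} \<union> {x. 1 - \<rho> < check x $ i})
        \<le> measure torus_measure {x :: 'n torus. check x $ i < \<rho>} + measure torus_measure {x :: 'n torus. 1 - \<rho> < check x $ i}"
      by (rule measure_Un_le) (simp_all, measurable)
    then show "measure torus_measure ({x :: 'n torus. check x $ i < \<rho>} \<union> {x. 1 - \<rho> < check x $ i}) \<le> \<rho> + \<rho>"
      using low[of i] high[of i] by linarith
  qed
  finally show ?thesis by simp
qed

context bernoulli
begin

definition smin :: real where "smin = p_min M E powr (1 / real CARD('n))"
definition smax :: real where "smax = p_max M E powr (1 / real CARD('n))"

lemma p_min_in: "p_min M E \<in> p ` {1..M}" and p_max_in: "p_max M E \<in> p ` {1..M}"
  unfolding p_min_def p_max_def using M_ge by (auto intro!: Min_in Max_in)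

lemma p_min_pos: "0 < p_min M E" and p_min_less: "p_min M E < 1"
  and p_max_pos: "0 < p_max M E" and p_max_less: "p_max M E < 1"
  using p_min_in p_max_in p_bounds by auto

lemma smin_bounds: "0 < smin" "smin < 1" and smax_bounds: "0 < smax" "smax < 1"
  unfolding smin_def smax_def
  using p_min_pos p_min_less p_max_pos p_max_less
    powr_less_mono2[of "1 / real CARD('n)" "p_min M E" 1] powr_less_mono2[of "1 / real CARD('n)" "p_max M E" 1]
  by auto

lemma side_between: assumes "i \<in> {1..M}" shows "smin \<le> side i" "side i \<le> smax"
proof -
  have "p_min M E \<le> p i" "p i \<le> p_max M E" using assms by (auto simp: p_min_def p_max_def)
  then show "smin \<le> side i" "side i \<le> smax"
    unfolding smin_def smax_def side_def using p_min_pos p_bounds(1)[OF assms]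
    by (auto intro!: powr_mono2)
qed

text \<open>The cells are the cylinders that are obtained by refining, for at most \<open>n\<close> generations, until
  the side length is at most \<open>r\<close>. Zooming into the first-generation cylinder with index \<open>i\<close> multiplies
  lengths by \<open>1 / side i\<close>, and so the cells need not be named: the conditional expectation
  with respect to them can be computed by recursion.\<close>

primrec cell_average :: "nat \<Rightarrow> real \<Rightarrow> ('n torus \<Rightarrow> complex) \<Rightarrow> 'n torus \<Rightarrow> complex" where
  "cell_average 0 r f = (\<lambda>_. \<integral>y. f y \<partial>torus_measure)"
| "cell_average (Suc n) r f = (if 1 \<le> r then (\<lambda>_. \<integral>y. f y \<partial>torus_measure)
     else (\<lambda>x. cell_average n (r / side (branch x)) (\<lambda>y. f (\<psi> (branch x) y)) (\<phi> x)))"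

declare cell_average.simps [simp del]

text \<open>The points whose distance to the boundary of their cell is at least \<open>\<rho>\<close>.\<close>

primrec inside_cell :: "nat \<Rightarrow> real \<Rightarrow> real \<Rightarrow> 'n torus \<Rightarrow> bool" where
  "inside_cell 0 r \<rho> = away_from_faces \<rho>"
| "inside_cell (Suc n) r \<rho> = (if 1 \<le> r then away_from_faces \<rho>
     else (\<lambda>x. inside_cell n (r / side (branch x)) (\<rho> / side (branch x)) (\<phi> x)))"

declare inside_cell.simps [simp del]

text \<open>Cells are never much smaller than \<open>r\<close>: a cell is refined only while its side exceeds \<open>r\<close>, so its parts
  have sides of at least \<open>smin * r\<close>. The condition \<open>r * smin \<le> 1\<close> allows for the sizes that
  are met when zooming in, which may exceed \<open>1\<close> by a factor of at most \<open>1 / smin\<close>.\<close>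

lemma rescaled_size:
  assumes "i \<in> {1..M}" "0 < r" "r < 1" shows "r / side i * smin \<le> 1"
proof -
  have "r * smin \<le> 1 * side i"
    using assms side_bounds side_between smin_bounds by (intro mult_mono) (auto simp: less_imp_le)
  then show ?thesis using side_bounds[OF assms(1)] by (simp add: field_simps)
qed

lemma norm_cell_average_le:
  assumes "bounded_borel f" "\<And>x. norm (f x) \<le> B"
  shows "norm (cell_average n r f x) \<le> B"
  using assms
proof (induction n arbitrary: r f x)
  have int: "norm (\<integral>y. f y \<partial>torus_measure) \<le> B" if "bounded_borel f" "\<And>x. norm (f x) \<le> B" for f :: "'n torus \<Rightarrow> complex"
  proof -
    have "norm (\<integral>y. f y \<partial>torus_measure) \<le> (\<integral>y. norm (f y) \<partial>torus_measure)" by (rule integral_norm_bound)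
    also have "\<dots> \<le> (\<integral>y. B \<partial>(torus_measure :: 'n torus measure))" using that by (intro integral_mono) auto
    finally show ?thesis by simp
  qed
  {
    case 0 then show ?case using int by (simp add: cell_average.simps)
  next
    case (Suc n) then show ?case using int by (simp add: cell_average.simps)
  }
qed

lemma bounded_borel_cell_average [simp, intro]:
  assumes "bounded_borel f" shows "bounded_borel (cell_average n r f)"
proof -
  have "cell_average n r f \<in> borel_measurable borel"
    using assms
  proof (induction n arbitrary: r f)
    case (Suc n)
    have [measurable]: "cell_average n (r / side i) (\<lambda>y. f (\<psi> i y)) \<in> borel_measurable borel" for i
      by (intro Suc.IH bounded_borel_\<psi> Suc.prems)
    have "(\<lambda>x. cell_average n (r / side (branch x)) (\<lambda>y. f (\<psi> (branch x) y)) (\<phi> x)) \<in> borel_measurable borel"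
      by (rule measurable_compose_countable[OF _ branch_measurable]) measurable
    then show ?case by (cases "1 \<le> r") (simp_all add: cell_average.simps)
  qed (simp add: cell_average.simps)
  then show ?thesis using norm_cell_average_le[OF assms] bounded_borelE[OF assms]
    by (metis bounded_borelI)
qed

lemma inside_cell_measurable [measurable]: "Measurable.pred borel (inside_cell n r \<rho>)"
proof (induction n arbitrary: r \<rho>)
  case (Suc n)
  note [measurable] = Suc
  have "Measurable.pred borel (\<lambda>x. inside_cell n (r / side (branch x)) (\<rho> / side (branch x)) (\<phi> x))"
    by (rule measurable_compose_countable[OF _ branch_measurable]) measurable
  then show ?case by (cases "1 \<le> r") (simp_all add: inside_cell.simps)
qed (simp add: inside_cell.simps)

lemma cell_average_\<psi>:
  "i \<in> {1..M} \<Longrightarrow> r < 1 \<Longrightarrow> cell_average (Suc n) r f (\<psi> i x) = cell_average n (r / side i) (\<lambda>y. f (\<psi> i y)) x"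
  by (simp add: branch_\<psi>[simplified] \<phi>_\<psi>[simplified] cell_average.simps)

lemma inside_cell_\<psi>:
  "i \<in> {1..M} \<Longrightarrow> r < 1 \<Longrightarrow> inside_cell (Suc n) r \<rho> (\<psi> i x) = inside_cell n (r / side i) (\<rho> / side i) x"
  by (simp add: branch_\<psi>[simplified] \<phi>_\<psi>[simplified] inside_cell.simps)

lemma cell_average_diff:
  assumes "bounded_borel f" "bounded_borel g"
  shows "cell_average n r (\<lambda>x. f x - g x) x = cell_average n r f x - cell_average n r g x"
  using assms by (induction n arbitrary: r f g x) (auto simp: cell_average.simps)

text \<open>Taking cell averages is an orthogonal projection.\<close>

lemma inner_cell_average:
  assumes "bounded_borel f" "bounded_borel g"
  shows "inner_L2 f (cell_average n r g) = inner_L2 (cell_average n r f) (cell_average n r g)"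
  using assms
proof (induction n arbitrary: r f g)
  have const: "inner_L2 f (\<lambda>_. c) = inner_L2 (\<lambda>_. \<integral>y. f y \<partial>torus_measure) (\<lambda>_. c)" for f :: "'n torus \<Rightarrow> complex" and c
    by (simp add: inner_L2_def)
  {
    case 0 then show ?case using const by (simp add: cell_average.simps)
  next
    case (Suc n)
    show ?case
    proof (cases "1 \<le> r")
      case True then show ?thesis using const by (simp add: cell_average.simps)
    next
      case False
      have "inner_L2 f (cell_average (Suc n) r g)
          = (\<Sum>i\<in>{1..M}. p i *\<^sub>R inner_L2 (\<lambda>x. f (\<psi> i x)) (\<lambda>x. cell_average (Suc n) r g (\<psi> i x)))"
        by (rule inner_L2_branches) (use Suc.prems in auto)
      also have "\<dots> = (\<Sum>i\<in>{1..M}. p i *\<^sub>R inner_L2 (\<lambda>x. cell_average (Suc n) r f (\<psi> i x)) (\<lambda>x. cell_average (Suc n) r g (\<psi> i x)))"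
      proof (intro sum.cong refl arg_cong2[where f = scaleR])
        fix i assume i: "i \<in> {1..M}"
        show "inner_L2 (\<lambda>x. f (\<psi> i x)) (\<lambda>x. cell_average (Suc n) r g (\<psi> i x))
            = inner_L2 (\<lambda>x. cell_average (Suc n) r f (\<psi> i x)) (\<lambda>x. cell_average (Suc n) r g (\<psi> i x))"
          using False by (simp only: cell_average_\<psi>[OF i] not_le) (intro Suc.IH bounded_borel_\<psi> Suc.prems)
      qed
      also have "\<dots> = inner_L2 (cell_average (Suc n) r f) (cell_average (Suc n) r g)"
        by (rule inner_L2_branches[symmetric]) (use Suc.prems in auto)
      finally show ?thesis .
    qed
  }
qed

lemma norm_L2_cell_average_le:
  assumes f: "bounded_borel f"
  shows "norm_L2 (cell_average n r f) \<le> norm_L2 f"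
proof -
  let ?h = "cell_average n r f"
  have "(norm_L2 ?h)\<^sup>2 = norm (inner_L2 f ?h)"
    using inner_cell_average[OF f f] by (simp add: inner_L2_self norm_L2_square)
  also have "\<dots> \<le> norm_L2 f * norm_L2 ?h" using f by (intro inner_L2_Cauchy_Schwarz) auto
  finally have "norm_L2 ?h * norm_L2 ?h \<le> norm_L2 f * norm_L2 ?h" by (simp add: power2_eq_square)
  then show ?thesis
    by (cases "norm_L2 ?h = 0") (use norm_L2_nonneg[of ?h] norm_L2_nonneg[of f] in \<open>auto simp: mult_le_cancel_right\<close>)
qed

text \<open>The map turns averages over cells of size \<open>r\<close> into averages over the larger cells of size
  \<open>r / side i\<close>. Without noise the averages over cells of size \<open>r\<close> of a function of mean zero would
  vanish as soon as \<open>n\<close> steps enlarge \<open>r\<close> to more than \<open>1\<close>.\<close>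

lemma energy_cell_average_\<phi>:
  assumes f: "bounded_borel f" and r: "r < 1"
  shows "energy (cell_average (Suc n) r (\<lambda>x. f (\<phi> x))) = (\<Sum>i\<in>{1..M}. p i * energy (cell_average n (r / side i) f))"
proof -
  have "energy (cell_average (Suc n) r (\<lambda>x. f (\<phi> x)))
      = (\<Sum>i\<in>{1..M}. p i * energy (\<lambda>x. cell_average (Suc n) r (\<lambda>x. f (\<phi> x)) (\<psi> i x)))"
    using f by (intro energy_branches) auto
  also have "\<dots> = (\<Sum>i\<in>{1..M}. p i * energy (cell_average n (r / side i) f))"
  proof (intro sum.cong refl)
    fix i assume i: "i \<in> {1..M}"
    show "p i * energy (\<lambda>x. cell_average (Suc n) r (\<lambda>x. f (\<phi> x)) (\<psi> i x)) = p i * energy (cell_average n (r / side i) f)"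
      by (simp only: cell_average_\<psi>[OF i r] \<phi>_\<psi>[OF i])
  qed
  finally show ?thesis .
qed

lemma check_shift: "check x + v \<in> unit_cube \<Longrightarrow> check (x + torus_of v) = check x + v"
  using check_torus_of[of "check x + v"] by (simp add: torus_of_add torus_of_check)

text \<open>A displacement within the cube of generation one acts on the image as the rotated and
  rescaled displacement.\<close>

lemma branch_shift:
  assumes v': "v' = (1 / side (branch x)) *\<^sub>R (D (branch x) *v v)"
    and cube: "check (\<phi> x) + v' \<in> unit_cube"
  shows "check x + v \<in> unit_cube" "branch (x + torus_of v) = branch x" "\<phi> (x + torus_of v) = \<phi> x + torus_of v'"
    "norm v' = norm v / side (branch x)"
proof -
  let ?i = "branch x"
  note i = branch_in[of x]
  have "affine_branch E D e ?i (check x + v) = check (\<phi> x) + v'"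
    by (simp add: check_\<phi> affine_branch_eq[OF i] v' matrix_vector_right_distrib scaleR_add_right)
  then have E: "check x + v \<in> E ?i" using affine_branch_in_cube_iff[OF i] cube by metis
  then show cube': "check x + v \<in> unit_cube" using E_subset[OF i] by blast
  show b: "branch (x + torus_of v) = ?i"
    by (rule branch_unique[OF i]) (simp add: check_shift[OF cube'] E)
  show "\<phi> (x + torus_of v) = \<phi> x + torus_of v'"
    unfolding \<phi>_eq[of "x + torus_of v"] b check_shift[OF cube']
    by (simp add: \<open>affine_branch E D e ?i (check x + v) = check (\<phi> x) + v'\<close> torus_of_add torus_of_check)
  show "norm v' = norm v / side ?i"
    using side_bounds[OF i] by (simp add: v' norm_orthogonal_matrix_mult[OF D_orth[OF i]])
qed

lemma away_from_faces_shift: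
  assumes "away_from_faces \<rho> x" "norm v < \<rho>" shows "check x + v \<in> unit_cube"
proof -
  have "\<bar>v $ i\<bar> < \<rho>" for i using component_le_norm_cart[of v i] assms(2) by linarith
  then have "- \<rho> < v $ i \<and> v $ i < \<rho>" for i by (simp add: abs_less_iff minus_less_iff)
  then show ?thesis using assms(1) unfolding away_from_faces_def unit_cube_def
    by simp (smt (verit))
qed

lemma cell_average_shift:
  assumes "inside_cell n r \<rho> x" "norm v < \<rho>"
  shows "check x + v \<in> unit_cube \<and> cell_average n r f (x + torus_of v) = cell_average n r f x"
  using assms
proof (induction n arbitrary: r \<rho> x v f)
  case (Suc n)
  show ?case
  proof (cases "1 \<le> r")
    case True then show ?thesis using Suc.prems away_from_faces_shift by (simp add: cell_average.simps inside_cell.simps)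
  next
    case False
    define v' where "v' = (1 / side (branch x)) *\<^sub>R (D (branch x) *v v)"
    have i: "branch x \<in> {1..M}" by (rule branch_in)
    have "norm v' = norm v / side (branch x)"
      using side_bounds[OF i] by (simp add: v'_def norm_orthogonal_matrix_mult[OF D_orth[OF i]])
    then have "norm v' < \<rho> / side (branch x)"
      using side_bounds[OF i] Suc.prems(2) by (simp add: divide_strict_right_mono)
    then have IH: "check (\<phi> x) + v' \<in> unit_cube"
      "cell_average n (r / side (branch x)) (\<lambda>y. f (\<psi> (branch x) y)) (\<phi> x + torus_of v')
        = cell_average n (r / side (branch x)) (\<lambda>y. f (\<psi> (branch x) y)) (\<phi> x)"
      using Suc.IH[of "r / side (branch x)" "\<rho> / side (branch x)" "\<phi> x" v'] Suc.prems(1) False by (auto simp: inside_cell.simps)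
    show ?thesis using branch_shift[OF v'_def IH(1)] IH(2) False by (simp add: cell_average.simps)
  qed
qed (simp add: away_from_faces_shift cell_average.simps inside_cell.simps)

text \<open>By self-similarity only the unscaled cube has to be looked at: the boundary layer of width
  \<open>\<rho>\<close> takes the fraction \<open>\<rho> / side\<close> of each cell, up to a constant.\<close>

lemma cell_average_boundary_mass:
  assumes "bounded_borel f" "0 < \<rho>" "0 < r" "r * smin \<le> 1"
  shows "energy (\<lambda>x. if inside_cell n r \<rho> x then 0 else cell_average n r f x)
    \<le> 2 * real CARD('n) * \<rho> / (smin * r) * energy (cell_average n r f)"
  using assms
proof (induction n arbitrary: f r \<rho>)
  have base: "energy (\<lambda>x :: 'n torus. if away_from_faces \<rho> x then 0 else c) \<le> 2 * real CARD('n) * \<rho> / (smin * r) * energy (\<lambda>_ :: 'n torus. c)"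
    if "0 < \<rho>" "0 < r" "r * smin \<le> 1" for c \<rho> r
  proof -
    have "energy (\<lambda>x :: 'n torus. if away_from_faces \<rho> x then 0 else c)
        = (\<integral>x. (norm c)\<^sup>2 * indicator {x. \<not> away_from_faces \<rho> x} x \<partial>(torus_measure :: 'n torus measure))"
      unfolding energy_def by (intro Bochner_Integration.integral_cong) (auto simp: indicator_def)
    also have "\<dots> = (norm c)\<^sup>2 * measure torus_measure {x :: 'n torus. \<not> away_from_faces \<rho> x}"
      by simp
    also have "\<dots> \<le> (norm c)\<^sup>2 * (2 * real CARD('n) * \<rho>)"
      by (intro mult_left_mono measure_near_faces that) auto
    also have "\<dots> \<le> (norm c)\<^sup>2 * (2 * real CARD('n) * \<rho> / (smin * r))"
    proof (intro mult_left_mono)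
      have "2 * real CARD('n) * \<rho> * (smin * r) \<le> 2 * real CARD('n) * \<rho> * 1"
        using that by (intro mult_left_mono) (auto simp: mult.commute)
      then show "2 * real CARD('n) * \<rho> \<le> 2 * real CARD('n) * \<rho> / (smin * r)"
        using that smin_bounds by (simp add: pos_le_divide_eq)
    qed auto
    finally show ?thesis by (simp add: energy_def mult.commute)
  qed
  {
    case 0 then show ?case unfolding cell_average.simps inside_cell.simps by (intro base)
  next
    case (Suc n)
    show ?case
    proof (cases "1 \<le> r")
      case True then show ?thesis using base[of \<rho> r] Suc.prems
        unfolding cell_average.simps inside_cell.simps if_P[OF True] by blast
    next
      case False
      define C where "C = 2 * real CARD('n) * \<rho> / (smin * r)"
      have bb: "bounded_borel (\<lambda>x. if inside_cell (Suc n) r \<rho> x then 0 else cell_average (Suc n) r f x)"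
      proof -
        have "bounded_borel (\<lambda>x. complex_of_real (indicat_real {x. \<not> inside_cell (Suc n) r \<rho> x} x) * cell_average (Suc n) r f x)"
          by (intro bounded_borel_mult bounded_borel_of_real bounded_borel_indicator bounded_borel_cell_average Suc.prems(1)) measurable
        moreover have "(\<lambda>x. complex_of_real (indicat_real {x. \<not> inside_cell (Suc n) r \<rho> x} x) * cell_average (Suc n) r f x)
            = (\<lambda>x. if inside_cell (Suc n) r \<rho> x then 0 else cell_average (Suc n) r f x)"
          by (rule ext) (simp only: indicator_def mem_Collect_eq, simp)
        ultimately show ?thesis by (simp only:)
      qed
      have "energy (\<lambda>x. if inside_cell (Suc n) r \<rho> x then 0 else cell_average (Suc n) r f x)
          = (\<Sum>i\<in>{1..M}. p i * energy (\<lambda>x. if inside_cell (Suc n) r \<rho> (\<psi> i x) then 0 else cell_average (Suc n) r f (\<psi> i x)))"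
        by (rule energy_branches[OF bb])
      also have "\<dots> \<le> (\<Sum>i\<in>{1..M}. p i * (C * energy (\<lambda>x. cell_average (Suc n) r f (\<psi> i x))))"
      proof (intro sum_mono mult_left_mono)
        fix i assume i: "i \<in> {1..M}"
        note s = side_bounds[OF i] side_between[OF i]
        have "r / side i * smin \<le> 1" using False Suc.prems by (intro rescaled_size[OF i]) auto
        then have "energy (\<lambda>x. if inside_cell n (r / side i) (\<rho> / side i) x then 0 else cell_average n (r / side i) (\<lambda>y. f (\<psi> i y)) x)
            \<le> 2 * real CARD('n) * (\<rho> / side i) / (smin * (r / side i)) * energy (cell_average n (r / side i) (\<lambda>y. f (\<psi> i y)))"
          using Suc.prems s by (intro Suc.IH) auto
        also have "2 * real CARD('n) * (\<rho> / side i) / (smin * (r / side i)) = C"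
          using s by (simp add: C_def)
        finally show "energy (\<lambda>x. if inside_cell (Suc n) r \<rho> (\<psi> i x) then 0 else cell_average (Suc n) r f (\<psi> i x))
            \<le> C * energy (\<lambda>x. cell_average (Suc n) r f (\<psi> i x))"
          using False by (simp only: cell_average_\<psi>[OF i] inside_cell_\<psi>[OF i] not_le)
      qed (use p_bounds in \<open>auto simp: less_imp_le\<close>)
      also have "\<dots> = C * (\<Sum>i\<in>{1..M}. p i * energy (\<lambda>x. cell_average (Suc n) r f (\<psi> i x)))"
        by (simp add: sum_distrib_left mult_ac)
      also have "(\<Sum>i\<in>{1..M}. p i * energy (\<lambda>x. cell_average (Suc n) r f (\<psi> i x))) = energy (cell_average (Suc n) r f)"
        by (rule energy_branches[symmetric]) (use Suc.prems in auto)
      finally show ?thesis by (simp add: C_def)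
    qed
  }
qed

lemma energy_le_sum2:
  assumes "bounded_borel u" "bounded_borel f" "bounded_borel g" "\<And>x. norm (u x) \<le> norm (f x) + norm (g x)"
  shows "energy u \<le> 2 * (energy f + energy g)"
proof -
  have "energy u \<le> (\<integral>x. 2 * ((norm (f x))\<^sup>2 + (norm (g x))\<^sup>2) \<partial>torus_measure)"
    unfolding energy_def
  proof (intro integral_mono)
    fix x
    have "(norm (u x))\<^sup>2 \<le> (norm (f x) + norm (g x))\<^sup>2" using assms(4) by (intro power_mono) auto
    also have "\<dots> \<le> 2 * ((norm (f x))\<^sup>2 + (norm (g x))\<^sup>2)" 
      using sum_squares_bound[of "norm (f x)" "norm (g x)"] by (simp add: power2_sum)
    finally show "(norm (u x))\<^sup>2 \<le> 2 * ((norm (f x))\<^sup>2 + (norm (g x))\<^sup>2)" .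
  qed (use assms in \<open>auto intro!: bounded_borel_add bounded_borel_mult\<close>)
  then show ?thesis using assms by (simp add: energy_def)
qed

text \<open>A translation by \<open>v\<close> changes a function that is constant on cells only at points whose
  distance to the boundary of their cell is at most \<open>norm v\<close>.\<close>

lemma cell_average_variation:
  assumes f: "bounded_borel f" and r: "0 < r" "r * smin \<le> 1" and v: "norm v < \<rho>"
  shows "energy (\<lambda>x. cell_average n r f (x + torus_of v) - cell_average n r f x)
    \<le> 8 * real CARD('n) * \<rho> / (smin * r) * energy (cell_average n r f)"
proof -
  define h where "h = cell_average n r f"
  define g where "g x = (if inside_cell n r \<rho> x then 0 else h x)" for x
  have \<rho>: "\<rho> > 0" using v norm_ge_zero le_less_trans by blast
  have h: "bounded_borel h" using f by (simp add: h_def)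
  have g: "bounded_borel g"
  proof -
    note [measurable] = bounded_borelD[OF h]
    obtain B where "B > 0" "\<And>x. norm (h x) \<le> B" using bounded_borelE[OF h] by blast
    moreover have "g \<in> borel_measurable borel" unfolding g_def by measurable
    ultimately show ?thesis by (intro bounded_borelI[of _ B]) (auto simp: g_def)
  qed
  have "norm (h (x + torus_of v) - h x) \<le> norm (g (x + torus_of v)) + norm (g x)" for x
  proof (cases "h (x + torus_of v) = h x")
    case False
    have "\<not> inside_cell n r \<rho> x" using cell_average_shift[OF _ v] False by (auto simp: h_def)
    moreover have "\<not> inside_cell n r \<rho> (x + torus_of v)"
    proof
      assume "inside_cell n r \<rho> (x + torus_of v)"
      then have "h (x + torus_of v + torus_of (- v)) = h (x + torus_of v)"
        using cell_average_shift[of n r \<rho> "x + torus_of v" "- v"] v by (simp add: h_def)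
      then show False using False by (simp add: torus_of_uminus)
    qed
    ultimately show ?thesis by (simp add: g_def norm_triangle_ineq4)
  qed simp
  then have "energy (\<lambda>x. h (x + torus_of v) - h x) \<le> 2 * (energy (\<lambda>x. g (x + torus_of v)) + energy g)"
    using h g by (intro energy_le_sum2) (auto intro: bounded_borel_shift)
  also have "\<dots> = 4 * energy g" using g by (simp add: energy_shift)
  also have "\<dots> \<le> 4 * (2 * real CARD('n) * \<rho> / (smin * r) * energy h)"
    using cell_average_boundary_mass[OF f \<rho> r, of n] unfolding g_def h_def by linarith
  finally show ?thesis by (simp add: h_def)
qed

end

section \<open>Poincare inequality on the cells\<close>

interpretation torus_noise: torus_prob torus_measure
  by unfold_locales simp

text \<open>The double integral that bounds the variance over cells of diameter at most \<open>s\<close>.\<close>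

definition pair_variation :: "real \<Rightarrow> ('n::finite torus \<Rightarrow> complex) \<Rightarrow> real" where
  "pair_variation s u = (\<integral>x. (\<integral>y. (norm (u x - u y))\<^sup>2 * indicator {0..s} (norm (check x - check y))
     \<partial>torus_measure) \<partial>torus_measure)"

context
  fixes u :: "'n::finite torus \<Rightarrow> complex"
  assumes u: "bounded_borel u"
begin

lemma pair_integrand_bounded:
  obtains B where "\<And>x y. \<bar>(norm (u x - u y))\<^sup>2 * indicat_real {0..s} (norm (check x - check y))\<bar> \<le> B"
proof -
  obtain C where C: "\<And>x y. (norm (u x - u y))\<^sup>2 \<le> C" using bounded_borel_diff_square_bound[OF u] by blast
  have "\<bar>(norm (u x - u y))\<^sup>2 * indicat_real {0..s} (norm (check x - check y))\<bar> \<le> C" for x y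
    using C[of x y] order_trans[OF zero_le_power2 C] by (auto simp: indicator_def)
  then show ?thesis by (rule that)
qed

lemma pair_integrand_measurable:
  "(\<lambda>(x, y). (norm (u x - u y))\<^sup>2 * indicat_real {0..s} (norm (check x - check y))) \<in> borel_measurable (borel \<Otimes>\<^sub>M borel)"
  using bounded_borelD[OF u] by measurable

lemma pair_integrand_bounded_borel:
  "bounded_borel (\<lambda>y. (norm (u x - u y))\<^sup>2 * indicat_real {0..s} (norm (check x - check y)))"
proof -
  obtain B where "\<And>x y. \<bar>(norm (u x - u y))\<^sup>2 * indicat_real {0..s} (norm (check x - check y))\<bar> \<le> B"
    using pair_integrand_bounded[of s] by blast
  then show ?thesis using bounded_borelD[OF u] by (intro bounded_borelI[of _ B]) auto
qed

lemma pair_inner_bounded_borel: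
  "bounded_borel (\<lambda>x. \<integral>y. (norm (u x - u y))\<^sup>2 * indicat_real {0..s} (norm (check x - check y)) \<partial>torus_measure)"
proof -
  obtain B where B: "\<And>x y. \<bar>(norm (u x - u y))\<^sup>2 * indicat_real {0..s} (norm (check x - check y))\<bar> \<le> B"
    using pair_integrand_bounded[of s] by blast
  show ?thesis
  proof (rule bounded_borelI[of _ B])
    show "norm (\<integral>y. (norm (u x - u y))\<^sup>2 * indicat_real {0..s} (norm (check x - check y)) \<partial>torus_measure) \<le> B" for x
    proof -
      have "norm (\<integral>y. (norm (u x - u y))\<^sup>2 * indicat_real {0..s} (norm (check x - check y)) \<partial>torus_measure)
          \<le> (\<integral>y. norm ((norm (u x - u y))\<^sup>2 * indicat_real {0..s} (norm (check x - check y))) \<partial>torus_measure)"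
        by (rule integral_norm_bound)
      also have "\<dots> \<le> (\<integral>y. B \<partial>(torus_measure :: 'n torus measure))"
        using B by (intro integral_mono integrable_torus bounded_borel_norm pair_integrand_bounded_borel) auto
      finally show ?thesis by simp
    qed
    show "(\<lambda>x. \<integral>y. (norm (u x - u y))\<^sup>2 * indicat_real {0..s} (norm (check x - check y)) \<partial>torus_measure) \<in> borel_measurable borel"
      by (rule torus_noise.measurable_integral_noise) (rule pair_integrand_measurable)
  qed
qed

lemma norm_check_diff_le: "norm (check x - check y) \<le> sqrt (real CARD('n))" for x y :: "'n torus"
proof -
  have "\<bar>(check x - check y) $ i\<bar> \<le> 1" for i
    using check_in_unit_cube[of x] check_in_unit_cube[of y]
    by (simp add: unit_cube_def abs_le_iff) (smt (verit))
  then have "((check x - check y) $ i)\<^sup>2 \<le> 1" for i by (simp add: abs_square_le_1)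
  then have "(\<Sum>i\<in>UNIV. ((check x - check y) $ i)\<^sup>2) \<le> real CARD('n)"
    using sum_bounded_above[of UNIV "\<lambda>i. ((check x - check y) $ i)\<^sup>2" 1] by simp
  then show ?thesis by (simp add: norm_vec_def L2_set_def)
qed

lemma variance_eq_pair_variation:
  assumes s: "sqrt (real CARD('n)) \<le> s"
  shows "2 * energy (\<lambda>x. u x - (\<integral>y. u y \<partial>torus_measure)) = pair_variation s u"
proof -
  let ?m = "\<integral>y. u y \<partial>torus_measure"
  obtain B where B: "\<And>x. norm (u x) \<le> B" using bounded_borelE[OF u] by blast
  note [measurable] = bounded_borelD[OF u]
  have ind: "indicat_real {0..s} (norm (check x - check y)) = 1" for x y :: "'n torus"
    using norm_check_diff_le[of x y] s by (simp add: indicator_def)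
  have "energy (\<lambda>x. u x - ?m) = energy u - 2 * Re (cnj ?m * ?m) + (norm ?m)\<^sup>2"
    unfolding energy_def using B by (intro torus.integral_norm_diff_square[of u B]) auto
  also have "Re (cnj ?m * ?m) = (norm ?m)\<^sup>2" unfolding cmod_power2 by (simp add: power2_eq_square)
  finally have 1: "energy (\<lambda>x. u x - ?m) = energy u - (norm ?m)\<^sup>2" by simp
  have "pair_variation s u = (\<integral>x. (\<integral>y. (norm (u y - u x))\<^sup>2 \<partial>torus_measure) \<partial>torus_measure)"
    unfolding pair_variation_def by (simp add: ind norm_minus_commute)
  also have "\<dots> = (\<integral>x. energy u - 2 * Re (cnj (u x) * ?m) + (norm (u x))\<^sup>2 \<partial>torus_measure)"
    unfolding energy_def using B
    by (intro Bochner_Integration.integral_cong refl torus.integral_norm_diff_square[of u B]) auto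
  also have "\<dots> = energy u - 2 * (\<integral>x. Re (cnj (u x) * ?m) \<partial>torus_measure) + energy u"
    using u by (simp add: energy_def del: complex_cnj_mult times_complex.sel)
  also have "(\<integral>x. Re (cnj (u x) * ?m) \<partial>torus_measure) = Re (\<integral>x. cnj (u x) * ?m \<partial>torus_measure)"
    using u by (intro integral_Re) auto
  also have "(\<integral>x. cnj (u x) * ?m \<partial>torus_measure) = cnj ?m * ?m" by simp
  also have "Re (cnj ?m * ?m) = (norm ?m)\<^sup>2" unfolding cmod_power2 by (simp add: power2_eq_square)
  finally show ?thesis using 1 by simp
qed

end

lemma pair_variation_nonneg: "0 \<le> pair_variation s u"
  unfolding pair_variation_def by simp

context bernoulli
begin

lemma norm_check_\<psi>_diff:
  assumes i: "i \<in> {1..M}"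
  shows "norm (check (\<psi> i x) - check (\<psi> i y)) = side i * norm (check x - check y)"
proof -
  have "orthogonal_matrix (transpose (D i))" using D_orth[OF i] by simp
  moreover have "check (\<psi> i x) - check (\<psi> i y) = side i *\<^sub>R (transpose (D i) *v (check x - check y))"
    by (simp add: check_\<psi>[OF i] chart_def matrix_vector_mult_diff_distrib scaleR_diff_right)
  ultimately show ?thesis using side_bounds[OF i] by (simp add: norm_orthogonal_matrix_mult)
qed

text \<open>Pairs of points from different \<open>E i\<close> are dropped.\<close>

lemma pair_variation_branches:
  assumes u: "bounded_borel u"
  shows "(\<Sum>i\<in>{1..M}. (p i)\<^sup>2 * pair_variation (s / side i) (\<lambda>x. u (\<psi> i x))) \<le> pair_variation s u"
proof -
  define F where "F x y = (norm (u x - u y))\<^sup>2 * indicat_real {0..s} (norm (check x - check y))" for x y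
  define G where "G x = (\<integral>y. F x y \<partial>torus_measure)" for x
  have bF: "bounded_borel (F x)" for x using pair_integrand_bounded_borel[OF u] by (simp add: F_def[abs_def])
  have bG: "bounded_borel G" using pair_inner_bounded_borel[OF u] by (simp add: F_def[abs_def] G_def[abs_def])
  have F0: "F x y \<ge> 0" for x y by (simp add: F_def)
  have F\<psi>: "F (\<psi> i x) (\<psi> i y) = (norm (u (\<psi> i x) - u (\<psi> i y)))\<^sup>2 * indicat_real {0..s / side i} (norm (check x - check y))"
    if i: "i \<in> {1..M}" for i x y
    using side_bounds[OF i] by (simp add: F_def norm_check_\<psi>_diff[OF i] indicator_def pos_le_divide_eq mult.commute)
  have G_ge: "p i * (\<integral>y. F (\<psi> i x) (\<psi> i y) \<partial>torus_measure) \<le> G (\<psi> i x)" if i: "i \<in> {1..M}" for i x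
  proof -
    have "G (\<psi> i x) = (\<Sum>j\<in>{1..M}. p j *\<^sub>R (\<integral>y. F (\<psi> i x) (\<psi> j y) \<partial>torus_measure))"
      unfolding G_def by (rule integral_branches[OF bF])
    moreover have "p i *\<^sub>R (\<integral>y. F (\<psi> i x) (\<psi> i y) \<partial>torus_measure) \<le> (\<Sum>j\<in>{1..M}. p j *\<^sub>R (\<integral>y. F (\<psi> i x) (\<psi> j y) \<partial>torus_measure))"
      using i p_bounds F0 by (intro member_le_sum) (auto intro!: mult_nonneg_nonneg simp: less_imp_le)
    ultimately show ?thesis by simp
  qed
  have "pair_variation s u = (\<integral>x. G x \<partial>torus_measure)" by (simp add: pair_variation_def G_def F_def)
  also have "\<dots> = (\<Sum>i\<in>{1..M}. p i *\<^sub>R (\<integral>x. G (\<psi> i x) \<partial>torus_measure))" by (rule integral_branches[OF bG])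
  also have "\<dots> \<ge> (\<Sum>i\<in>{1..M}. (p i)\<^sup>2 * pair_variation (s / side i) (\<lambda>x. u (\<psi> i x)))"
  proof (rule sum_mono)
    fix i assume i: "i \<in> {1..M}"
    let ?H = "\<lambda>x. \<integral>y. (norm (u (\<psi> i x) - u (\<psi> i y)))\<^sup>2 * indicat_real {0..s / side i} (norm (check x - check y)) \<partial>torus_measure"
    have bH: "bounded_borel ?H" using pair_inner_bounded_borel[OF bounded_borel_\<psi>[OF u]] by simp
    have "(\<integral>x. p i * ?H x \<partial>torus_measure) \<le> (\<integral>x. G (\<psi> i x) \<partial>torus_measure)"
      using G_ge[OF i] bG bH by (intro integral_mono integrable_torus bounded_borel_mult bounded_borel_const bounded_borel_\<psi>) (simp_all add: F\<psi>[OF i])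
    then have "p i * pair_variation (s / side i) (\<lambda>x. u (\<psi> i x)) \<le> (\<integral>x. G (\<psi> i x) \<partial>torus_measure)"
      by (simp add: pair_variation_def)
    then have "p i * (p i * pair_variation (s / side i) (\<lambda>x. u (\<psi> i x))) \<le> p i * (\<integral>x. G (\<psi> i x) \<partial>torus_measure)"
      using p_bounds[OF i] by (intro mult_left_mono) auto
    then show "(p i)\<^sup>2 * pair_variation (s / side i) (\<lambda>x. u (\<psi> i x)) \<le> p i *\<^sub>R (\<integral>x. G (\<psi> i x) \<partial>torus_measure)"
      by (simp add: power2_eq_square mult.assoc)
  qed
  finally show ?thesis .
qed

text \<open>The variance on a cell is half the double integral of \<open>(norm (u x - u y))\<^sup>2\<close> over the cell, divided by the
  volume of the cell. Two points of a cell have a distance of at most \<open>sqrt d * r\<close>, and the volume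
  is at least \<open>(smin * r)\<^sup>d\<close>, where \<open>d\<close> is the dimension. In the induction both sides
  scale in the same way: a factor \<open>p i\<close> on the left meets \<open>(p i)\<^sup>2\<close> on the right, and the denominator
  supplies the missing \<open>side i ^ d = p i\<close>.\<close>

lemma cell_average_Poincare:
  assumes "bounded_borel u" "smax ^ n \<le> r" "r * smin \<le> 1"
  shows "energy (\<lambda>x. u x - cell_average n r u x)
    \<le> pair_variation (sqrt (real CARD('n)) * r) u / (2 * (smin * r) ^ CARD('n))"
  using assms
proof (induction n arbitrary: u r)
  have base: "energy (\<lambda>x. u x - (\<integral>y. u y \<partial>torus_measure)) \<le> pair_variation (sqrt (real CARD('n)) * r) u / (2 * (smin * r) ^ CARD('n))"
    if u: "bounded_borel u" and r: "1 \<le> r" "r * smin \<le> 1" for u :: "'n torus \<Rightarrow> complex" and r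
  proof -
    have "sqrt (real CARD('n)) \<le> sqrt (real CARD('n)) * r" using r by (simp add: mult_le_cancel_left1)
    then have "energy (\<lambda>x. u x - (\<integral>y. u y \<partial>torus_measure)) = pair_variation (sqrt (real CARD('n)) * r) u / 2"
      using variance_eq_pair_variation[OF u] by (simp add: field_simps)
    also have "\<dots> \<le> pair_variation (sqrt (real CARD('n)) * r) u / (2 * (smin * r) ^ CARD('n))"
    proof (intro divide_left_mono pair_variation_nonneg)
      have "0 < smin * r" "smin * r \<le> 1" using r smin_bounds by (auto simp: mult.commute)
      then show "2 * (smin * r) ^ CARD('n) \<le> 2" "0 < 2 * (2 * (smin * r) ^ CARD('n))" by (auto simp: power_le_one)
    qed
    finally show ?thesis .
  qed
  {
    case 0 then show ?case using base[of u r] by (simp add: cell_average.simps)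
  next
    case (Suc n)
    show ?case
    proof (cases "1 \<le> r")
      case True then show ?thesis using base[of u r] Suc.prems by (simp add: cell_average.simps)
    next
      case False
      have "smax ^ Suc n > 0" using smax_bounds by simp
      then have r: "r > 0" using Suc.prems(2) by linarith
      define d where "d = CARD('n)"
      have "energy (\<lambda>x. u x - cell_average (Suc n) r u x)
          = (\<Sum>i\<in>{1..M}. p i * energy (\<lambda>x. u (\<psi> i x) - cell_average (Suc n) r u (\<psi> i x)))"
        using Suc.prems by (intro energy_branches) auto
      also have "\<dots> \<le> (\<Sum>i\<in>{1..M}. (p i)\<^sup>2 * pair_variation (sqrt (real d) * r / side i) (\<lambda>x. u (\<psi> i x)) / (2 * (smin * r) ^ d))"
      proof (intro sum_mono)
        fix i assume i: "i \<in> {1..M}"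
        note s = side_bounds[OF i] side_between[OF i]
        have le1: "r / side i * smin \<le> 1" using False r by (intro rescaled_size[OF i]) auto
        have le2: "smax ^ n \<le> r / side i"
        proof -
          have "smax ^ n * side i \<le> smax ^ n * smax" using s smax_bounds by (intro mult_left_mono) auto
          also have "\<dots> \<le> r" using Suc.prems(2) by (simp add: mult.commute)
          finally show ?thesis using s by (simp add: pos_le_divide_eq)
        qed
        have "energy (\<lambda>x. u (\<psi> i x) - cell_average (Suc n) r u (\<psi> i x))
            = energy (\<lambda>x. u (\<psi> i x) - cell_average n (r / side i) (\<lambda>y. u (\<psi> i y)) x)"
          using False by (simp only: cell_average_\<psi>[OF i] not_le)
        also have "\<dots> \<le> pair_variation (sqrt (real d) * (r / side i)) (\<lambda>x. u (\<psi> i x)) / (2 * (smin * (r / side i)) ^ d)"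
          unfolding d_def by (intro Suc.IH le1 le2 bounded_borel_\<psi> Suc.prems)
        also have "(smin * (r / side i)) ^ d = (smin * r) ^ d / p i"
          using side_power[OF i] by (simp add: d_def power_divide)
        finally have "p i * energy (\<lambda>x. u (\<psi> i x) - cell_average (Suc n) r u (\<psi> i x))
            \<le> p i * (pair_variation (sqrt (real d) * (r / side i)) (\<lambda>x. u (\<psi> i x)) / (2 * ((smin * r) ^ d / p i)))"
          using p_bounds[OF i] by (intro mult_left_mono) auto
        then show "p i * energy (\<lambda>x. u (\<psi> i x) - cell_average (Suc n) r u (\<psi> i x))
            \<le> (p i)\<^sup>2 * pair_variation (sqrt (real d) * r / side i) (\<lambda>x. u (\<psi> i x)) / (2 * (smin * r) ^ d)"
          by (simp add: power2_eq_square mult_ac)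
      qed
      also have "\<dots> = (\<Sum>i\<in>{1..M}. (p i)\<^sup>2 * pair_variation (sqrt (real d) * r / side i) (\<lambda>x. u (\<psi> i x))) / (2 * (smin * r) ^ d)"
        by (rule sum_divide_distrib[symmetric])
      also have "\<dots> \<le> pair_variation (sqrt (real d) * r) u / (2 * (smin * r) ^ d)"
        using r smin_bounds by (intro divide_right_mono pair_variation_branches Suc.prems) auto
      finally show ?thesis by (simp add: d_def)
    qed
  }
qed

end

text \<open>Substituting \<open>y = x + z\<close> in the double integral leaves an integral over the translations \<open>z\<close>
  of length at most \<open>s\<close>.\<close>

lemma pair_variation_le_translations:
  fixes u :: "'n::finite torus \<Rightarrow> complex"
  assumes u: "bounded_borel u" and s: "0 < s" "s < 1/4"
    and c: "\<And>z. dist z 0 \<le> s \<Longrightarrow> energy (\<lambda>x. u (x + z) - u x) \<le> c"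
  shows "pair_variation s u \<le> (4 * s) ^ CARD('n) * c"
proof -
  note [measurable] = bounded_borelD[OF u]
  obtain C where sq: "\<And>x y. (norm (u x - u y))\<^sup>2 \<le> C" using bounded_borel_diff_square_bound[OF u] by blast
  define N where "N = {z :: 'n torus. \<forall>i. \<bar>check (z + torus_of (\<chi> i. 1/2)) $ i - 1/2\<bar> \<le> 2 * s}"
  have [measurable]: "N \<in> sets borel" unfolding N_def by measurable
  \<comment> \<open>\<open>N\<close> is the cube of side \<open>4 * s\<close> about the origin, moved away from the seam of the
    fundamental domain.\<close>
  have rep: "\<exists>v. torus_of v = z \<and> norm v < 2 * s" if "dist z 0 \<le> s" for z :: "'n torus"
  proof -
    obtain a b where ab: "torus_of a = z" "torus_of b = 0" "norm (a - b) < dist z 0 + s"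
      using dist_torus_approx[OF s(1), of z 0] by blast
    have "torus_of (a - b) = z" using ab torus_of_add[of a "- b"] by (simp add: torus_of_uminus)
    then show ?thesis using ab that by (intro exI[of _ "a - b"]) auto
  qed
  have inN: "z \<in> N" and cz: "energy (\<lambda>x. u (x + z) - u x) \<le> c" if z: "dist z 0 \<le> s" for z :: "'n torus"
  proof -
    obtain v where v: "torus_of v = z" "norm v < 2 * s" using rep[OF z] by blast
    have vi: "\<bar>v $ i\<bar> < 2 * s" for i using component_le_norm_cart[of v i] v(2) by linarith
    have "v + (\<chi> i. 1/2) \<in> unit_cube"
      unfolding unit_cube_def using vi s(2) by simp (smt (verit) field_sum_of_halves)
    then have "check (z + torus_of (\<chi> i. 1/2)) = v + (\<chi> i. 1/2)"
      unfolding v(1)[symmetric] torus_of_add[symmetric] by (rule check_torus_of)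
    then show "z \<in> N" using vi by (simp add: N_def less_imp_le)
    show "energy (\<lambda>x. u (x + z) - u x) \<le> c" by (rule c[OF z])
  qed
  have c0: "c \<ge> 0" using cz[of 0] s energy_nonneg[of "\<lambda>x. u (x + 0) - u x"] by (simp only: dist_self) linarith
  have dist_check: "dist (y - x) 0 \<le> norm (check x - check y)" for x y :: "'n torus"
  proof -
    have "dist (y - x) 0 \<le> norm ((check y - check x) - 0)"
      by (rule dist_torus_lower)
        (use torus_of_add[of "check y" "- check x"] in \<open>simp_all add: torus_of_uminus torus_of_check torus_of_0\<close>)
    then show ?thesis by (simp add: norm_minus_commute)
  qed
  define I where "I x z = (norm (u (x + z) - u x))\<^sup>2 * indicat_real {0..s} (norm (check x - check (x + z)))" for x z
  have I_le: "I x z \<le> (norm (u (x + z) - u x))\<^sup>2 * indicat_real {z. dist z 0 \<le> s} z" for x z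
    using dist_check[of "x + z" x] unfolding I_def by (intro mult_left_mono) (auto simp: indicator_def)
  have [measurable]: "{z :: 'n torus. dist z 0 \<le> s} \<in> sets borel"
  proof -
    have "{z :: 'n torus. dist z 0 \<le> s} = cball 0 s" by (auto simp: dist_commute)
    then show ?thesis by simp
  qed
  have Imeas: "case_prod I \<in> borel_measurable (borel \<Otimes>\<^sub>M borel)" unfolding I_def by measurable
  have Ibound: "norm (I x z) \<le> C" for x z
    using sq[of "x + z" x] order_trans[OF zero_le_power2 sq] by (auto simp: I_def indicator_def)
  have "(\<lambda>x. I x z) \<in> borel_measurable borel" for z unfolding I_def by measurable
  then have bI: "bounded_borel (\<lambda>x. I x z)" for z by (rule bounded_borelI[OF _ Ibound])
  have "pair_variation s u = (\<integral>x. (\<integral>z. I x z \<partial>torus_measure) \<partial>torus_measure)"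
    unfolding pair_variation_def
  proof (rule Bochner_Integration.integral_cong[OF refl])
    fix x :: "'n torus"
    have "(\<integral>y. (norm (u x - u y))\<^sup>2 * indicat_real {0..s} (norm (check x - check y)) \<partial>torus_measure)
        = (\<integral>z. (norm (u x - u (z + x)))\<^sup>2 * indicat_real {0..s} (norm (check x - check (z + x))) \<partial>torus_measure)"
      by (rule integral_torus_shift[symmetric]) measurable
    then show "(\<integral>y. (norm (u x - u y))\<^sup>2 * indicat_real {0..s} (norm (check x - check y)) \<partial>torus_measure)
        = (\<integral>z. I x z \<partial>torus_measure)" by (simp add: I_def add.commute norm_minus_commute)
  qed
  also have "\<dots> = (\<integral>z. (\<integral>x. I x z \<partial>torus_measure) \<partial>torus_measure)"
    by (rule torus_noise.Fubini_bounded[OF Imeas Ibound])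
  also have "\<dots> \<le> (\<integral>z. c * indicat_real N z \<partial>torus_measure)"
  proof (rule integral_mono)
    have "(\<lambda>z. \<integral>x. I x z \<partial>torus_measure) \<in> borel_measurable borel"
      by (rule torus_noise.measurable_integral_noise) (unfold I_def, measurable)
    moreover have "norm (\<integral>x. I x z \<partial>torus_measure) \<le> C" for z
    proof -
      have "norm (\<integral>x. I x z \<partial>torus_measure) \<le> (\<integral>x. norm (I x z) \<partial>torus_measure)" by (rule integral_norm_bound)
      also have "\<dots> \<le> (\<integral>x. C \<partial>(torus_measure :: 'n torus measure))"
        using Ibound bI by (intro integral_mono) auto
      finally show ?thesis by simp
    qed
    ultimately show "integrable torus_measure (\<lambda>z. \<integral>x. I x z \<partial>torus_measure)"
      by (intro integrable_torus bounded_borelI)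
    show "integrable torus_measure (\<lambda>z. c * indicat_real N z)" by (intro integrable_torus) auto
    show "(\<integral>x. I x z \<partial>torus_measure) \<le> c * indicat_real N z" for z
    proof (cases "dist z 0 \<le> s")
      case True
      have "(\<integral>x. I x z \<partial>torus_measure) \<le> energy (\<lambda>x. u (x + z) - u x)"
        unfolding energy_def
      proof (rule integral_mono)
        show "I x z \<le> (norm (u (x + z) - u x))\<^sup>2" for x using I_le[of x z] True by simp
        show "integrable torus_measure (\<lambda>x. (norm (u (x + z) - u x))\<^sup>2)"
          by (intro integrable_torus bounded_borel_power bounded_borel_norm bounded_borel_diff bounded_borel_shift u)
      qed (use bI in auto)
      then show ?thesis using cz[OF True] inN[OF True] by simp
    next
      case False
      have "I x z = 0" for x
      proof (rule antisym)
        show "I x z \<le> 0" using I_le[of x z] False by simp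
        show "0 \<le> I x z" unfolding I_def by simp
      qed
      then show ?thesis using c0 by simp
    qed
  qed
  also have "\<dots> = c * measure torus_measure N" by simp
  also have "\<dots> \<le> c * (4 * s) ^ CARD('n)"
  proof (rule mult_left_mono[OF _ c0])
    let ?h = "torus_of (\<chi> i. 1/2) :: 'n torus"
    define N' where "N' = {z :: 'n torus. \<forall>i. \<bar>check z $ i - 1/2\<bar> \<le> 2 * s}"
    have [measurable]: "N' \<in> sets borel" unfolding N'_def by measurable
    have "measure torus_measure N = (\<integral>z. indicat_real N z \<partial>torus_measure)" by simp
    also have "\<dots> = (\<integral>z. indicat_real N' (z + ?h) \<partial>torus_measure)"
      by (simp add: N_def N'_def indicator_def)
    also have "\<dots> = (\<integral>z. indicat_real N' z \<partial>torus_measure)" by (rule integral_torus_shift) measurable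
    also have "\<dots> = measure torus_measure N'" by simp
    also have "\<dots> \<le> (\<Prod>i\<in>(UNIV :: 'n set). (\<chi> i. 1/2 + 2 * s) $ i - (\<chi> i. 1/2 - 2 * s) $ i)"
    proof (rule measure_torus_le_box)
      show "check z \<in> cbox (\<chi> i. 1/2 - 2 * s) (\<chi> i. 1/2 + 2 * s)" if "z \<in> N'" for z
        using that by (simp add: N'_def mem_box_cart abs_le_iff) (smt (verit))
    qed (use s in auto)
    finally show "measure torus_measure N \<le> (4 * s) ^ CARD('n)" by simp
  qed
  finally show ?thesis by (simp only: mult.commute)
qed

section \<open>Energy decay\<close>

lemma small_representative:
  fixes z :: "'n::finite torus"
  assumes "dist z 0 < s" obtains v where "torus_of v = z" "norm v < s"
proof -
  obtain a b where ab: "torus_of a = z" "torus_of b = 0" "norm (a - b) < dist z 0 + (s - dist z 0)"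
    using dist_torus_approx[of "s - dist z 0" z 0] assms by auto
  have "torus_of (a - b) = z" using ab torus_of_add[of a "- b"] by (simp add: torus_of_uminus)
  then show ?thesis using ab by (intro that[of "a - b"]) auto
qed

lemma norm_character_minus_one_le: "norm (character k z - 1) \<le> 2 * pi * norm (int_vec k) * dist z 0"
proof -
  have "character k (0 :: 'a torus) = 1" using character_torus_of[of k 0] by (simp add: torus_of_0)
  then show ?thesis using character_lipschitz[of k z 0] by simp
qed

text \<open>The translation multiplies the coefficient of frequency \<open>k\<close> by \<open>character k z\<close>, which differs from
  \<open>1\<close> by at most \<open>2 * pi * norm k * dist z 0\<close>.\<close>

lemma energy_trig_poly_translation:
  assumes F: "finite F" and L: "\<And>k. k \<in> F \<Longrightarrow> norm (int_vec k) \<le> L" and z: "dist z 0 \<le> s"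
  shows "energy (\<lambda>x. trig_poly F a (x + z) - trig_poly F a x) \<le> (2 * pi * L * s)\<^sup>2 * energy (trig_poly F a)"
proof -
  have "energy (\<lambda>x. trig_poly F a (x + z) - trig_poly F a x) = energy (trig_poly F (\<lambda>k. a k * character k z - a k))"
    unfolding trig_poly_shift trig_poly_diff ..
  also have "\<dots> = (\<Sum>k\<in>F. (norm (a k * character k z - a k))\<^sup>2)" by (rule energy_trig_poly[OF F])
  also have "\<dots> \<le> (\<Sum>k\<in>F. (2 * pi * L * s)\<^sup>2 * (norm (a k))\<^sup>2)"
  proof (intro sum_mono)
    fix k assume k: "k \<in> F"
    have L0: "0 \<le> L" using L[OF k] norm_ge_zero order_trans by blast
    have "a k * character k z - a k = a k * (character k z - 1)" by (simp add: algebra_simps)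
    then have "norm (a k * character k z - a k) = norm (character k z - 1) * norm (a k)" by (simp add: norm_mult)
    also have "\<dots> \<le> (2 * pi * L * s) * norm (a k)"
    proof (intro mult_right_mono)
      have "norm (character k z - 1) \<le> 2 * pi * norm (int_vec k) * dist z 0" by (rule norm_character_minus_one_le)
      also have "\<dots> \<le> 2 * pi * L * s" using L[OF k] z L0 by (intro mult_mono) auto
      finally show "norm (character k z - 1) \<le> 2 * pi * L * s" .
    qed auto
    finally have "(norm (a k * character k z - a k))\<^sup>2 \<le> ((2 * pi * L * s) * norm (a k))\<^sup>2" by (intro power_mono) auto
    then show "(norm (a k * character k z - a k))\<^sup>2 \<le> (2 * pi * L * s)\<^sup>2 * (norm (a k))\<^sup>2" by (simp add: power_mult_distrib)
  qed
  also have "\<dots> = (2 * pi * L * s)\<^sup>2 * energy (trig_poly F a)" by (simp add: energy_trig_poly[OF F] sum_distrib_left)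
  finally show ?thesis .
qed

context bernoulli begin

text \<open>The constant of the Poincare inequality on cells of size \<open>\<epsilon>\<close>, for frequencies up to \<open>c / \<epsilon>\<close> and
  without the factor \<open>c\<^sup>2\<close>: a ball of radius \<open>sqrt d * \<epsilon>\<close> has measure at most \<open>(4 * sqrt d * \<epsilon>)\<^sup>d\<close>,
  and \<open>\<epsilon>\<close> cancels.\<close>

definition low_constant :: real where
  "low_constant = (4 * sqrt (real CARD('n)) / smin) ^ CARD('n) * (2 * pi * sqrt (real CARD('n)))\<^sup>2 / 2"

end

locale noisy_bernoulli = bernoulli M E D e + torus_prob \<nu>
  for M :: nat and E :: "nat \<Rightarrow> (real^'n::finite) set" and D :: "nat \<Rightarrow> real^'n^'n" and e :: "nat \<Rightarrow> real^'n"
    and \<nu> :: "'n torus measure" +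
  fixes \<epsilon> :: real
  assumes \<epsilon>: "0 < \<epsilon>"
    and noise_small: "AE z in \<nu>. dist z 0 < \<epsilon>"
begin

lemma small_\<epsilon>:
  assumes "sqrt (real CARD('n)) * \<epsilon> < 1 / 4" shows "\<epsilon> < 1 / 4" "\<epsilon> * smin \<le> 1"
proof -
  have "1 * \<epsilon> \<le> sqrt (real CARD('n)) * \<epsilon>" using one_le_card_finite[where 'a = 'n] \<epsilon> by (intro mult_right_mono) auto
  then show "\<epsilon> < 1 / 4" using assms by simp
  then show "\<epsilon> * smin \<le> 1" using \<epsilon> smin_bounds mult_mono[of \<epsilon> 1 smin 1] by simp
qed

definition step :: "('n torus \<Rightarrow> complex) \<Rightarrow> 'n torus \<Rightarrow> complex" where
  "step f = (\<lambda>x. conv \<nu> f (\<phi> x))"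

lemma bounded_borel_step [simp, intro]: "bounded_borel f \<Longrightarrow> bounded_borel (step f)"
  unfolding step_def by (intro bounded_borel_\<phi> bounded_borel_conv)

lemma bounded_borel_steps [simp, intro]: "bounded_borel f \<Longrightarrow> bounded_borel ((step ^^ n) f)"
  by (induction n) auto

lemma energy_step: "bounded_borel f \<Longrightarrow> energy (step f) = energy f - loss \<nu> f"
  by (simp add: step_def energy_\<phi> loss_def)

lemma integral_step: "bounded_borel f \<Longrightarrow> (\<integral>x. step f x \<partial>torus_measure) = (\<integral>x. f x \<partial>torus_measure)"
  by (simp add: step_def integral_\<phi> integral_conv)

lemma integral_steps: "bounded_borel f \<Longrightarrow> (\<integral>x. (step ^^ n) f x \<partial>torus_measure) = (\<integral>x. f x \<partial>torus_measure)"
  by (induction n) (simp_all add: integral_step)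

lemma AE_variation_le:
  assumes "\<And>v. norm v < \<epsilon> \<Longrightarrow> energy (\<lambda>x. f (x + torus_of v) - f x) \<le> c"
  shows "AE z in \<nu>. energy (\<lambda>x. f (x + z) - f x) \<le> c"
  using noise_small
proof (rule AE_mp, intro AE_I2 impI)
  fix z :: "'n torus" assume "dist z 0 < \<epsilon>"
  then obtain v where "torus_of v = z" "norm v < \<epsilon>" by (rule small_representative)
  then show "energy (\<lambda>x. f (x + z) - f x) \<le> c" using assms[of v] by simp
qed

text \<open>Up to a constant, a step function on cells of size \<open>r\<close> loses at most the share \<open>\<epsilon> / r\<close> of its energy, so the
  averages over such cells see little of the displacement caused by the noise.\<close>

lemma norm_cell_average_displacement:
  assumes B: "\<And>k. norm (multiplier \<nu> k - 1) \<le> B * (1 - (norm (multiplier \<nu> k))\<^sup>2)" "B \<ge> 0"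
    and f: "bounded_borel f" and r: "0 < r" "r * smin \<le> 1"
  shows "norm_L2 (cell_average n r (\<lambda>x. conv \<nu> f x - f x))
    \<le> B * sqrt (8 * real CARD('n) * \<epsilon> / (smin * r)) * sqrt (loss \<nu> f)"
proof -
  define g where "g x = conv \<nu> f x - f x" for x
  define h where "h = cell_average n r g"
  define c where "c = 8 * real CARD('n) * \<epsilon> / (smin * r)"
  have c: "c \<ge> 0" using \<epsilon> r smin_bounds by (simp add: c_def)
  have g: "bounded_borel g" unfolding g_def using f by auto
  then have h: "bounded_borel h" by (simp add: h_def)
  have "loss \<nu> h \<le> c * energy h"
    unfolding h_def c_def using g r
    by (intro loss_le_variation AE_variation_le cell_average_variation) auto
  have "(energy h)\<^sup>2 = (norm (inner_L2 g h))\<^sup>2"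
    using inner_cell_average[OF g g, of n r] by (simp add: h_def inner_L2_self)
  also have "\<dots> \<le> B\<^sup>2 * (loss \<nu> f * loss \<nu> h)"
    unfolding g_def by (rule inner_displacement_le_loss[OF B f h])
  also have "\<dots> \<le> B\<^sup>2 * (loss \<nu> f * (c * energy h))"
    using loss_nonneg[OF f] \<open>loss \<nu> h \<le> c * energy h\<close> by (intro mult_left_mono) auto
  finally have *: "energy h * energy h \<le> (B\<^sup>2 * c * loss \<nu> f) * energy h" by (simp add: power2_eq_square mult_ac)
  have "energy h \<le> B\<^sup>2 * c * loss \<nu> f"
  proof (cases "energy h = 0")
    case True then show ?thesis using c loss_nonneg[OF f] by simp
  next
    case False
    then have "energy h > 0" using energy_nonneg[of h] by linarith
    then show ?thesis using * by simp
  qed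
  then have "sqrt (energy h) \<le> sqrt (B\<^sup>2 * c * loss \<nu> f)" by (rule real_sqrt_le_mono)
  then have "norm_L2 h \<le> B * sqrt c * sqrt (loss \<nu> f)" using B(2) by (simp add: norm_L2_def real_sqrt_mult)
  then show ?thesis by (simp only: h_def g_def[abs_def] c_def)
qed

text \<open>Cells of size \<open>r\<close> come from cells of size at least \<open>r / smax\<close> one step earlier, and so
  the bounds on the displacement form a geometric series when they are added up over the steps.\<close>

lemma norm_cell_average_steps:
  assumes B: "\<And>k. norm (multiplier \<nu> k - 1) \<le> B * (1 - (norm (multiplier \<nu> k))\<^sup>2)" "B \<ge> 0"
    and f: "bounded_borel f" and mean: "(\<integral>x. f x \<partial>torus_measure) = 0" and r: "0 < r" "r * smin \<le> 1"
  shows "norm_L2 (cell_average n r ((step ^^ n) f))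
    \<le> B * sqrt (8 * real CARD('n) * \<epsilon> / (smin * r))
       * (\<Sum>j<n. sqrt smax ^ (n - 1 - j) * sqrt (loss \<nu> ((step ^^ j) f)))"
  using r
proof (induction n arbitrary: r)
  case 0
  show ?case by (simp add: cell_average.simps mean norm_L2_def energy_def)
next
  case (Suc n)
  define l where "l j = loss \<nu> ((step ^^ j) f)" for j
  have l: "l j \<ge> 0" for j using f by (simp add: l_def loss_nonneg)
  define S where "S = (\<lambda>n. \<Sum>j<n. sqrt smax ^ (n - 1 - j) * sqrt (l j))"
  have S0: "S n \<ge> 0" for n unfolding S_def using smax_bounds l by (auto intro!: sum_nonneg mult_nonneg_nonneg)
  have S_Suc: "S (Suc n) = sqrt smax * S n + sqrt (l n)"
  proof -
    have "(\<Sum>j<n. sqrt smax ^ (n - j) * sqrt (l j)) = (\<Sum>j<n. sqrt smax * (sqrt smax ^ (n - 1 - j) * sqrt (l j)))"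
    proof (intro sum.cong refl)
      fix j assume "j \<in> {..<n}"
      then have "n - j = Suc (n - 1 - j)" by auto
      then show "sqrt smax ^ (n - j) * sqrt (l j) = sqrt smax * (sqrt smax ^ (n - 1 - j) * sqrt (l j))" by simp
    qed
    then show ?thesis by (simp add: S_def sum_distrib_left)
  qed
  define c where "c = B * sqrt (8 * real CARD('n) * \<epsilon> / (smin * r))"
  have c: "c \<ge> 0" using \<epsilon> Suc.prems smin_bounds B(2) by (simp add: c_def)
  let ?g = "(step ^^ n) f"
  have g: "bounded_borel ?g" using f by auto
  have "energy (cell_average (Suc n) r ((step ^^ Suc n) f)) \<le> (c * S (Suc n))\<^sup>2"
  proof (cases "1 \<le> r")
    case True
    then show ?thesis
      using integral_steps[OF f, of "Suc n"] mean by (simp add: cell_average.simps energy_def)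
  next
    case False
    have "energy (cell_average (Suc n) r ((step ^^ Suc n) f)) = energy (cell_average (Suc n) r (\<lambda>x. conv \<nu> ?g (\<phi> x)))"
      by (simp add: step_def)
    also have "\<dots> = (\<Sum>i\<in>{1..M}. p i * energy (cell_average n (r / side i) (conv \<nu> ?g)))"
      using False g by (intro energy_cell_average_\<phi>) auto
    also have "\<dots> \<le> (\<Sum>i\<in>{1..M}. p i * (c * S (Suc n))\<^sup>2)"
    proof (intro sum_mono mult_left_mono)
      fix i assume i: "i \<in> {1..M}"
      note s = side_bounds[OF i] side_between[OF i]
      define r' where "r' = r / side i"
      have r': "0 < r'" using s Suc.prems by (simp add: r'_def)
      have r'1: "r' * smin \<le> 1" unfolding r'_def using False Suc.prems by (intro rescaled_size[OF i]) auto
      define c' where "c' = B * sqrt (8 * real CARD('n) * \<epsilon> / (smin * r'))"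
      have c'_eq: "c' = c * sqrt (side i)"
        by (simp add: c'_def c_def r'_def real_sqrt_mult real_sqrt_divide)
      have "c' \<le> c * sqrt smax" unfolding c'_eq using c s by (intro mult_left_mono) auto
      have "c' \<le> c" unfolding c'_eq using c s by (intro mult_left_le) auto
      have "norm_L2 (cell_average n r' (conv \<nu> ?g))
          \<le> norm_L2 (cell_average n r' ?g) + norm_L2 (\<lambda>x. cell_average n r' (conv \<nu> ?g) x - cell_average n r' ?g x)"
        using g by (intro norm_L2_triangle_diff) auto
      also have "(\<lambda>x. cell_average n r' (conv \<nu> ?g) x - cell_average n r' ?g x) = cell_average n r' (\<lambda>x. conv \<nu> ?g x - ?g x)"
        using g by (auto simp: cell_average_diff)
      also have "norm_L2 (cell_average n r' ?g) + norm_L2 (cell_average n r' (\<lambda>x. conv \<nu> ?g x - ?g x))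
          \<le> c' * S n + c' * sqrt (l n)"
        using Suc.IH[OF r' r'1] norm_cell_average_displacement[OF B g r' r'1, of n]
        unfolding c'_def S_def l_def by (intro add_mono) auto
      also have "\<dots> \<le> c * sqrt smax * S n + c * sqrt (l n)"
        using \<open>c' \<le> c * sqrt smax\<close> \<open>c' \<le> c\<close> S0 l by (intro add_mono mult_right_mono) auto
      also have "\<dots> = c * S (Suc n)" by (simp add: S_Suc algebra_simps)
      finally have "(norm_L2 (cell_average n r' (conv \<nu> ?g)))\<^sup>2 \<le> (c * S (Suc n))\<^sup>2" by (intro power_mono) auto
      then show "energy (cell_average n (r / side i) (conv \<nu> ?g)) \<le> (c * S (Suc n))\<^sup>2"
        by (simp add: norm_L2_square r'_def)
    qed (use p_bounds in \<open>auto simp: less_imp_le\<close>)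
    also have "\<dots> = (c * S (Suc n))\<^sup>2" by (simp add: sum_distrib_right[symmetric] sum_p[simplified])
    finally show ?thesis .
  qed
  then have "norm_L2 (cell_average (Suc n) r ((step ^^ Suc n) f)) \<le> c * S (Suc n)"
    unfolding norm_L2_def using c S0 by (intro real_le_lsqrt) auto
  then show ?case by (simp only: c_def S_def l_def)
qed

text \<open>The part of a function with frequencies above \<open>c / \<epsilon>\<close> loses energy at a fixed rate. The part
  below is almost constant on cells of size \<open>\<epsilon>\<close> if \<open>c\<close> is small, so it is seen by the averages.\<close>

lemma norm_le_cell_average_loss:
  assumes c: "0 < c" "low_constant * c\<^sup>2 \<le> 1 / 4"
    and gap: "\<And>k. norm (int_vec k :: real^'n) > c / \<epsilon> \<Longrightarrow> norm (multiplier \<nu> k) \<le> \<rho>" "0 \<le> \<rho>" "\<rho> < 1"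
    and n: "smax ^ n \<le> \<epsilon>" and small: "sqrt (real CARD('n)) * \<epsilon> < 1 / 4"
    and f: "bounded_borel f"
  shows "norm_L2 f \<le> 2 * norm_L2 (cell_average n \<epsilon> f) + 3 * sqrt (loss \<nu> f / (1 - \<rho>\<^sup>2))"
proof -
  define d where "d = real CARD('n)"
  have d: "d \<ge> 1" using one_le_card_finite[where 'a = 'n] by (simp add: d_def)
  let ?A = "cell_average n \<epsilon>"
  note \<epsilon>s = small_\<epsilon>(2)[OF small]
  have \<rho>: "1 - \<rho>\<^sup>2 > 0" using gap(2,3) by (simp add: abs_square_less_1)
  have poly: "norm_L2 (trig_poly F a) \<le> 2 * norm_L2 (?A (trig_poly F a)) + 3 * sqrt (loss \<nu> (trig_poly F a) / (1 - \<rho>\<^sup>2))"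
    if F: "finite F" for F a
  proof -
    define Lo where "Lo = {k \<in> F. norm (int_vec k :: real^'n) \<le> c / \<epsilon>}"
    have Lo: "finite Lo" "finite (F - Lo)" using F by (auto simp: Lo_def)
    define u where "u = trig_poly Lo a"
    define v where "v = trig_poly (F - Lo) a"
    have guv: "trig_poly F a x - v x = u x" for x
    proof -
      have "trig_poly F a x = v x + u x"
        unfolding u_def v_def trig_poly_def by (rule sum.subset_diff[OF _ F]) (auto simp: Lo_def)
      then show ?thesis by simp
    qed
    have b: "bounded_borel u" "bounded_borel v" by (auto simp: u_def v_def)
    have "pair_variation (sqrt d * \<epsilon>) u \<le> (4 * (sqrt d * \<epsilon>)) ^ CARD('n) * ((2 * pi * (c / \<epsilon>) * (sqrt d * \<epsilon>))\<^sup>2 * energy u)"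
    proof (rule pair_variation_le_translations[OF b(1)])
      show "energy (\<lambda>x. u (x + z) - u x) \<le> (2 * pi * (c / \<epsilon>) * (sqrt d * \<epsilon>))\<^sup>2 * energy u"
        if "dist z 0 \<le> sqrt d * \<epsilon>" for z
        unfolding u_def by (rule energy_trig_poly_translation[OF Lo(1) _ that]) (simp add: Lo_def)
    qed (use \<epsilon> d small in \<open>auto simp: d_def\<close>)
    also have "(2 * pi * (c / \<epsilon>) * (sqrt d * \<epsilon>))\<^sup>2 = (2 * pi * sqrt d)\<^sup>2 * c\<^sup>2"
      using \<epsilon> by (simp add: power_mult_distrib power_divide)
    finally have pv: "pair_variation (sqrt d * \<epsilon>) u \<le> (4 * (sqrt d * \<epsilon>)) ^ CARD('n) * ((2 * pi * sqrt d)\<^sup>2 * c\<^sup>2 * energy u)" .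
    have "energy (\<lambda>x. u x - ?A u x) \<le> pair_variation (sqrt d * \<epsilon>) u / (2 * (smin * \<epsilon>) ^ CARD('n))"
      unfolding d_def by (rule cell_average_Poincare[OF b(1) n \<epsilon>s])
    also have "\<dots> \<le> ((4 * (sqrt d * \<epsilon>)) ^ CARD('n) * ((2 * pi * sqrt d)\<^sup>2 * c\<^sup>2 * energy u)) / (2 * (smin * \<epsilon>) ^ CARD('n))"
      using pv \<epsilon> smin_bounds by (intro divide_right_mono) auto
    also have "\<dots> = low_constant * c\<^sup>2 * energy u"
      using \<epsilon> smin_bounds by (simp add: low_constant_def d_def power_mult_distrib power_divide field_simps)
    also have "\<dots> \<le> 1 / 4 * energy u" using c by (intro mult_right_mono) auto
    finally have "sqrt (energy (\<lambda>x. u x - ?A u x)) \<le> sqrt (1 / 4 * energy u)" by (rule real_sqrt_le_mono)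
    also have "\<dots> = norm_L2 u / 2" by (simp add: norm_L2_def real_sqrt_mult real_sqrt_divide)
    finally have half: "norm_L2 (\<lambda>x. u x - ?A u x) \<le> norm_L2 u / 2" by (simp add: norm_L2_def)
    have "norm_L2 u \<le> norm_L2 (?A u) + norm_L2 (\<lambda>x. u x - ?A u x)"
      using b by (intro norm_L2_triangle_diff) auto
    then have u: "norm_L2 u \<le> 2 * norm_L2 (?A u)" using half by linarith
    have "?A u = (\<lambda>x. ?A (trig_poly F a) x - ?A v x)"
      using b cell_average_diff[of "trig_poly F a" v n \<epsilon>] by (simp add: guv fun_eq_iff)
    then have "norm_L2 (?A u) \<le> norm_L2 (?A (trig_poly F a)) + norm_L2 (?A v)"
      using norm_L2_triangle[of "?A (trig_poly F a)" "\<lambda>x. - ?A v x"] b bounded_borel_diff[of "\<lambda>_. 0" "?A v"]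
      by (simp add: norm_L2_def energy_def)
    moreover have "norm_L2 (?A v) \<le> norm_L2 v" using b by (intro norm_L2_cell_average_le)
    moreover have "norm_L2 (trig_poly F a) \<le> norm_L2 v + norm_L2 (\<lambda>x. trig_poly F a x - v x)"
      using b by (intro norm_L2_triangle_diff) auto
    moreover have "norm_L2 (\<lambda>x. trig_poly F a x - v x) = norm_L2 u" by (simp add: guv)
    moreover have "norm_L2 v \<le> sqrt (loss \<nu> (trig_poly F a) / (1 - \<rho>\<^sup>2))"
    proof -
      have "(1 - \<rho>\<^sup>2) * energy v = (\<Sum>k\<in>F - Lo. (1 - \<rho>\<^sup>2) * (norm (a k))\<^sup>2)"
        by (simp add: v_def energy_trig_poly[OF Lo(2)] sum_distrib_left)
      also have "\<dots> \<le> (\<Sum>k\<in>F - Lo. (1 - (norm (multiplier \<nu> k))\<^sup>2) * (norm (a k))\<^sup>2)"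
      proof (intro sum_mono mult_right_mono)
        fix k assume "k \<in> F - Lo"
        then have "norm (multiplier \<nu> k) \<le> \<rho>" by (intro gap(1)) (auto simp: Lo_def)
        then have "(norm (multiplier \<nu> k))\<^sup>2 \<le> \<rho>\<^sup>2" by (intro power_mono) auto
        then show "1 - \<rho>\<^sup>2 \<le> 1 - (norm (multiplier \<nu> k))\<^sup>2" by simp
      qed auto
      also have "\<dots> \<le> (\<Sum>k\<in>F. (1 - (norm (multiplier \<nu> k))\<^sup>2) * (norm (a k))\<^sup>2)"
        using F norm_multiplier_le by (intro sum_mono2) (auto simp: power_le_one)
      also have "\<dots> = loss \<nu> (trig_poly F a)" by (rule loss_trig_poly[OF F, symmetric])
      finally have "energy v \<le> loss \<nu> (trig_poly F a) / (1 - \<rho>\<^sup>2)" using \<rho> by (simp add: pos_le_divide_eq mult.commute)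
      then show ?thesis unfolding norm_L2_def by (rule real_sqrt_le_mono)
    qed
    ultimately show ?thesis using u by linarith
  qed
  obtain F a where F: "\<And>m. finite (F m)" "(\<lambda>m. norm_L2 (\<lambda>x. trig_poly (F m) (a m) x - f x)) \<longlonglongrightarrow> 0"
    using trig_polys_dense[OF f] by blast
  define g where "g m = trig_poly (F m) (a m)" for m
  have g: "bounded_borel (g m)" for m by (auto simp: g_def)
  have lim: "(\<lambda>m. norm_L2 (\<lambda>x. g m x - f x)) \<longlonglongrightarrow> 0" using F(2) by (simp add: g_def)
  have Alim: "(\<lambda>m. norm_L2 (\<lambda>x. ?A (g m) x - ?A f x)) \<longlonglongrightarrow> 0"
  proof (rule Lim_null_comparison[OF _ lim])
    have "norm_L2 (\<lambda>x. ?A (g m) x - ?A f x) \<le> norm_L2 (\<lambda>x. g m x - f x)" for m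
    proof -
      have "(\<lambda>x. ?A (g m) x - ?A f x) = ?A (\<lambda>x. g m x - f x)"
        using g f by (auto simp: cell_average_diff)
      then show ?thesis using g f norm_L2_cell_average_le[of "\<lambda>x. g m x - f x"] by auto
    qed
    then show "\<forall>\<^sub>F m in sequentially. norm (norm_L2 (\<lambda>x. ?A (g m) x - ?A f x)) \<le> norm_L2 (\<lambda>x. g m x - f x)"
      by (intro always_eventually) auto
  qed
  have nl: "(\<lambda>m. norm_L2 (G m)) \<longlonglongrightarrow> norm_L2 h"
    if "\<And>m. bounded_borel (G m)" "bounded_borel h" "(\<lambda>m. norm_L2 (\<lambda>x. G m x - h x)) \<longlonglongrightarrow> 0" for G h
    unfolding norm_L2_def by (intro tendsto_real_sqrt energy_tendsto that)
  show ?thesis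
  proof (rule LIMSEQ_le)
    show "(\<lambda>m. norm_L2 (g m)) \<longlonglongrightarrow> norm_L2 f" by (rule nl[OF g f lim])
    have "(\<lambda>m. norm_L2 (?A (g m))) \<longlonglongrightarrow> norm_L2 (?A f)"
      using g f Alim by (intro nl) auto
    then show "(\<lambda>m. 2 * norm_L2 (?A (g m)) + 3 * sqrt (loss \<nu> (g m) / (1 - \<rho>\<^sup>2)))
        \<longlonglongrightarrow> 2 * norm_L2 (?A f) + 3 * sqrt (loss \<nu> f / (1 - \<rho>\<^sup>2))"
      using \<rho> by (intro tendsto_intros loss_tendsto g f lim) auto
    show "\<exists>N. \<forall>m\<ge>N. norm_L2 (g m) \<le> 2 * norm_L2 (?A (g m)) + 3 * sqrt (loss \<nu> (g m) / (1 - \<rho>\<^sup>2))"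
      using poly[OF F(1)] by (auto simp: g_def)
  qed
qed

end

lemma sum_geometric_le:
  fixes \<mu> :: real assumes "0 \<le> \<mu>" "\<mu> < 1"
  shows "(\<Sum>j\<le>n. \<mu> ^ (n - j)) \<le> 1 / (1 - \<mu>)"
proof -
  have "(\<Sum>j\<le>n. \<mu> ^ (n - j)) = (\<Sum>j\<le>n. \<mu> ^ j)"
    by (rule sum.reindex_bij_witness[where i = "\<lambda>j. n - j" and j = "\<lambda>j. n - j"]) auto
  also have "\<dots> = (1 - \<mu> ^ Suc n) / (1 - \<mu>)"
    using assms sum_gp0[of \<mu> n] by simp
  also have "\<dots> \<le> 1 / (1 - \<mu>)" using assms by (intro divide_right_mono) auto
  finally show ?thesis .
qed

text \<open>If the energy at time \<open>N + m\<close> is bounded by a geometrically weighted sum of the energies lost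
  up to that time, then the energies are summable, since only the initial energy can be lost.\<close>

lemma energy_decay_of_weighted_losses:
  fixes En :: "nat \<Rightarrow> real"
  assumes nonneg: "\<And>j. 0 \<le> En j" and decr: "\<And>j. En (Suc j) \<le> En j" and \<mu>: "0 \<le> \<mu>" "\<mu> < 1" and C: "0 \<le> C"
    and bound: "\<And>m. En (N + m) \<le> C * (\<Sum>j\<le>N. \<mu> ^ (N - j) * (En (m + j) - En (Suc (m + j))))"
  shows "real (Suc k) * En (N + k) \<le> C / (1 - \<mu>) * En 0"
proof -
  have mono: "En j \<le> En i" if "i \<le> j" for i j using decr that by (rule lift_Suc_antimono_le)
  have "real (Suc k) * En (N + k) = (\<Sum>m\<le>k. En (N + k))" by simp
  also have "\<dots> \<le> (\<Sum>m\<le>k. En (N + m))" by (intro sum_mono mono) auto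
  also have "\<dots> \<le> (\<Sum>m\<le>k. C * (\<Sum>j\<le>N. \<mu> ^ (N - j) * (En (m + j) - En (Suc (m + j)))))"
    by (intro sum_mono bound)
  also have "\<dots> = C * (\<Sum>j\<le>N. \<mu> ^ (N - j) * (\<Sum>m\<le>k. En (m + j) - En (Suc (m + j))))"
    by (simp add: sum_distrib_left[symmetric] sum.swap[of _ "{..N}" "{..k}"])
  also have "\<dots> \<le> C * (\<Sum>j\<le>N. \<mu> ^ (N - j) * En 0)"
  proof (intro mult_left_mono sum_mono)
    fix j
    have "(\<Sum>m\<le>k. En (m + j) - En (Suc (m + j))) = En j - En (Suc (k + j))"
      using sum_telescope[of "\<lambda>m. En (m + j)" k] by simp
    then show "(\<Sum>m\<le>k. En (m + j) - En (Suc (m + j))) \<le> En 0"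
      using nonneg[of "Suc (k + j)"] mono[of 0 j] by simp
  qed (use C \<mu> in auto)
  also have "\<dots> = C * (\<Sum>j\<le>N. \<mu> ^ (N - j)) * En 0" by (simp add: sum_distrib_right mult.assoc)
  also have "\<dots> \<le> C * (1 / (1 - \<mu>)) * En 0"
    by (intro mult_right_mono mult_left_mono sum_geometric_le \<mu> C nonneg)
  finally show ?thesis by simp
qed

context noisy_bernoulli
begin

text \<open>While cells of size \<open>\<epsilon>\<close> grow to the size of the torus, within \<open>N\<close> steps, the averages over
  them record only the losses on the way, the recent ones most. Whatever is not seen by these
  averages is lost at a fixed rate. So the energy is controlled by losses alone.\<close>

theorem energy_decay:
  assumes B: "\<And>k. norm (multiplier \<nu> k - 1) \<le> B * (1 - (norm (multiplier \<nu> k))\<^sup>2)" "B \<ge> 0"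
    and c: "0 < c" "low_constant * c\<^sup>2 \<le> 1 / 4"
    and gap: "\<And>k. norm (int_vec k :: real^'n) > c / \<epsilon> \<Longrightarrow> norm (multiplier \<nu> k) \<le> \<rho>" "0 \<le> \<rho>" "\<rho> < 1"
    and N: "smax ^ N \<le> \<epsilon>" and small: "sqrt (real CARD('n)) * \<epsilon> < 1 / 4"
    and f: "bounded_borel f" and mean: "(\<integral>x. f x \<partial>torus_measure) = 0"
  shows "real (Suc k) * energy ((step ^^ (N + k)) f)
    \<le> ((2 * (B * sqrt (8 * real CARD('n) / smin)) / sqrt smax + 3 / sqrt (1 - \<rho>\<^sup>2)) / (1 - sqrt smax))\<^sup>2 * energy f"
proof -
  define \<mu> where "\<mu> = sqrt smax"
  have \<mu>: "0 < \<mu>" "\<mu> < 1" using smax_bounds by (auto simp: \<mu>_def)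
  define S where "S = B * sqrt (8 * real CARD('n) / smin)"
  define C where "C = 2 * S / \<mu> + 3 / sqrt (1 - \<rho>\<^sup>2)"
  have \<rho>: "1 - \<rho>\<^sup>2 > 0" using gap(2,3) by (simp add: abs_square_less_1)
  have S: "S \<ge> 0" using B smin_bounds by (simp add: S_def)
  then have C: "C \<ge> 0" using \<mu> \<rho> by (simp add: C_def)
  define En where "En j = energy ((step ^^ j) f)" for j
  define l where "l j = loss \<nu> ((step ^^ j) f)" for j
  have l_eq: "l j = En j - En (Suc j)" for j using f by (simp add: l_def En_def energy_step)
  have l: "l j \<ge> 0" for j using f by (simp add: l_def loss_nonneg)
  note \<epsilon>s = small_\<epsilon>(2)[OF small]
  have "En (N + m) \<le> C\<^sup>2 / (1 - \<mu>) * (\<Sum>j\<le>N. \<mu> ^ (N - j) * (En (m + j) - En (Suc (m + j))))" for m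
  proof -
    define g where "g = (step ^^ m) f"
    have g: "bounded_borel g" using f by (simp add: g_def)
    have gmean: "(\<integral>x. g x \<partial>torus_measure) = 0" using integral_steps[OF f] mean by (simp add: g_def)
    have steps_g: "(step ^^ j) g = (step ^^ (m + j)) f" for j
      by (simp add: g_def funpow_add add.commute[of m])
    define W where "W = (\<Sum>j\<le>N. \<mu> ^ (N - j) * sqrt (l (m + j)))"
    have "norm_L2 (cell_average N \<epsilon> ((step ^^ N) g))
        \<le> B * sqrt (8 * real CARD('n) * \<epsilon> / (smin * \<epsilon>)) * (\<Sum>j<N. sqrt smax ^ (N - 1 - j) * sqrt (loss \<nu> ((step ^^ j) g)))"
      by (rule norm_cell_average_steps[OF B g gmean \<epsilon> \<epsilon>s])
    also have "\<dots> = S * (\<Sum>j<N. \<mu> ^ (N - 1 - j) * sqrt (l (m + j)))"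
      using \<epsilon> by (simp add: S_def \<mu>_def l_def steps_g)
    also have "(\<Sum>j<N. \<mu> ^ (N - 1 - j) * sqrt (l (m + j))) = (\<Sum>j<N. \<mu> ^ (N - j) * sqrt (l (m + j))) / \<mu>"
      unfolding sum_divide_distrib
    proof (intro sum.cong refl)
      fix j assume "j \<in> {..<N}"
      then have "N - j = Suc (N - 1 - j)" by auto
      then show "\<mu> ^ (N - 1 - j) * sqrt (l (m + j)) = \<mu> ^ (N - j) * sqrt (l (m + j)) / \<mu>" using \<mu> by simp
    qed
    finally have A: "norm_L2 (cell_average N \<epsilon> ((step ^^ N) g)) \<le> S / \<mu> * (\<Sum>j<N. \<mu> ^ (N - j) * sqrt (l (m + j)))"
      by simp
    have "norm_L2 ((step ^^ N) g)
        \<le> 2 * norm_L2 (cell_average N \<epsilon> ((step ^^ N) g)) + 3 * sqrt (loss \<nu> ((step ^^ N) g) / (1 - \<rho>\<^sup>2))"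
      using g by (intro norm_le_cell_average_loss[OF c gap N small]) auto
    also have "\<dots> \<le> 2 * (S / \<mu> * (\<Sum>j<N. \<mu> ^ (N - j) * sqrt (l (m + j)))) + 3 / sqrt (1 - \<rho>\<^sup>2) * sqrt (l (m + N))"
      using A by (simp add: steps_g l_def real_sqrt_divide)
    also have "\<dots> \<le> C * (\<Sum>j<N. \<mu> ^ (N - j) * sqrt (l (m + j))) + C * sqrt (l (m + N))"
    proof (intro add_mono)
      have "2 * (S / \<mu>) * (\<Sum>j<N. \<mu> ^ (N - j) * sqrt (l (m + j))) \<le> C * (\<Sum>j<N. \<mu> ^ (N - j) * sqrt (l (m + j)))"
        using \<rho> \<mu> l by (intro mult_right_mono sum_nonneg) (auto simp: C_def)
      then show "2 * (S / \<mu> * (\<Sum>j<N. \<mu> ^ (N - j) * sqrt (l (m + j)))) \<le> C * (\<Sum>j<N. \<mu> ^ (N - j) * sqrt (l (m + j)))"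
        by (simp add: mult.assoc)
      show "3 / sqrt (1 - \<rho>\<^sup>2) * sqrt (l (m + N)) \<le> C * sqrt (l (m + N))"
        using S \<mu> l by (intro mult_right_mono) (auto simp: C_def)
    qed
    also have "\<dots> = C * W" by (simp add: W_def lessThan_Suc_atMost[symmetric] algebra_simps)
    finally have "norm_L2 ((step ^^ N) g) \<le> C * W" .
    then have "(norm_L2 ((step ^^ N) g))\<^sup>2 \<le> (C * W)\<^sup>2" by (intro power_mono) auto
    also have "\<dots> = C\<^sup>2 * W\<^sup>2" by (simp add: power_mult_distrib)
    also have "W\<^sup>2 = (\<Sum>j\<le>N. sqrt (\<mu> ^ (N - j)) * (sqrt (\<mu> ^ (N - j)) * sqrt (l (m + j))))\<^sup>2"
      using \<mu> by (simp add: W_def mult.assoc[symmetric])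
    also have "C\<^sup>2 * \<dots> \<le> C\<^sup>2 * ((\<Sum>j\<le>N. (sqrt (\<mu> ^ (N - j)))\<^sup>2) * (\<Sum>j\<le>N. (sqrt (\<mu> ^ (N - j)) * sqrt (l (m + j)))\<^sup>2))"
      by (intro mult_left_mono Cauchy_Schwarz_ineq_sum) auto
    also have "\<dots> = C\<^sup>2 * ((\<Sum>j\<le>N. \<mu> ^ (N - j)) * (\<Sum>j\<le>N. \<mu> ^ (N - j) * l (m + j)))"
      using \<mu> l by (simp add: power_mult_distrib)
    also have "\<dots> \<le> C\<^sup>2 * (1 / (1 - \<mu>) * (\<Sum>j\<le>N. \<mu> ^ (N - j) * l (m + j)))"
      using \<mu> l by (intro mult_left_mono mult_right_mono sum_geometric_le sum_nonneg) auto
    finally show ?thesis by (simp add: norm_L2_square steps_g En_def l_eq add.commute)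
  qed
  then have "real (Suc k) * En (N + k) \<le> C\<^sup>2 / (1 - \<mu>) / (1 - \<mu>) * En 0"
    using \<mu> l l_eq by (intro energy_decay_of_weighted_losses) (auto simp: En_def)
  also have "C\<^sup>2 / (1 - \<mu>) / (1 - \<mu>) = (C / (1 - \<mu>))\<^sup>2" by (simp add: power2_eq_square)
  finally show ?thesis by (simp add: En_def C_def S_def \<mu>_def)
qed

end

section \<open>Fourier multiplier of small centered noise\<close>

lemma one_minus_cos_ge:
  fixes t :: real
  assumes "\<bar>t\<bar> \<le> 1" shows "t\<^sup>2 / 4 \<le> 1 - cos t"
proof -
  have "cmod (iexp t - (\<Sum>k\<le>3. (\<i> * t)^k / fact k)) \<le> \<bar>t\<bar>^4 / fact 4"
    using iexp_approx1[of t 3] by simp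
  moreover have "Re (iexp t - (\<Sum>k\<le>3. (\<i> * t)^k / fact k)) = cos t - (1 - t\<^sup>2 / 2)"
    by (simp add: numeral_eq_Suc Re_exp power_mult_distrib algebra_simps)
  ultimately have "cos t - (1 - t\<^sup>2 / 2) \<le> \<bar>t\<bar>^4 / 24"
    using complex_Re_le_cmod[of "iexp t - (\<Sum>k\<le>3. (\<i> * t)^k / fact k)"] by (simp add: fact_numeral)
  moreover have "\<bar>t\<bar>^4 \<le> t\<^sup>2"
  proof -
    have "\<bar>t\<bar>^4 = t\<^sup>2 * t\<^sup>2" by (simp add: power4_eq_xxxx power2_eq_square)
    also have "\<dots> \<le> t\<^sup>2 * 1" using assms by (intro mult_left_mono) (auto simp: abs_square_le_1)
    finally show ?thesis by simp
  qed
  ultimately show ?thesis using zero_le_power2[of t] by linarith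
qed

lemma centered_eqI:
  "torus_of v = z \<Longrightarrow> (\<And>i. - 1/2 \<le> v $ i \<and> v $ i < 1/2) \<Longrightarrow> centered z = v"
  unfolding centered_def by (rule the1_equality[OF centered_ex1]) auto

lemma centered_bounds: "- 1/2 \<le> centered z $ i \<and> centered z $ i < 1/2" and torus_of_centered: "torus_of (centered z) = z"
  using theI'[OF centered_ex1[of z]] by (auto simp: centered_def)

lemma centered_measurable [measurable]: "(centered :: 'n::finite torus \<Rightarrow> real^'n) \<in> borel_measurable borel"
proof -
  have "centered z = check (z + torus_of (\<chi> i. 1/2)) - (\<chi> i. 1/2)" for z :: "'n torus"
  proof (rule centered_eqI)
    have "torus_of (check (z + torus_of (\<chi> i. 1/2)) - (\<chi> i. 1/2))
        = torus_of (check (z + torus_of (\<chi> i. 1/2))) - torus_of (\<chi> i. 1/2)"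
      using torus_of_add[of "check (z + torus_of (\<chi> i. 1/2))" "- (\<chi> i. 1/2)"] by (simp add: torus_of_uminus)
    then show "torus_of (check (z + torus_of (\<chi> i. 1/2)) - (\<chi> i. 1/2)) = z" by (simp add: torus_of_check)
    show "- 1/2 \<le> (check (z + torus_of (\<chi> i. 1/2)) - (\<chi> i. 1/2)) $ i
        \<and> (check (z + torus_of (\<chi> i. 1/2)) - (\<chi> i. 1/2)) $ i < 1/2" for i
      using check_in_unit_cube[of "z + torus_of (\<chi> i. 1/2)"] by (simp add: unit_cube_def)
  qed
  then have "centered = (\<lambda>z. check (z + torus_of (\<chi> i. 1/2)) - (\<chi> i. 1/2) :: real^'n)" by (rule ext)
  moreover have "(\<lambda>z. check (z + torus_of (\<chi> i. 1/2)) - (\<chi> i. 1/2) :: real^'n) \<in> borel_measurable borel" by measurable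
  ultimately show ?thesis by simp
qed

lemma norm_centered_less:
  assumes "dist z 0 < \<epsilon>" "\<epsilon> \<le> 1/2" shows "norm (centered z) < \<epsilon>"
proof -
  obtain v where v: "torus_of v = z" "norm v < \<epsilon>" using small_representative[OF assms(1)] by blast
  have "centered z = v"
  proof (rule centered_eqI[OF v(1)])
    fix i
    have "\<bar>v $ i\<bar> < 1/2" using component_le_norm_cart[of v i] v(2) assms(2) by linarith
    then show "- 1/2 \<le> v $ i \<and> v $ i < 1/2" by linarith
  qed
  then show ?thesis using v by simp
qed

lemma norm_centered_le: "norm (centered z) \<le> real CARD('n)" for z :: "'n::finite torus"
proof -
  have "norm (centered z) \<le> (\<Sum>i\<in>UNIV. \<bar>centered z $ i\<bar>)" by (rule norm_le_l1_cart)
  also have "\<dots> \<le> (\<Sum>i\<in>(UNIV :: 'n set). 1)"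
  proof (intro sum_mono)
    fix i show "\<bar>centered z $ i\<bar> \<le> 1" using centered_bounds[of z i] by (simp add: abs_le_iff)
  qed
  finally show ?thesis by simp
qed

text \<open>At low frequency both sides are comparable to the variance of the noise in the direction
  \<open>k\<close>. The first-order term of the left hand side vanishes since the noise has mean zero.\<close>

lemma (in torus_prob) multiplier_low_frequency:
  assumes small: "AE z in \<nu>. dist z 0 < \<epsilon>" "0 < \<epsilon>" "\<epsilon> \<le> 1/2" and mean: "(\<integral>z. centered z \<partial>\<nu>) = 0"
    and k: "2 * pi * (norm (int_vec k :: real^'n) * \<epsilon>) \<le> 1"
  shows "norm (multiplier \<nu> k - 1) \<le> 2 * (1 - (norm (multiplier \<nu> k))\<^sup>2)"
proof -
  define t where "t z = 2 * pi * (int_vec k \<bullet> centered z)" for z :: "'n torus"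
  have cint: "bounded_borel (centered :: 'n torus \<Rightarrow> real^'n)"
    by (rule bounded_borelI[OF centered_measurable norm_centered_le])
  have tmeas [measurable]: "t \<in> borel_measurable borel" unfolding t_def by measurable
  have bt: "bounded_borel t"
  proof (rule bounded_borelI[OF tmeas])
    fix z
    have "\<bar>int_vec k \<bullet> centered z\<bar> \<le> norm (int_vec k :: real^'n) * norm (centered z)" by (rule Cauchy_Schwarz_ineq2)
    also have "\<dots> \<le> norm (int_vec k :: real^'n) * real CARD('n)" by (intro mult_left_mono norm_centered_le) auto
    finally show "norm (t z) \<le> 2 * pi * (norm (int_vec k :: real^'n) * real CARD('n))" by (simp add: t_def abs_mult)
  qed
  have AE_t: "AE z in \<nu>. \<bar>t z\<bar> \<le> 1"
    using small(1)
  proof (rule AE_mp, intro AE_I2 impI)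
    fix z :: "'n torus" assume "dist z 0 < \<epsilon>"
    then have "norm (centered z) < \<epsilon>" using small(3) by (rule norm_centered_less)
    then have "\<bar>int_vec k \<bullet> centered z\<bar> \<le> norm (int_vec k :: real^'n) * \<epsilon>"
      by (intro order_trans[OF Cauchy_Schwarz_ineq2] mult_left_mono) auto
    then have "2 * pi * \<bar>int_vec k \<bullet> centered z\<bar> \<le> 2 * pi * (norm (int_vec k :: real^'n) * \<epsilon>)" by (intro mult_left_mono) auto
    moreover have "\<bar>t z\<bar> = 2 * pi * \<bar>int_vec k \<bullet> centered z\<bar>" by (simp add: t_def abs_mult)
    ultimately show "\<bar>t z\<bar> \<le> 1" using k by linarith
  qed
  have char: "character k z = iexp (t z)" for z
    using character_torus_of[of k "centered z"] by (simp add: torus_of_centered t_def cis_conv_exp)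
  have int_t: "(\<integral>z. t z \<partial>\<nu>) = 0"
    using integrable_noise(1)[OF cint] mean by (simp add: t_def)
  define s where "s = (\<integral>z. (t z)\<^sup>2 \<partial>\<nu>)"
  have int_sq: "integrable \<nu> (\<lambda>z. (t z)\<^sup>2)" using bt by (intro integrable_noise(1)) auto
  have ic: "integrable \<nu> (character k)" by (intro integrable_noise(1)) auto
  have it: "integrable \<nu> (\<lambda>z. \<i> * complex_of_real (t z))" using bt by (intro integrable_noise(1)) auto
  have s0: "0 \<le> s" by (simp add: s_def)
  have s1: "s \<le> 1"
  proof -
    have "s \<le> (\<integral>z. 1 \<partial>\<nu>)" unfolding s_def
    proof (rule integral_mono_AE[OF int_sq])
      show "AE z in \<nu>. (t z)\<^sup>2 \<le> 1" using AE_t by eventually_elim (simp add: abs_square_le_1)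
    qed simp
    then show ?thesis by simp
  qed
  have up: "norm (multiplier \<nu> k - 1) \<le> s / 2"
  proof -
    have "multiplier \<nu> k - 1 = (\<integral>z. character k z - 1 - \<i> * complex_of_real (t z) \<partial>\<nu>)"
      using ic it int_t bt by (simp add: multiplier_def integrable_noise(1))
    also have "norm \<dots> \<le> (\<integral>z. norm (character k z - 1 - \<i> * complex_of_real (t z)) \<partial>\<nu>)" by (rule integral_norm_bound)
    also have "\<dots> \<le> (\<integral>z. (t z)\<^sup>2 / 2 \<partial>\<nu>)"
    proof (rule integral_mono)
      show "norm (character k z - 1 - \<i> * complex_of_real (t z)) \<le> (t z)\<^sup>2 / 2" for z
        using iexp_approx1[of "t z" 1] unfolding char by (simp add: numeral_eq_Suc algebra_simps)
    qed (use int_sq ic it in auto)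
    finally show ?thesis by (simp add: s_def)
  qed
  have "s / 4 \<le> 1 - Re (multiplier \<nu> k)"
  proof -
    have "s / 4 = (\<integral>z. (t z)\<^sup>2 / 4 \<partial>\<nu>)" by (simp add: s_def)
    also have "\<dots> \<le> (\<integral>z. 1 - Re (character k z) \<partial>\<nu>)"
    proof (rule integral_mono_AE)
      show "AE z in \<nu>. (t z)\<^sup>2 / 4 \<le> 1 - Re (character k z)"
        using AE_t by eventually_elim (use one_minus_cos_ge in \<open>simp add: char Re_exp\<close>)
    qed (use int_sq ic in auto)
    also have "\<dots> = 1 - Re (multiplier \<nu> k)" using ic by (simp add: multiplier_def)
    finally show ?thesis .
  qed
  moreover have "(norm (multiplier \<nu> k))\<^sup>2 = 1 - 2 * (1 - Re (multiplier \<nu> k)) + (norm (multiplier \<nu> k - 1))\<^sup>2"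
    unfolding cmod_power2 by (simp add: power2_eq_square algebra_simps)
  moreover have "(norm (multiplier \<nu> k - 1))\<^sup>2 \<le> s / 4"
  proof -
    have "(norm (multiplier \<nu> k - 1))\<^sup>2 \<le> (s / 2)\<^sup>2" using up by (intro power_mono) auto
    also have "s * s \<le> s * 1" using s0 s1 by (intro mult_left_mono)
    then have "(s / 2)\<^sup>2 \<le> s / 4" by (simp add: power2_eq_square)
    finally show ?thesis .
  qed
  ultimately have "s / 4 \<le> 1 - (norm (multiplier \<nu> k))\<^sup>2" by argo
  then show ?thesis using up by argo
qed

lemma (in torus_prob) multiplier_displacement_bound:
  assumes small: "AE z in \<nu>. dist z 0 < \<epsilon>" "0 < \<epsilon>" "\<epsilon> \<le> 1/2" and mean: "(\<integral>z. centered z \<partial>\<nu>) = 0"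
    and c: "2 * pi * c \<le> 1"
    and gap: "\<And>k. norm (int_vec k :: real^'n) > c / \<epsilon> \<Longrightarrow> norm (multiplier \<nu> k) \<le> \<rho>" "0 \<le> \<rho>" "\<rho> < 1"
  shows "norm (multiplier \<nu> k - 1) \<le> 2 / (1 - \<rho>\<^sup>2) * (1 - (norm (multiplier \<nu> k))\<^sup>2)"
proof -
  have \<rho>: "0 < 1 - \<rho>\<^sup>2" "1 - \<rho>\<^sup>2 \<le> 1" using gap(2,3) by (auto simp: abs_square_less_1)
  show ?thesis
  proof (cases "norm (int_vec k :: real^'n) > c / \<epsilon>")
    case True
    then have "(norm (multiplier \<nu> k))\<^sup>2 \<le> \<rho>\<^sup>2" by (intro power_mono gap(1)) auto
    then have "2 * (1 - \<rho>\<^sup>2) \<le> 2 * (1 - (norm (multiplier \<nu> k))\<^sup>2)" by simp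
    then have "2 \<le> 2 / (1 - \<rho>\<^sup>2) * (1 - (norm (multiplier \<nu> k))\<^sup>2)"
      unfolding times_divide_eq_left pos_le_divide_eq[OF \<rho>(1)] .
    moreover have "norm (multiplier \<nu> k - 1) \<le> 2"
      using norm_triangle_ineq4[of "multiplier \<nu> k" 1] norm_multiplier_le[of k] by simp
    ultimately show ?thesis by linarith
  next
    case False
    then have "norm (int_vec k :: real^'n) * \<epsilon> \<le> c" using small(2) by (simp add: not_less pos_le_divide_eq)
    then have "2 * pi * (norm (int_vec k :: real^'n) * \<epsilon>) \<le> 2 * pi * c" by (intro mult_left_mono) auto
    then have "norm (multiplier \<nu> k - 1) \<le> 2 * (1 - (norm (multiplier \<nu> k))\<^sup>2)"
      using c by (intro multiplier_low_frequency[OF small mean]) linarith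
    also have "\<dots> \<le> 2 / (1 - \<rho>\<^sup>2) * (1 - (norm (multiplier \<nu> k))\<^sup>2)"
      using \<rho> norm_multiplier_le[of k] by (intro mult_right_mono) (auto simp: power_le_one pos_le_divide_eq)
    finally show ?thesis .
  qed
qed

section \<open>Functions that keep their energy for a long time\<close>

context bernoulli
begin

text \<open>For \<open>r = 0\<close> the refinement does not stop early, and the cells are the cylinders of length \<open>n\<close>.\<close>

lemma measure_not_inside_cylinder:
  assumes "0 < \<rho>"
  shows "measure torus_measure {x. \<not> inside_cell n 0 \<rho> x} \<le> 2 * real CARD('n) * \<rho> * (1 / smin) ^ n"
  using assms
proof (induction n arbitrary: \<rho>)
  case 0 then show ?case using measure_near_faces[of \<rho>] by (simp add: inside_cell.simps)
next
  case (Suc n)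
  have ms [measurable]: "{x. \<not> inside_cell m r \<rho> x} \<in> sets borel" for m r \<rho> by measurable
  have "measure torus_measure {x. \<not> inside_cell (Suc n) 0 \<rho> x} = (\<integral>x. indicat_real {x. \<not> inside_cell (Suc n) 0 \<rho> x} x \<partial>torus_measure)"
    by simp
  also have "\<dots> = (\<Sum>i\<in>{1..M}. p i *\<^sub>R (\<integral>x. indicat_real {x. \<not> inside_cell (Suc n) 0 \<rho> x} (\<psi> i x) \<partial>torus_measure))"
    by (rule integral_branches) (rule bounded_borel_indicator[OF ms])
  also have "\<dots> \<le> (\<Sum>i\<in>{1..M}. p i * (2 * real CARD('n) * \<rho> * (1 / smin) ^ Suc n))"
  proof (intro sum_mono)
    fix i assume i: "i \<in> {1..M}"
    note s = side_bounds[OF i] side_between[OF i]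
    have "inside_cell (Suc n) 0 \<rho> (\<psi> i x) = inside_cell n 0 (\<rho> / side i) x" for x
      using inside_cell_\<psi>[OF i, of 0 n \<rho> x] by simp
    then have "(\<integral>x. indicat_real {x. \<not> inside_cell (Suc n) 0 \<rho> x} (\<psi> i x) \<partial>torus_measure)
        = (\<integral>x. indicat_real {x. \<not> inside_cell n 0 (\<rho> / side i) x} x \<partial>torus_measure)"
      by (intro Bochner_Integration.integral_cong) (auto simp: indicator_def)
    also have "\<dots> = measure torus_measure {x. \<not> inside_cell n 0 (\<rho> / side i) x}" by simp
    also have "\<dots> \<le> 2 * real CARD('n) * (\<rho> / side i) * (1 / smin) ^ n"
      using Suc.prems s by (intro Suc.IH) auto
    also have "\<dots> \<le> 2 * real CARD('n) * (\<rho> / smin) * (1 / smin) ^ n"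
      using Suc.prems s smin_bounds by (intro mult_right_mono mult_left_mono divide_left_mono) auto
    also have "\<dots> = 2 * real CARD('n) * \<rho> * (1 / smin) ^ Suc n" by simp
    finally show "p i *\<^sub>R (\<integral>x. indicat_real {x. \<not> inside_cell (Suc n) 0 \<rho> x} (\<psi> i x) \<partial>torus_measure)
        \<le> p i * (2 * real CARD('n) * \<rho> * (1 / smin) ^ Suc n)"
      unfolding real_scaleR_def using p_bounds[OF i] by (intro mult_left_mono) auto
  qed
  also have "\<dots> = 2 * real CARD('n) * \<rho> * (1 / smin) ^ Suc n"
    by (simp only: sum_distrib_right[symmetric] sum_p mult_1_left)
  finally show ?case .
qed

lemma inside_cylinder_shift:
  assumes "inside_cell n 0 \<rho> x" "norm v < \<rho>"
  shows "check x + v \<in> unit_cube \<and>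
    (\<exists>v'. (\<phi> ^^ n) (x + torus_of v) = (\<phi> ^^ n) x + torus_of v' \<and> norm v' \<le> (1 / smin) ^ n * norm v)"
  using assms
proof (induction n arbitrary: \<rho> x v)
  case 0 then show ?case using away_from_faces_shift by (auto simp: inside_cell.simps)
next
  case (Suc n)
  define v' where "v' = (1 / side (branch x)) *\<^sub>R (D (branch x) *v v)"
  have i: "branch x \<in> {1..M}" by (rule branch_in)
  note s = side_bounds[OF i] side_between[OF i]
  have nv': "norm v' = norm v / side (branch x)"
    using s by (simp add: v'_def norm_orthogonal_matrix_mult[OF D_orth[OF i]])
  then have "norm v' < \<rho> / side (branch x)"
    using s Suc.prems(2) by (simp add: divide_strict_right_mono)
  moreover have "inside_cell n 0 (\<rho> / side (branch x)) (\<phi> x)" using Suc.prems(1) by (simp add: inside_cell.simps)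
  ultimately obtain v'' where IH: "check (\<phi> x) + v' \<in> unit_cube"
    "(\<phi> ^^ n) (\<phi> x + torus_of v') = (\<phi> ^^ n) (\<phi> x) + torus_of v''" "norm v'' \<le> (1 / smin) ^ n * norm v'"
    using Suc.IH[of "\<rho> / side (branch x)" "\<phi> x" v'] by blast
  note b = branch_shift[OF v'_def IH(1)]
  have "norm v'' \<le> (1 / smin) ^ Suc n * norm v"
  proof -
    have "norm v' \<le> norm v / smin" unfolding nv' using s smin_bounds by (intro divide_left_mono) auto
    then have "(1 / smin) ^ n * norm v' \<le> (1 / smin) ^ n * (norm v / smin)"
      using smin_bounds by (intro mult_left_mono) auto
    then show ?thesis using IH(3) by simp
  qed
  then show ?case using b(1,3) IH(2) by (auto simp: funpow_swap1)
qed

lemma bounded_borel_\<phi>_funpow: "bounded_borel f \<Longrightarrow> bounded_borel (\<lambda>x. f ((\<phi> ^^ n) x))"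
proof (induction n arbitrary: f)
  case (Suc n)
  show ?case using Suc.IH[OF bounded_borel_\<phi>[OF Suc.prems]] by simp
qed simp

lemma character_funpow_variation:
  assumes k: "norm (int_vec k :: real^'n) = 1" and v: "norm v < \<rho>" and small: "(1 / smin) ^ n * \<rho> \<le> 1"
  shows "energy (\<lambda>x. character k ((\<phi> ^^ n) (x + torus_of v)) - character k ((\<phi> ^^ n) x))
    \<le> (4 * pi\<^sup>2 + 8 * real CARD('n)) * ((1 / smin) ^ n * \<rho>)"
proof -
  define L where "L = (1 / smin) ^ n * \<rho>"
  have \<rho>: "\<rho> > 0" using v norm_ge_zero le_less_trans by blast
  have L: "0 \<le> L" "L \<le> 1" using \<rho> smin_bounds small by (auto simp: L_def)
  define f where "f x = character k ((\<phi> ^^ n) x)" for x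
  define bad where "bad = {x. \<not> inside_cell n 0 \<rho> x}"
  have bad: "bad \<in> sets borel" unfolding bad_def by measurable
  have bf: "bounded_borel f" unfolding f_def[abs_def] by (rule bounded_borel_\<phi>_funpow) simp
  have ptw: "(norm (f (x + torus_of v) - f x))\<^sup>2 \<le> (2 * pi * L)\<^sup>2 + 4 * indicat_real bad x" for x
  proof (cases "x \<in> bad")
    case True
    have "norm (f (x + torus_of v) - f x) \<le> 2"
      using norm_triangle_ineq4[of "f (x + torus_of v)" "f x"] by (simp add: f_def)
    then have "(norm (f (x + torus_of v) - f x))\<^sup>2 \<le> 2\<^sup>2" by (intro power_mono) auto
    moreover have "4 * indicat_real bad x = 2\<^sup>2" using True by simp
    ultimately show ?thesis using zero_le_power2[of "2 * pi * L"] by linarith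
  next
    case False
    then obtain v' where v': "(\<phi> ^^ n) (x + torus_of v) = (\<phi> ^^ n) x + torus_of v'" "norm v' \<le> (1 / smin) ^ n * norm v"
      using inside_cylinder_shift[OF _ v, of n x] by (auto simp: bad_def)
    have "(1 / smin) ^ n * norm v \<le> L" unfolding L_def using v smin_bounds by (intro mult_left_mono) auto
    then have "norm v' \<le> L" using v'(2) by linarith
    have "f (x + torus_of v) - f x = f x * (character k (torus_of v') - 1)"
      by (simp add: f_def v'(1) character_add algebra_simps)
    then have "norm (f (x + torus_of v) - f x) = norm (character k (torus_of v') - 1)"
      by (simp add: norm_mult f_def)
    also have "\<dots> \<le> 2 * pi * norm (int_vec k :: real^'n) * dist (torus_of v' :: 'n torus) 0"
      by (rule norm_character_minus_one_le)
    also have "\<dots> \<le> 2 * pi * L"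
      using dist_torus_lower[OF refl torus_of_0, of v'] \<open>norm v' \<le> L\<close> k by simp
    finally have "(norm (f (x + torus_of v) - f x))\<^sup>2 \<le> (2 * pi * L)\<^sup>2" by (intro power_mono) auto
    then show ?thesis using False by simp
  qed
  have "energy (\<lambda>x. f (x + torus_of v) - f x) \<le> (\<integral>x. (2 * pi * L)\<^sup>2 + 4 * indicat_real bad x \<partial>torus_measure)"
    unfolding energy_def
  proof (rule integral_mono)
    show "integrable torus_measure (\<lambda>x. (norm (f (x + torus_of v) - f x))\<^sup>2)"
      by (intro integrable_torus bounded_borel_power bounded_borel_norm bounded_borel_diff bounded_borel_shift bf)
    show "integrable torus_measure (\<lambda>x. (2 * pi * L)\<^sup>2 + 4 * indicat_real bad x)"
      by (intro integrable_torus bounded_borel_add bounded_borel_mult bounded_borel_const bounded_borel_indicator bad)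
  qed (rule ptw)
  also have "\<dots> = (2 * pi * L)\<^sup>2 + 4 * measure torus_measure bad"
    using bounded_borel_indicator[OF bad] bad by simp
  also have "\<dots> \<le> 4 * pi\<^sup>2 * L + 4 * (2 * real CARD('n) * L)"
  proof (intro add_mono mult_left_mono)
    have "(2 * pi * L)\<^sup>2 = 4 * pi\<^sup>2 * (L * L)" by (simp add: power2_eq_square)
    also have "\<dots> \<le> 4 * pi\<^sup>2 * (L * 1)" using L by (intro mult_left_mono) auto
    finally show "(2 * pi * L)\<^sup>2 \<le> 4 * pi\<^sup>2 * L" by simp
    show "measure torus_measure bad \<le> 2 * real CARD('n) * L"
      using measure_not_inside_cylinder[OF \<rho>, of n] by (simp add: bad_def L_def mult_ac)
  qed auto
  finally show ?thesis by (simp add: f_def L_def algebra_simps)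
qed

text \<open>The displacements at the times \<open>j < n\<close> are bounded by a geometric series with ratio
  \<open>sqrt (1 / smin)\<close>.\<close>

definition keep_constant :: real where
  "keep_constant = sqrt (4 * pi\<^sup>2 + 8 * real CARD('n)) / (sqrt (1 / smin) - 1)"

end

context noisy_bernoulli
begin

text \<open>Neither the map nor the averaging increases norms, so the differences between the noisy and
  the deterministic evolution at most add up.\<close>

lemma steps_minus_funpow:
  assumes f: "bounded_borel f"
  shows "norm_L2 (\<lambda>x. (step ^^ n) f x - f ((\<phi> ^^ n) x))
    \<le> (\<Sum>j<n. norm_L2 (\<lambda>x. conv \<nu> (\<lambda>y. f ((\<phi> ^^ j) y)) x - f ((\<phi> ^^ j) x)))"
proof (induction n)
  case 0 then show ?case by (simp add: norm_L2_def energy_def)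
next
  case (Suc n)
  define g where "g = (step ^^ n) f"
  define h where "h x = f ((\<phi> ^^ n) x)" for x
  have g: "bounded_borel g" and h: "bounded_borel h"
    using f bounded_borel_\<phi>_funpow[OF f] by (auto simp: g_def h_def[abs_def])
  let ?w = "\<lambda>x. conv \<nu> (\<lambda>x. g x - h x) x + (conv \<nu> h x - h x)"
  have "(\<lambda>x. (step ^^ Suc n) f x - f ((\<phi> ^^ Suc n) x)) = (\<lambda>x. ?w (\<phi> x))"
    using g h by (simp add: step_def g_def[symmetric] h_def[symmetric] conv_diff funpow_swap1 fun_eq_iff)
  then have "norm_L2 (\<lambda>x. (step ^^ Suc n) f x - f ((\<phi> ^^ Suc n) x)) = norm_L2 ?w"
    using g h energy_\<phi>[of ?w] by (simp add: norm_L2_def)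
  also have "\<dots> \<le> norm_L2 (conv \<nu> (\<lambda>x. g x - h x)) + norm_L2 (\<lambda>x. conv \<nu> h x - h x)"
    using g h by (intro norm_L2_triangle) auto
  also have "norm_L2 (conv \<nu> (\<lambda>x. g x - h x)) \<le> norm_L2 (\<lambda>x. g x - h x)"
    using g h by (intro norm_L2_conv_le) auto
  finally show ?case using Suc.IH by (simp add: g_def h_def[abs_def])
qed

text \<open>As long as the noise, expanded by the map, has not reached the size of the torus, the
  process follows the deterministic orbit.\<close>

lemma norm_steps_character_ge:
  assumes k: "norm (int_vec k :: real^'n) = 1" and small: "(1 / smin) ^ n * \<epsilon> \<le> 1"
  shows "1 - keep_constant * sqrt ((1 / smin) ^ n * \<epsilon>) \<le> norm_L2 ((step ^^ n) (character k))"
proof -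
  define q where "q = sqrt (1 / smin)"
  have lam: "1 / smin > 1" using smin_bounds by simp
  then have q: "q > 1" by (simp add: q_def)
  define G where "G = 4 * pi\<^sup>2 + 8 * real CARD('n)"
  have G: "G \<ge> 0" by (simp add: G_def)
  have displacement: "norm_L2 (\<lambda>x. conv \<nu> (\<lambda>y. character k ((\<phi> ^^ j) y)) x - character k ((\<phi> ^^ j) x))
      \<le> sqrt (G * \<epsilon>) * q ^ j" if j: "j < n" for j
  proof -
    have "(1 / smin) ^ j * \<epsilon> \<le> (1 / smin) ^ n * \<epsilon>"
      using lam j \<epsilon> by (intro mult_right_mono power_increasing) auto
    then have sm: "(1 / smin) ^ j * \<epsilon> \<le> 1" using small by linarith
    have "energy (\<lambda>x. conv \<nu> (\<lambda>y. character k ((\<phi> ^^ j) y)) x - character k ((\<phi> ^^ j) x)) \<le> G * ((1 / smin) ^ j * \<epsilon>)"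
      unfolding G_def
      by (intro energy_conv_diff_le_variation[OF bounded_borel_\<phi>_funpow] AE_variation_le character_funpow_variation k sm)
        simp_all
    then have "sqrt (energy (\<lambda>x. conv \<nu> (\<lambda>y. character k ((\<phi> ^^ j) y)) x - character k ((\<phi> ^^ j) x))) \<le> sqrt (G * ((1 / smin) ^ j * \<epsilon>))"
      by (rule real_sqrt_le_mono)
    also have "\<dots> = sqrt (G * \<epsilon>) * q ^ j" by (simp add: q_def real_sqrt_mult real_sqrt_power mult_ac)
    finally show ?thesis by (simp add: norm_L2_def)
  qed
  have "norm_L2 (\<lambda>x. (step ^^ n) (character k) x - character k ((\<phi> ^^ n) x)) \<le> (\<Sum>j<n. sqrt (G * \<epsilon>) * q ^ j)"
    by (rule order_trans[OF steps_minus_funpow[OF bounded_borel_character]]) (intro sum_mono displacement, simp)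
  also have "\<dots> = sqrt (G * \<epsilon>) * ((q ^ n - 1) / (q - 1))"
    using q by (simp add: sum_distrib_left[symmetric] geometric_sum)
  also have "\<dots> \<le> sqrt (G * \<epsilon>) * (q ^ n / (q - 1))"
    using q G \<epsilon> by (intro mult_left_mono divide_right_mono) auto
  also have "\<dots> = keep_constant * sqrt ((1 / smin) ^ n * \<epsilon>)"
    by (simp add: keep_constant_def G_def q_def real_sqrt_mult real_sqrt_power)
  finally have d: "norm_L2 (\<lambda>x. (step ^^ n) (character k) x - character k ((\<phi> ^^ n) x)) \<le> keep_constant * sqrt ((1 / smin) ^ n * \<epsilon>)" .
  have "norm_L2 (\<lambda>x. character k ((\<phi> ^^ n) x)) = 1" by (simp add: norm_L2_def energy_def)
  moreover have "norm_L2 (\<lambda>x. character k ((\<phi> ^^ n) x))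
      \<le> norm_L2 ((step ^^ n) (character k)) + norm_L2 (\<lambda>x. character k ((\<phi> ^^ n) x) - (step ^^ n) (character k) x)"
    by (intro norm_L2_triangle_diff bounded_borel_\<phi>_funpow bounded_borel_steps bounded_borel_character)
  ultimately show ?thesis using d by (simp add: norm_L2_minus[of "\<lambda>x. character k ((\<phi> ^^ n) x)"])
qed

end

section \<open>The Markov process\<close>

definition noise_law :: "('n::finite torus \<Rightarrow> real) \<Rightarrow> 'n torus measure" where
  "noise_law K = density torus_measure (\<lambda>x. ennreal (K x))"

lemma markov_chain_cong:
  "(\<And>i. i \<in> {1..n} \<Longrightarrow> \<xi> i \<omega> = \<xi>' i \<omega>') \<Longrightarrow> markov_chain \<phi> \<xi> x n \<omega> = markov_chain \<phi> \<xi>' x n \<omega>'"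
  by (induction n) auto

lemma markov_chain_measurable:
  assumes \<phi>: "\<phi> \<in> borel_measurable borel" and \<xi>: "\<And>i. i \<in> {1..n} \<Longrightarrow> \<xi> i \<in> borel_measurable N"
  shows "(\<lambda>\<omega>. markov_chain \<phi> \<xi> x n \<omega>) \<in> borel_measurable N"
  using \<xi>
proof (induction n)
  case (Suc n)
  have "(\<lambda>\<omega>. \<phi> (markov_chain \<phi> \<xi> x n \<omega>)) \<in> borel_measurable N"
    using Suc by (intro measurable_compose[OF _ \<phi>]) auto
  moreover have "\<xi> (Suc n) \<in> borel_measurable N" using Suc.prems by simp
  ultimately show ?case by simp
next
  case 0
  have "(\<lambda>\<omega>. markov_chain \<phi> \<xi> x 0 \<omega>) = (\<lambda>_. x)" by auto
  then show ?case by (simp only: measurable_const space_borel UNIV_I)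
qed

locale bernoulli_process = bernoulli M E D e
  for M :: nat and E :: "nat \<Rightarrow> (real^'n::finite) set" and D :: "nat \<Rightarrow> real^'n^'n" and e :: "nat \<Rightarrow> real^'n" +
  fixes P :: "'w measure" and \<xi> :: "nat \<Rightarrow> 'w \<Rightarrow> 'n torus" and K :: "'n torus \<Rightarrow> real" and \<epsilon> :: real
  assumes noise: "noise_process P \<xi> K" and pos: "0 < \<epsilon>" and supp: "closure {x. K x \<noteq> 0} \<subseteq> ball 0 \<epsilon>"
begin

sublocale prob_P: prob_space P
  using noise by (simp add: noise_process_def)

lemma K_nonneg: "0 \<le> K x"
  using noise by (simp add: noise_process_def)

lemma \<xi>_distr: assumes "1 \<le> n" shows "\<xi> n \<in> borel_measurable P" "distr P borel (\<xi> n) = noise_law K"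
proof -
  have d: "distributed P torus_measure (\<xi> n) (\<lambda>x. ennreal (K x))"
    using noise assms by (simp add: noise_process_def)
  show "\<xi> n \<in> borel_measurable P"
    using distributed_measurable[OF d] by (simp cong: measurable_cong_sets)
  have "distr P borel (\<xi> n) = distr P torus_measure (\<xi> n)" by (rule distr_cong) simp_all
  then show "distr P borel (\<xi> n) = noise_law K" using distributed_distr_eq_density[OF d] by (simp add: noise_law_def)
qed

lemma K_measurable [measurable]: "K \<in> borel_measurable borel"
proof -
  have "distributed P torus_measure (\<xi> 1) (\<lambda>x. ennreal (K x))"
    using noise by (simp add: noise_process_def)
  then have "(\<lambda>x. ennreal (K x)) \<in> borel_measurable torus_measure" by (rule distributed_borel_measurable)
  then have "(\<lambda>x. enn2real (ennreal (K x))) \<in> borel_measurable borel" by simp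
  then show ?thesis by (simp add: K_nonneg)
qed

sublocale noisy_bernoulli M E D e "noise_law K" \<epsilon>
proof (intro noisy_bernoulli.intro torus_prob.intro bernoulli_axioms torus_prob_axioms.intro noisy_bernoulli_axioms.intro pos)
  have "prob_space (distr P borel (\<xi> 1))" by (rule prob_P.prob_space_distr) (rule \<xi>_distr, simp)
  then show "prob_space (noise_law K)" by (simp add: \<xi>_distr(2))
  show "sets (noise_law K) = sets borel" by (simp add: noise_law_def)
  show "AE z in noise_law K. dist z 0 < \<epsilon>"
  proof -
    have "dist z 0 < \<epsilon>" if "K z \<noteq> 0" for z
      using supp closure_subset[of "{x. K x \<noteq> 0}"] that by (auto simp: dist_commute)
    then have "0 < ennreal (K z) \<longrightarrow> dist z 0 < \<epsilon>" for z by (cases "K z = 0") auto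
    then show ?thesis unfolding noise_law_def by (subst AE_density) auto
  qed
qed

lemma noise_mean: "(\<integral>z. centered z \<partial>noise_law K) = 0"
proof -
  have "(\<integral>z. centered z \<partial>noise_law K) = (\<integral>\<omega>. centered (\<xi> 1 \<omega>) \<partial>P)"
    unfolding \<xi>_distr(2)[OF order_refl, symmetric]
    by (rule integral_distr) (use \<xi>_distr(1)[OF order_refl] in auto)
  then show ?thesis using noise by (simp add: noise_process_def)
qed

lemma norm_multiplier_eq: "norm (multiplier (noise_law K) k) = norm (fourier_coeff K k)"
proof -
  have "multiplier (noise_law K) (- k) = (\<integral>x. K x *\<^sub>R character (- k) x \<partial>torus_measure)"
    unfolding multiplier_def noise_law_def by (rule integral_density) (auto simp: K_nonneg)
  also have "\<dots> = fourier_coeff K k"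
    unfolding fourier_coeff_def
  proof (intro Bochner_Integration.integral_cong refl)
    fix x :: "'n torus"
    have "int_vec (- k) \<bullet> check x = - (int_vec k \<bullet> check x)" by (simp add: int_vec_def inner_vec_def sum_negf)
    then have "character (- k) x = exp (- 2 * of_real pi * \<i> * of_real (int_vec k \<bullet> check x))"
      by (simp add: character_def cis_conv_exp mult_ac)
    then show "K x *\<^sub>R character (- k) x = of_real (K x) * exp (- 2 * of_real pi * \<i> * of_real (int_vec k \<bullet> check x))"
      by (simp add: scaleR_conv_of_real)
  qed
  finally have 1: "multiplier (noise_law K) (- k) = fourier_coeff K k" .
  have "multiplier (noise_law K) (- k) = cnj (multiplier (noise_law K) k)"
    unfolding multiplier_def character_cnj[symmetric] by simp
  then show ?thesis using 1 by (metis complex_mod_cnj)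
qed

text \<open>The noise at time \<open>n + 1\<close> is independent of the position at time \<open>n\<close>.\<close>

lemma integral_markov_chain:
  assumes "bounded_borel f"
  shows "(\<integral>\<omega>. f (markov_chain \<phi> \<xi> x n \<omega>) \<partial>P) = (step ^^ n) f x"
  using assms
proof (induction n arbitrary: f)
  case 0 then show ?case by (simp add: prob_P.prob_space)
next
  case (Suc n)
  note [measurable] = bounded_borelD[OF Suc.prems]
  let ?X = "\<lambda>\<omega>. markov_chain \<phi> \<xi> x n \<omega>"
  define G where "G w = markov_chain \<phi> (\<lambda>i (_ :: unit). w i) x n ()" for w
  have X_meas [measurable]: "?X \<in> borel_measurable P"
    using \<xi>_distr(1) by (intro markov_chain_measurable \<phi>_measurable) auto
  have \<xi>_meas [measurable]: "\<xi> (Suc n) \<in> borel_measurable P" by (rule \<xi>_distr) simp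
  have G: "G \<in> borel_measurable (PiM {1..n} (\<lambda>_. borel))"
  proof -
    have "(\<lambda>w. markov_chain \<phi> (\<lambda>i w. w i) x n w) \<in> borel_measurable (PiM {1..n} (\<lambda>_. borel))"
      by (intro markov_chain_measurable \<phi>_measurable measurable_component_singleton)
    moreover have "markov_chain \<phi> (\<lambda>i w. w i) x n w = G w" for w
      unfolding G_def by (rule markov_chain_cong) simp
    ultimately show ?thesis by simp
  qed
  have "prob_P.indep_vars (\<lambda>_. borel) \<xi> {1..}" using noise by (simp add: noise_process_def)
  then have "prob_P.indep_var (PiM {1..n} (\<lambda>_. borel)) (\<lambda>\<omega>. restrict (\<lambda>i. \<xi> i \<omega>) {1..n})
      (PiM {Suc n} (\<lambda>_. borel)) (\<lambda>\<omega>. restrict (\<lambda>i. \<xi> i \<omega>) {Suc n})"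
    by (rule prob_P.indep_var_restrict) auto
  then have "prob_P.indep_var borel (G \<circ> (\<lambda>\<omega>. restrict (\<lambda>i. \<xi> i \<omega>) {1..n}))
      borel ((\<lambda>w. w (Suc n)) \<circ> (\<lambda>\<omega>. restrict (\<lambda>i. \<xi> i \<omega>) {Suc n}))"
    by (rule prob_P.indep_var_compose) (use G in auto)
  moreover have "G \<circ> (\<lambda>\<omega>. restrict (\<lambda>i. \<xi> i \<omega>) {1..n}) = ?X"
  proof
    fix \<omega>
    show "(G \<circ> (\<lambda>\<omega>. restrict (\<lambda>i. \<xi> i \<omega>) {1..n})) \<omega> = ?X \<omega>"
      unfolding G_def comp_def by (rule markov_chain_cong) simp
  qed
  moreover have "(\<lambda>w. w (Suc n)) \<circ> (\<lambda>\<omega>. restrict (\<lambda>i. \<xi> i \<omega>) {Suc n}) = \<xi> (Suc n)" by (auto simp: comp_def)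
  ultimately have "prob_P.indep_var borel ?X borel (\<xi> (Suc n))" by (simp only:)
  then have joint: "distr P borel ?X \<Otimes>\<^sub>M noise_law K = distr P (borel \<Otimes>\<^sub>M borel) (\<lambda>\<omega>. (?X \<omega>, \<xi> (Suc n) \<omega>))"
    by (simp add: prob_P.indep_var_distribution_eq \<xi>_distr(2))
  interpret X: prob_space "distr P borel ?X" by (rule prob_P.prob_space_distr) measurable
  interpret XN: pair_prob_space "distr P borel ?X" "noise_law K" ..
  have meas: "(\<lambda>(a, z). f (\<phi> a + z)) \<in> borel_measurable (borel \<Otimes>\<^sub>M borel)" by measurable
  obtain B where B: "\<And>x. norm (f x) \<le> B" using bounded_borelE[OF Suc.prems] by blast
  have "(\<integral>\<omega>. f (markov_chain \<phi> \<xi> x (Suc n) \<omega>) \<partial>P)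
      = (\<integral>p. (\<lambda>(a, z). f (\<phi> a + z)) p \<partial>distr P (borel \<Otimes>\<^sub>M borel) (\<lambda>\<omega>. (?X \<omega>, \<xi> (Suc n) \<omega>)))"
    by (subst integral_distr[OF _ meas]) auto
  also have "\<dots> = (\<integral>p. (\<lambda>(a, z). f (\<phi> a + z)) p \<partial>(distr P borel ?X \<Otimes>\<^sub>M noise_law K))" by (simp only: joint)
  also have "\<dots> = (\<integral>a. (\<integral>z. f (\<phi> a + z) \<partial>noise_law K) \<partial>distr P borel ?X)"
  proof -
    have "(\<lambda>(a, z). f (\<phi> a + z)) \<in> borel_measurable (distr P borel ?X \<Otimes>\<^sub>M noise_law K)"
      using meas by (simp cong: measurable_cong_sets sets_pair_measure_cong)
    then have "integrable (distr P borel ?X \<Otimes>\<^sub>M noise_law K) (\<lambda>(a, z). f (\<phi> a + z))"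
      using B by (intro XN.integrable_const_bound[of _ B]) auto
    then show ?thesis using XN.integral_fst'[of "\<lambda>(a, z). f (\<phi> a + z)"] by simp
  qed
  also have "\<dots> = (\<integral>a. step f a \<partial>distr P borel ?X)" by (simp add: step_def conv_def)
  also have "\<dots> = (\<integral>\<omega>. step f (?X \<omega>) \<partial>P)"
    using bounded_borelD[OF bounded_borel_step[OF Suc.prems]] by (intro integral_distr) auto
  also have "\<dots> = (step ^^ n) (step f) x" by (intro Suc.IH bounded_borel_step Suc.prems)
  finally show ?case by (simp add: funpow_swap1)
qed

lemma chain_measurable [measurable]: "(\<lambda>\<omega>. markov_chain \<phi> \<xi> x n \<omega>) \<in> borel_measurable P"
  using \<xi>_distr(1) by (intro markov_chain_measurable \<phi>_measurable) auto

lemma integrable_chain: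
  fixes f :: "'n torus \<Rightarrow> 'c::{banach, second_countable_topology}"
  shows "bounded_borel f \<Longrightarrow> integrable P (\<lambda>\<omega>. f (markov_chain \<phi> \<xi> x n \<omega>))"
  by (rule prob_P.integrable_bounded_borel) measurable

lemma evolve_Re_Im:
  assumes f: "bounded_borel f"
  shows "evolve P \<phi> \<xi> (\<lambda>x. Re (f x)) n x = Re ((step ^^ n) f x)" "evolve P \<phi> \<xi> (\<lambda>x. Im (f x)) n x = Im ((step ^^ n) f x)"
  unfolding evolve_def integral_markov_chain[OF f, symmetric] using integrable_chain[OF f] by simp_all

lemma evolve_bounded:
  assumes \<theta>: "bounded_borel \<theta>"
  shows "complex_of_real (evolve P \<phi> \<xi> \<theta> n x) = (step ^^ n) (\<lambda>x. complex_of_real (\<theta> x)) x"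
  unfolding evolve_def using integral_markov_chain[of "\<lambda>x. complex_of_real (\<theta> x)" x n] \<theta> by auto

definition dissipated :: "real \<Rightarrow> nat \<Rightarrow> bool" where
  "dissipated \<delta> n \<longleftrightarrow> (\<forall>\<theta>\<in>L2_mean_zero. L2_norm (evolve P \<phi> \<xi> \<theta> n) \<le> \<delta> * L2_norm \<theta>)"

text \<open>Bounded functions suffice: the truncations of \<open>\<theta>\<close>, corrected by their means, evolve to
  functions that converge to the evolution of \<open>\<theta>\<close> wherever the defining integral exists. Elsewhere
  that integral has the value \<open>0\<close>. Hence Fatou's lemma applies at every point.\<close>

lemma dissipatedI:
  assumes \<delta>: "0 \<le> \<delta>"
    and bounded: "\<And>f. bounded_borel f \<Longrightarrow> (\<integral>x. f x \<partial>torus_measure) = 0 \<Longrightarrow> energy ((step ^^ n) f) \<le> \<delta>\<^sup>2 * energy f"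
  shows "dissipated \<delta> n"
  unfolding dissipated_def
proof
  fix \<theta> :: "'n torus \<Rightarrow> real" assume "\<theta> \<in> L2_mean_zero"
  then have [measurable]: "\<theta> \<in> borel_measurable borel"
    and sq: "integrable torus_measure (\<lambda>x. (\<theta> x)\<^sup>2)" and mean: "(\<integral>x. \<theta> x \<partial>torus_measure) = 0"
    by (auto simp: L2_mean_zero_def)
  define I where "I = (\<integral>x. (\<theta> x)\<^sup>2 \<partial>torus_measure)"
  have I: "I \<ge> 0" by (simp add: I_def)
  have int\<theta>: "integrable torus_measure \<theta>"
  proof (rule Bochner_Integration.integrable_bound)
    show "integrable torus_measure (\<lambda>x. 1 + (\<theta> x)\<^sup>2)" using sq by simp
    show "AE x in torus_measure. norm (\<theta> x) \<le> norm (1 + (\<theta> x)\<^sup>2)"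
    proof (rule AE_I2)
      fix x
      have "0 \<le> (\<bar>\<theta> x\<bar> - 1/2)\<^sup>2" by simp
      then have "\<bar>\<theta> x\<bar> \<le> 1 + (\<theta> x)\<^sup>2" by (simp add: power2_diff power_divide)
      then show "norm (\<theta> x) \<le> norm (1 + (\<theta> x)\<^sup>2)" by simp
    qed
  qed simp
  define t where "t m x = max (- real m) (min (\<theta> x) (real m))" for m x
  have t_le: "\<bar>t m x\<bar> \<le> \<bar>\<theta> x\<bar>" "\<bar>t m x\<bar> \<le> real m" for m x by (auto simp: t_def)
  have [measurable]: "t m \<in> borel_measurable borel" for m unfolding t_def by measurable
  have bt: "bounded_borel (t m)" for m by (rule bounded_borelI[of _ "real m"]) (use t_le in auto)
  have t_lim: "(\<lambda>m. t m x) \<longlonglongrightarrow> \<theta> x" for x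
  proof -
    obtain m0 where m0: "\<bar>\<theta> x\<bar> \<le> real m0" using real_arch_simple by blast
    have "t m x = \<theta> x" if "m \<ge> m0" for m
    proof -
      have "real m0 \<le> real m" using that by simp
      then show ?thesis using m0 by (auto simp: t_def min_def max_def)
    qed
    then show ?thesis by (intro tendsto_eventually) (auto simp: eventually_sequentially)
  qed
  define c where "c m = (\<integral>x. t m x \<partial>torus_measure)" for m
  have c_lim: "c \<longlonglongrightarrow> 0"
  proof -
    have "(\<lambda>m. \<integral>x. t m x \<partial>torus_measure) \<longlonglongrightarrow> (\<integral>x. \<theta> x \<partial>torus_measure)"
      using int\<theta> t_lim t_le by (intro integral_dominated_convergence[where w = "\<lambda>x. \<bar>\<theta> x\<bar>"]) auto
    then show ?thesis by (simp add: c_def[abs_def] mean)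
  qed
  define u where "u m x = evolve P \<phi> \<xi> (t m) n x - c m" for m x
  have u_step: "complex_of_real (u m x) = (step ^^ n) (\<lambda>x. complex_of_real (t m x - c m)) x" for m x
  proof -
    have "evolve P \<phi> \<xi> (\<lambda>x. t m x - c m) n x = u m x"
      unfolding evolve_def u_def using integrable_chain[OF bt] by (simp add: prob_P.prob_space)
    then show ?thesis using evolve_bounded[of "\<lambda>x. t m x - c m" n x] bt by auto
  qed
  have u_meas [measurable]: "u m \<in> borel_measurable borel" for m
  proof -
    have "bounded_borel ((step ^^ n) (\<lambda>x. complex_of_real (t m x - c m)))"
      using bt by (intro bounded_borel_steps bounded_borel_of_real bounded_borel_diff) auto
    then have "(\<lambda>x. Re ((step ^^ n) (\<lambda>x. complex_of_real (t m x - c m)) x)) \<in> borel_measurable borel"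
      by (intro bounded_borelD bounded_borel_Re_Im)
    moreover have "Re ((step ^^ n) (\<lambda>x. complex_of_real (t m x - c m)) x) = u m x" for x
      unfolding u_step[symmetric] by simp
    ultimately show ?thesis by simp
  qed
  have u_int: "(\<integral>\<^sup>+x. ennreal ((u m x)\<^sup>2) \<partial>torus_measure) \<le> ennreal (\<delta>\<^sup>2 * I)" for m
  proof -
    let ?f = "\<lambda>x. complex_of_real (t m x - c m)"
    have bf: "bounded_borel ?f" using bt by (intro bounded_borel_of_real bounded_borel_diff) auto
    have "(\<integral>x. ?f x \<partial>torus_measure) = complex_of_real (\<integral>x. t m x - c m \<partial>torus_measure)"
      by (rule integral_complex_of_real)
    also have "(\<integral>x. t m x - c m \<partial>torus_measure) = 0" using integrable_torus[OF bt[of m]] by (simp add: c_def)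
    finally have "energy ((step ^^ n) ?f) \<le> \<delta>\<^sup>2 * energy ?f" using bounded[OF bf] by simp
    also have "energy ?f \<le> I"
    proof -
      have "energy ?f = (\<integral>x. (t m x)\<^sup>2 - 2 * c m * t m x + (c m)\<^sup>2 \<partial>torus_measure)"
        unfolding energy_def by (simp add: power2_diff norm_of_real del: of_real_diff) (simp add: algebra_simps)
      also have "\<dots> = (\<integral>x. (t m x)\<^sup>2 \<partial>torus_measure) - (c m)\<^sup>2"
        using bt[of m] by (simp add: c_def[symmetric] power2_eq_square)
      also have "\<dots> \<le> (\<integral>x. (t m x)\<^sup>2 \<partial>torus_measure)" by simp
      also have "\<dots> \<le> I"
        unfolding I_def using bt[of m] sq t_le(1) by (intro integral_mono) (auto simp: abs_le_square_iff)
      finally show ?thesis .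
    qed
    finally have le: "energy ((step ^^ n) ?f) \<le> \<delta>\<^sup>2 * I" by (simp add: mult_left_mono)
    have "energy ((step ^^ n) ?f) = (\<integral>x. (u m x)\<^sup>2 \<partial>torus_measure)"
      unfolding energy_def u_step[symmetric] by (simp add: norm_of_real)
    moreover have "integrable torus_measure (\<lambda>x. (u m x)\<^sup>2)"
    proof -
      have "bounded_borel (\<lambda>x. (norm ((step ^^ n) ?f x))\<^sup>2)" using bf by auto
      then show ?thesis unfolding u_step[symmetric] by (simp add: norm_of_real)
    qed
    ultimately show ?thesis using le by (subst nn_integral_eq_integral) (auto intro: ennreal_leI)
  qed
  have pointwise: "ennreal ((evolve P \<phi> \<xi> \<theta> n x)\<^sup>2) \<le> liminf (\<lambda>m. ennreal ((u m x)\<^sup>2))" for x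
  proof (cases "integrable P (\<lambda>\<omega>. \<theta> (markov_chain \<phi> \<xi> x n \<omega>))")
    case True
    have "(\<lambda>m. evolve P \<phi> \<xi> (t m) n x) \<longlonglongrightarrow> evolve P \<phi> \<xi> \<theta> n x"
      unfolding evolve_def
    proof (rule integral_dominated_convergence[where w = "\<lambda>\<omega>. \<bar>\<theta> (markov_chain \<phi> \<xi> x n \<omega>)\<bar>"])
      show "integrable P (\<lambda>\<omega>. \<bar>\<theta> (markov_chain \<phi> \<xi> x n \<omega>)\<bar>)" using True by simp
    qed (use t_lim t_le in auto)
    then have "(\<lambda>m. u m x) \<longlonglongrightarrow> evolve P \<phi> \<xi> \<theta> n x"
      unfolding u_def using tendsto_diff[OF _ c_lim] by fastforce
    then have "(\<lambda>m. ennreal ((u m x)\<^sup>2)) \<longlonglongrightarrow> ennreal ((evolve P \<phi> \<xi> \<theta> n x)\<^sup>2)"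
      by (intro tendsto_ennrealI tendsto_power)
    then have "liminf (\<lambda>m. ennreal ((u m x)\<^sup>2)) = ennreal ((evolve P \<phi> \<xi> \<theta> n x)\<^sup>2)"
      by (rule lim_imp_Liminf[OF sequentially_bot])
    then show ?thesis by (rule eq_refl[OF sym])
  next
    case False
    then show ?thesis by (simp add: evolve_def not_integrable_integral_eq)
  qed
  have "(\<integral>\<^sup>+x. ennreal ((evolve P \<phi> \<xi> \<theta> n x)\<^sup>2) \<partial>torus_measure) \<le> (\<integral>\<^sup>+x. liminf (\<lambda>m. ennreal ((u m x)\<^sup>2)) \<partial>torus_measure)"
    by (intro nn_integral_mono pointwise)
  also have "\<dots> \<le> liminf (\<lambda>m. \<integral>\<^sup>+x. ennreal ((u m x)\<^sup>2) \<partial>torus_measure)"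
    by (rule nn_integral_liminf) measurable
  also have "\<dots> \<le> ennreal (\<delta>\<^sup>2 * I)"
    by (rule order_trans[OF Liminf_le_Limsup Limsup_bounded]) (use u_int in auto)
  finally have fin: "(\<integral>\<^sup>+x. ennreal ((evolve P \<phi> \<xi> \<theta> n x)\<^sup>2) \<partial>torus_measure) \<le> ennreal (\<delta>\<^sup>2 * I)" .
  have "(\<integral>x. (evolve P \<phi> \<xi> \<theta> n x)\<^sup>2 \<partial>torus_measure) \<le> \<delta>\<^sup>2 * I"
  proof (cases "integrable torus_measure (\<lambda>x. (evolve P \<phi> \<xi> \<theta> n x)\<^sup>2)")
    case True
    then have "ennreal (\<integral>x. (evolve P \<phi> \<xi> \<theta> n x)\<^sup>2 \<partial>torus_measure) \<le> ennreal (\<delta>\<^sup>2 * I)"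
      using fin by (subst (asm) nn_integral_eq_integral) auto
    then show ?thesis using I by (simp add: ennreal_le_iff)
  next
    case False then show ?thesis using I by (simp add: not_integrable_integral_eq)
  qed
  then have "L2_norm (evolve P \<phi> \<xi> \<theta> n) \<le> sqrt (\<delta>\<^sup>2 * I)" unfolding L2_norm_def by (rule real_sqrt_le_mono)
  then show "L2_norm (evolve P \<phi> \<xi> \<theta> n) \<le> \<delta> * L2_norm \<theta>" using \<delta> by (simp add: real_sqrt_mult L2_norm_def I_def)
qed

lemma dissipatedD:
  assumes d: "dissipated \<delta> n" and \<delta>: "0 \<le> \<delta>" and f: "bounded_borel f" and mean: "(\<integral>x. f x \<partial>torus_measure) = 0"
  shows "norm_L2 ((step ^^ n) f) \<le> \<delta> * norm_L2 f"
proof -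
  define g where "g = (step ^^ n) f"
  have g: "bounded_borel g" using f by (simp add: g_def)
  have split: "energy h = (\<integral>x. (Re (h x))\<^sup>2 \<partial>torus_measure) + (\<integral>x. (Im (h x))\<^sup>2 \<partial>torus_measure)" if "bounded_borel h" for h :: "'n torus \<Rightarrow> complex"
    unfolding energy_def cmod_power2
    by (rule Bochner_Integration.integral_add; rule integrable_torus; rule bounded_borel_power)
      (rule bounded_borel_Re_Im[OF that])+
  have real: "(\<integral>x. (evolve P \<phi> \<xi> \<theta> n x)\<^sup>2 \<partial>torus_measure) \<le> \<delta>\<^sup>2 * (\<integral>x. (\<theta> x)\<^sup>2 \<partial>torus_measure)"
    if \<theta>: "bounded_borel \<theta>" "(\<integral>x. \<theta> x \<partial>torus_measure) = 0" for \<theta>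
  proof -
    have "\<theta> \<in> L2_mean_zero"
      using \<theta> bounded_borelD[OF \<theta>(1)] by (auto simp: L2_mean_zero_def)
    then have "L2_norm (evolve P \<phi> \<xi> \<theta> n) \<le> \<delta> * L2_norm \<theta>" using d by (simp add: dissipated_def)
    then have "(L2_norm (evolve P \<phi> \<xi> \<theta> n))\<^sup>2 \<le> (\<delta> * L2_norm \<theta>)\<^sup>2"
      by (intro power_mono) (auto simp: L2_norm_def)
    then show ?thesis by (simp add: L2_norm_def power_mult_distrib)
  qed
  have "(\<integral>x. Re (f x) \<partial>torus_measure) = 0" "(\<integral>x. Im (f x) \<partial>torus_measure) = 0"
    using f mean by simp_all
  then have "(\<integral>x. (Re (g x))\<^sup>2 \<partial>torus_measure) \<le> \<delta>\<^sup>2 * (\<integral>x. (Re (f x))\<^sup>2 \<partial>torus_measure)"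
    "(\<integral>x. (Im (g x))\<^sup>2 \<partial>torus_measure) \<le> \<delta>\<^sup>2 * (\<integral>x. (Im (f x))\<^sup>2 \<partial>torus_measure)"
    using real[of "\<lambda>x. Re (f x)"] real[of "\<lambda>x. Im (f x)"] f by (simp_all add: evolve_Re_Im g_def)
  then have "energy g \<le> \<delta>\<^sup>2 * energy f" using f g by (simp add: split distrib_left)
  then have "sqrt (energy g) \<le> sqrt (\<delta>\<^sup>2 * energy f)" by (rule real_sqrt_le_mono)
  then show ?thesis using \<delta> by (simp add: norm_L2_def real_sqrt_mult g_def)
qed

lemma dissipation_time_le: "dissipated \<delta> n \<Longrightarrow> ereal_of_enat (dissipation_time P \<phi> \<xi> \<delta>) \<le> ereal (real n)"
proof -
  assume "dissipated \<delta> n"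
  then have "dissipation_time P \<phi> \<xi> \<delta> \<le> enat n"
    unfolding dissipation_time_def dissipated_def by (intro Inf_lower) auto
  then have "ereal_of_enat (dissipation_time P \<phi> \<xi> \<delta>) \<le> ereal_of_enat (enat n)" by (simp only: ereal_of_enat_le_iff)
  then show ?thesis by simp
qed

lemma dissipation_time_ge:
  assumes "\<And>n. dissipated \<delta> n \<Longrightarrow> b \<le> real n"
  shows "ereal b \<le> ereal_of_enat (dissipation_time P \<phi> \<xi> \<delta>)"
proof (cases "dissipation_time P \<phi> \<xi> \<delta>")
  case (enat n)
  let ?S = "enat ` {n. dissipated \<delta> n}"
  have eq: "Inf ?S = enat n" using enat unfolding dissipation_time_def dissipated_def .
  have "?S \<noteq> {}"
  proof
    assume "?S = {}"
    then have "Inf ?S = \<infinity>" by (simp add: Inf_enat_def)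
    then show False using eq by simp
  qed
  then obtain k where "k \<in> ?S" by blast
  then have "Inf ?S \<in> ?S" by (rule wellorder_InfI)
  then have "dissipated \<delta> n" unfolding eq by auto
  then show ?thesis using assms enat by simp
qed simp

end

section \<open>Bounds on the dissipation time\<close>

context bernoulli
begin

lemma ln_smin: "ln smin = ln (p_min M E) / real CARD('n)" and ln_smax: "ln smax = ln (p_max M E) / real CARD('n)"
  using p_min_pos p_max_pos by (simp_all add: smin_def smax_def ln_powr)

text \<open>Expansion by \<open>1 / smin\<close> enlarges \<open>\<epsilon>\<close> to \<open>((1 - \<delta>) / max keep_constant 1)\<^sup>2\<close> in \<open>ln \<epsilon> / ln smin\<close>
  steps, up to a correction of at most \<open>lower_constant * (1 + |ln (1 - \<delta>)|)\<close>.\<close>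

definition lower_constant :: real where
  "lower_constant = (2 + 2 * ln (max keep_constant 1)) / - ln smin"

end

context bernoulli_process
begin

lemma dissipated_lower_bound:
  assumes \<delta>: "0 < \<delta>" "\<delta> < 1" and d: "dissipated \<delta> n"
  shows "real CARD('n) * ln \<epsilon> / ln (p_min M E) - lower_constant * (1 + \<bar>ln (1 - \<delta>)\<bar>) \<le> real n"
proof -
  define H where "H = max keep_constant 1"
  have H: "H \<ge> 1" "keep_constant \<le> H" by (auto simp: H_def)
  define b where "b = (1 - \<delta>) / H"
  have b: "0 < b" "b \<le> 1" using \<delta> H by (auto simp: b_def)
  define L where "L = (1 / smin) ^ n * \<epsilon>"
  have L: "L > 0" using \<epsilon> smin_bounds by (simp add: L_def)
  have "b\<^sup>2 \<le> L"
  proof (cases "L \<le> 1")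
    case True
    define k :: "int^'n" where "k = axis undefined 1"
    have "int_vec k = (axis undefined 1 :: real^'n)" by (simp add: k_def int_vec_def axis_def vec_eq_iff)
    then have k: "norm (int_vec k :: real^'n) = 1" by simp
    then have "k \<noteq> 0" by (auto simp: int_vec_def vec_eq_iff[of "\<chi> i. 0" 0] zero_vec_def[symmetric])
    then have "norm_L2 ((step ^^ n) (character k)) \<le> \<delta> * norm_L2 (character k)"
      using \<delta> by (intro dissipatedD[OF d]) (auto simp: integral_character_nonzero)
    moreover have "norm_L2 (character k) = 1" by (simp add: norm_L2_def energy_def)
    moreover have "1 - keep_constant * sqrt L \<le> norm_L2 ((step ^^ n) (character k))"
      using norm_steps_character_ge[OF k, of n] True by (simp add: L_def)
    ultimately have "1 - \<delta> \<le> keep_constant * sqrt L" by simp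
    also have "\<dots> \<le> H * sqrt L" using H L by (intro mult_right_mono) auto
    finally have "b \<le> sqrt L" using H by (simp add: b_def pos_divide_le_eq mult.commute)
    then have "b\<^sup>2 \<le> (sqrt L)\<^sup>2" using b by (intro power_mono) auto
    then show ?thesis using L by simp
  next
    case False
    have "b\<^sup>2 \<le> 1" using b by (simp add: power_le_one)
    then show ?thesis using False by linarith
  qed
  then have "ln (b\<^sup>2) \<le> ln L" using b L by simp
  moreover have "ln (b\<^sup>2) = 2 * (ln (1 - \<delta>) - ln H)"
    using b \<delta> H by (simp add: ln_realpow b_def ln_div)
  moreover have "ln L = - real n * ln smin + ln \<epsilon>"
    using \<epsilon> smin_bounds by (simp add: L_def ln_mult ln_realpow ln_div)
  ultimately have main: "2 * ln (1 - \<delta>) - 2 * ln H - ln \<epsilon> \<le> real n * - ln smin" by simp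
  have ls: "- ln smin > 0" using smin_bounds by simp
  have "lower_constant * (1 + \<bar>ln (1 - \<delta>)\<bar>) * - ln smin = (2 + 2 * ln H) * (1 + \<bar>ln (1 - \<delta>)\<bar>)"
    using ls by (simp add: lower_constant_def H_def)
  also have "\<dots> \<ge> 2 * ln H - 2 * ln (1 - \<delta>)"
  proof -
    have "0 \<le> ln H * \<bar>ln (1 - \<delta>)\<bar>" using H by (intro mult_nonneg_nonneg) auto
    then show ?thesis by (simp add: algebra_simps)
  qed
  finally have "- ln \<epsilon> - lower_constant * (1 + \<bar>ln (1 - \<delta>)\<bar>) * - ln smin \<le> real n * - ln smin"
    using main by linarith
  moreover have "real CARD('n) * ln \<epsilon> / ln (p_min M E) * - ln smin = - ln \<epsilon>"
    using p_min_pos p_min_less by (simp add: ln_smin)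
  ultimately have "(real CARD('n) * ln \<epsilon> / ln (p_min M E) - lower_constant * (1 + \<bar>ln (1 - \<delta>)\<bar>)) * - ln smin \<le> real n * - ln smin"
    by (simp add: algebra_simps)
  then show ?thesis using ls by (simp only: mult_le_cancel_right_pos)
qed

end

context bernoulli
begin

definition decay_constant :: "real \<Rightarrow> real" where
  "decay_constant \<rho> = ((2 * (2 / (1 - \<rho>\<^sup>2) * sqrt (8 * real CARD('n) / smin)) / sqrt smax + 3 / sqrt (1 - \<rho>\<^sup>2)) / (1 - sqrt smax))\<^sup>2"

definition upper_constant :: "real \<Rightarrow> real" where
  "upper_constant \<rho> = 2 + 4 * decay_constant \<rho> + decay_constant \<rho> / ln 2"

lemma decay_constant_nonneg: "0 \<le> decay_constant \<rho>"
  by (simp add: decay_constant_def)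

end

lemma inverse_square_le:
  fixes \<delta> :: real
  assumes "0 < \<delta>" "\<delta> < 1"
  shows "1 / \<delta>\<^sup>2 \<le> 4 + \<bar>ln \<delta>\<bar> / \<delta>\<^sup>2 / ln 2"
proof (cases "\<delta> \<le> 1 / 2")
  case True
  then have "ln \<delta> \<le> ln (1 / 2)" using assms by simp
  then have "ln 2 \<le> \<bar>ln \<delta>\<bar>" by (simp add: ln_div)
  then have "1 \<le> \<bar>ln \<delta>\<bar> / ln 2" by simp
  then have "1 / \<delta>\<^sup>2 \<le> \<bar>ln \<delta>\<bar> / ln 2 / \<delta>\<^sup>2" by (intro divide_right_mono) auto
  then show ?thesis by (simp add: mult.commute)
next
  case False
  then have "(1/2)\<^sup>2 \<le> \<delta>\<^sup>2" by (intro power_mono) auto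
  then have "1 / \<delta>\<^sup>2 \<le> 4" using assms by (simp add: field_simps power2_eq_square)
  moreover have "0 \<le> \<bar>ln \<delta>\<bar> / \<delta>\<^sup>2 / ln 2" by simp
  ultimately show ?thesis by linarith
qed

context bernoulli_process
begin

text \<open>The cylinders of length \<open>N\<close> have sides of at most \<open>\<epsilon>\<close>, and after \<open>N + k\<close> steps the energy is at most
  the fraction \<open>decay_constant \<rho> / (k + 1)\<close>, which is below \<open>\<delta>\<^sup>2\<close> for \<open>k\<close> of order \<open>1 / \<delta>\<^sup>2\<close>.\<close>

lemma dissipation_time_upper_bound:
  assumes c: "0 < c" "2 * pi * c \<le> 1" "low_constant * c\<^sup>2 \<le> 1 / 4"
    and gap: "\<And>k. norm (int_vec k :: real^'n) > c / \<epsilon> \<Longrightarrow> norm (fourier_coeff K k) \<le> \<rho>" "0 \<le> \<rho>" "\<rho> < 1"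
    and small: "sqrt (real CARD('n)) * \<epsilon> < 1 / 4" and \<delta>: "0 < \<delta>" "\<delta> < 1"
  shows "ereal_of_enat (dissipation_time P \<phi> \<xi> \<delta>)
    \<le> ereal (real CARD('n) * ln \<epsilon> / ln (p_max M E) + upper_constant \<rho> * (1 + \<bar>ln \<delta>\<bar> / \<delta>\<^sup>2))"
proof -
  have gap': "norm (multiplier (noise_law K) k) \<le> \<rho>" if "norm (int_vec k :: real^'n) > c / \<epsilon>" for k
    using gap(1)[OF that] by (simp add: norm_multiplier_eq)
  have \<rho>: "0 < 1 - \<rho>\<^sup>2" using gap(2,3) by (simp add: abs_square_less_1)
  note small4 = small_\<epsilon>(1)[OF small]
  define N where "N = nat \<lceil>ln \<epsilon> / ln smax\<rceil>"
  have lneg: "ln smax < 0" "ln \<epsilon> < 0" using smax_bounds \<epsilon> small4 by auto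
  then have ratio: "0 < ln \<epsilon> / ln smax" by (simp add: divide_neg_neg)
  have N: "smax ^ N \<le> \<epsilon>"
  proof -
    have "ln \<epsilon> / ln smax \<le> real N" unfolding N_def by linarith
    then have "real N * ln smax \<le> ln \<epsilon>" using lneg by (simp add: neg_divide_le_eq)
    then have "ln (smax ^ N) \<le> ln \<epsilon>" using smax_bounds by (simp add: ln_realpow)
    then show ?thesis using smax_bounds \<epsilon> by simp
  qed
  have N_le: "real N \<le> ln \<epsilon> / ln smax + 1" unfolding N_def using ratio by linarith
  define R where "R = decay_constant \<rho>"
  define k where "k = nat \<lceil>R / \<delta>\<^sup>2\<rceil>"
  have R: "R \<ge> 0" by (simp add: R_def decay_constant_nonneg)
  have R\<delta>: "0 \<le> R / \<delta>\<^sup>2" using R by simp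
  have k_ge: "R / \<delta>\<^sup>2 \<le> real k" and k_le: "real k \<le> R / \<delta>\<^sup>2 + 1"
    unfolding k_def using R\<delta> by linarith+
  have "dissipated \<delta> (N + k)"
  proof (rule dissipatedI)
    fix f :: "'n torus \<Rightarrow> complex" assume f: "bounded_borel f" "(\<integral>x. f x \<partial>torus_measure) = 0"
    have B: "norm (multiplier (noise_law K) k - 1) \<le> 2 / (1 - \<rho>\<^sup>2) * (1 - (norm (multiplier (noise_law K) k))\<^sup>2)" for k
      using small4
      by (intro multiplier_displacement_bound[OF noise_small \<epsilon> _ noise_mean c(2) gap' gap(2,3)]) auto
    have "real (Suc k) * energy ((step ^^ (N + k)) f) \<le> R * energy f"
      unfolding R_def decay_constant_def
      using \<rho> by (intro energy_decay[OF B _ c(1,3) gap' gap(2,3) N small f]) auto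
    also have "R * energy f \<le> (\<delta>\<^sup>2 * real (Suc k)) * energy f"
    proof (rule mult_right_mono)
      have "R \<le> real k * \<delta>\<^sup>2" using k_ge \<delta> by (simp add: pos_divide_le_eq)
      also have "\<dots> \<le> \<delta>\<^sup>2 * real (Suc k)" by (simp add: algebra_simps)
      finally show "R \<le> \<delta>\<^sup>2 * real (Suc k)" .
    qed simp
    finally have "real (Suc k) * energy ((step ^^ (N + k)) f) \<le> real (Suc k) * (\<delta>\<^sup>2 * energy f)" by (simp add: mult_ac)
    then show "energy ((step ^^ (N + k)) f) \<le> \<delta>\<^sup>2 * energy f" by (simp only: mult_le_cancel_left_pos of_nat_0_less_iff zero_less_Suc)
  qed (use \<delta> in simp)
  then have "ereal_of_enat (dissipation_time P \<phi> \<xi> \<delta>) \<le> ereal (real (N + k))" by (rule dissipation_time_le)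
  also have "real (N + k) \<le> real CARD('n) * ln \<epsilon> / ln (p_max M E) + upper_constant \<rho> * (1 + \<bar>ln \<delta>\<bar> / \<delta>\<^sup>2)"
  proof -
    define w where "w = \<bar>ln \<delta>\<bar> / \<delta>\<^sup>2"
    have w: "0 \<le> w" by (simp add: w_def)
    have "R * (1 / \<delta>\<^sup>2) \<le> R * (4 + w / ln 2)"
      unfolding w_def by (intro mult_left_mono inverse_square_le \<delta> R)
    moreover have "2 + R * (4 + w / ln 2) \<le> upper_constant \<rho> * (1 + w)"
    proof -
      have "0 \<le> R / ln 2" "0 \<le> (2 + 4 * R) * w" using R w by auto
      moreover have "upper_constant \<rho> * (1 + w) = 2 + R * (4 + w / ln 2) + (2 + 4 * R) * w + R / ln 2"
        by (simp add: upper_constant_def R_def[symmetric] add_divide_distrib algebra_simps)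
      ultimately show ?thesis by linarith
    qed
    ultimately have "real (N + k) \<le> ln \<epsilon> / ln smax + upper_constant \<rho> * (1 + w)"
      using N_le k_le by simp
    moreover have "ln \<epsilon> / ln smax = real CARD('n) * ln \<epsilon> / ln (p_max M E)"
      by (simp add: ln_smax mult.commute)
    ultimately show ?thesis by (simp add: w_def)
  qed
  finally show ?thesis by simp
qed

lemma norm_fourier_coeff_le: "norm (fourier_coeff K k) \<le> 1"
  using norm_multiplier_le[of k] by (simp add: norm_multiplier_eq)

end

theorem theorem1p5:
  fixes M :: nat
    and E :: "nat \<Rightarrow> (real^'n::finite) set"
    and D :: "nat \<Rightarrow> real^'n^'n"
    and e :: "nat \<Rightarrow> real^'n"
    and P :: "real \<Rightarrow> 'w measure"
    and \<xi> :: "real \<Rightarrow> nat \<Rightarrow> 'w \<Rightarrow> 'n torus"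
    and K :: "real \<Rightarrow> 'n torus \<Rightarrow> real"
  assumes "bernoulli_data M E D e"
    and "cubes_assumption M E D e"
    and "\<And>\<epsilon>. \<epsilon> > 0 \<Longrightarrow> noise_process (P \<epsilon>) (\<xi> \<epsilon>) (K \<epsilon>)"
    and "\<And>\<epsilon>. \<epsilon> > 0 \<Longrightarrow> closure {x. K \<epsilon> x \<noteq> 0} \<subseteq> ball 0 \<epsilon>"
    and "high_frequency_gap K"
  shows "\<exists>C::real. \<forall>\<delta>\<in>{0<..<1}. \<forall>\<^sub>F \<epsilon> in at_right 0.
    ereal (real CARD('n) * ln \<epsilon> / ln (p_min M E) - C * (1 + \<bar>ln (1 - \<delta>)\<bar>))
      \<le> ereal_of_enat (dissipation_time (P \<epsilon>) (bernoulli_map M E D e) (\<xi> \<epsilon>) \<delta>) \<and>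
    ereal_of_enat (dissipation_time (P \<epsilon>) (bernoulli_map M E D e) (\<xi> \<epsilon>) \<delta>)
      \<le> ereal (real CARD('n) * ln \<epsilon> / ln (p_max M E) + C * (1 + \<bar>ln \<delta>\<bar> / \<delta>\<^sup>2))"
proof -
  interpret bernoulli M E D e by unfold_locales (rule assms(1))
  \<comment> \<open>The first bound on \<open>c\<close> makes the expansion of the multiplier at low frequencies valid, the second
    one makes low frequencies visible to averages over cells of size \<open>\<epsilon>\<close>.\<close>
  define c where "c = min (1 / (2 * pi)) (1 / (2 * sqrt (low_constant + 1)))"
  have low: "0 \<le> low_constant" using smin_bounds by (simp add: low_constant_def)
  have c: "0 < c" "2 * pi * c \<le> 1" "low_constant * c\<^sup>2 \<le> 1 / 4"
  proof -
    show c0: "0 < c" using low by (simp add: c_def)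
    have "c \<le> 1 / (2 * pi)" by (simp add: c_def)
    then show "2 * pi * c \<le> 1" by (simp add: pos_le_divide_eq mult.commute)
    have "c \<le> 1 / (2 * sqrt (low_constant + 1))" by (simp add: c_def)
    then have "c\<^sup>2 \<le> (1 / (2 * sqrt (low_constant + 1)))\<^sup>2" using c0 by (intro power_mono) auto
    also have "\<dots> = 1 / (4 * (low_constant + 1))" using low by (simp add: power_divide power_mult_distrib)
    finally have "low_constant * c\<^sup>2 \<le> low_constant * (1 / (4 * (low_constant + 1)))" using low by (intro mult_left_mono)
    also have "\<dots> \<le> 1 / 4" using low by (simp add: field_simps)
    finally show "low_constant * c\<^sup>2 \<le> 1 / 4" .
  qed
  obtain \<rho>0 where \<rho>0: "\<rho>0 < 1"
    "\<forall>\<^sub>F \<epsilon> in at_right 0. (SUP k\<in>{k. norm (int_vec k :: real^'n) > c / \<epsilon>}. cmod (fourier_coeff (K \<epsilon>) k)) \<le> \<rho>0"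
    using assms(5) c(1) unfolding high_frequency_gap_def by blast
  define \<rho> where "\<rho> = max \<rho>0 0"
  have \<rho>: "0 \<le> \<rho>" "\<rho> < 1" "\<rho>0 \<le> \<rho>" using \<rho>0(1) by (auto simp: \<rho>_def)
  define C where "C = max lower_constant (upper_constant \<rho>)"
  show ?thesis
  proof (intro exI[of _ C] ballI)
    fix \<delta> :: real assume "\<delta> \<in> {0<..<1}"
    then have \<delta>: "0 < \<delta>" "\<delta> < 1" by auto
    have "\<forall>\<^sub>F \<epsilon> in at_right 0. \<epsilon> < 1 / (4 * sqrt (real CARD('n)))"
      unfolding eventually_at_right_field by (intro exI[of _ "1 / (4 * sqrt (real CARD('n)))"]) simp
    moreover have "\<forall>\<^sub>F \<epsilon> :: real in at_right 0. 0 < \<epsilon>" by (simp add: eventually_at_right_less)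
    ultimately show "\<forall>\<^sub>F \<epsilon> in at_right 0.
        ereal (real CARD('n) * ln \<epsilon> / ln (p_min M E) - C * (1 + \<bar>ln (1 - \<delta>)\<bar>))
          \<le> ereal_of_enat (dissipation_time (P \<epsilon>) (bernoulli_map M E D e) (\<xi> \<epsilon>) \<delta>) \<and>
        ereal_of_enat (dissipation_time (P \<epsilon>) (bernoulli_map M E D e) (\<xi> \<epsilon>) \<delta>)
          \<le> ereal (real CARD('n) * ln \<epsilon> / ln (p_max M E) + C * (1 + \<bar>ln \<delta>\<bar> / \<delta>\<^sup>2))"
      using \<rho>0(2)
    proof eventually_elim
      case (elim \<epsilon>)
      interpret B: bernoulli_process M E D e "P \<epsilon>" "\<xi> \<epsilon>" "K \<epsilon>" \<epsilon>
        by unfold_locales (use assms(3,4) elim in auto)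
      have small: "sqrt (real CARD('n)) * \<epsilon> < 1 / 4" using elim(1) by (simp add: field_simps)
      have gap: "norm (fourier_coeff (K \<epsilon>) k) \<le> \<rho>" if "norm (int_vec k :: real^'n) > c / \<epsilon>" for k
      proof -
        have "norm (fourier_coeff (K \<epsilon>) k) \<le> (SUP k\<in>{k. norm (int_vec k :: real^'n) > c / \<epsilon>}. cmod (fourier_coeff (K \<epsilon>) k))"
          using that B.norm_fourier_coeff_le by (intro cSUP_upper bdd_aboveI2[of _ _ 1]) auto
        then show ?thesis using elim(3) \<rho>(3) by linarith
      qed
      have "ereal (real CARD('n) * ln \<epsilon> / ln (p_min M E) - C * (1 + \<bar>ln (1 - \<delta>)\<bar>))
          \<le> ereal_of_enat (dissipation_time (P \<epsilon>) (bernoulli_map M E D e) (\<xi> \<epsilon>) \<delta>)"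
      proof (rule B.dissipation_time_ge)
        fix n assume "B.dissipated \<delta> n"
        then have "real CARD('n) * ln \<epsilon> / ln (p_min M E) - lower_constant * (1 + \<bar>ln (1 - \<delta>)\<bar>) \<le> real n"
          by (rule B.dissipated_lower_bound[OF \<delta>])
        moreover have "lower_constant * (1 + \<bar>ln (1 - \<delta>)\<bar>) \<le> C * (1 + \<bar>ln (1 - \<delta>)\<bar>)"
          by (intro mult_right_mono) (auto simp: C_def)
        ultimately show "real CARD('n) * ln \<epsilon> / ln (p_min M E) - C * (1 + \<bar>ln (1 - \<delta>)\<bar>) \<le> real n" by linarith
      qed
      moreover have "ereal_of_enat (dissipation_time (P \<epsilon>) (bernoulli_map M E D e) (\<xi> \<epsilon>) \<delta>)
          \<le> ereal (real CARD('n) * ln \<epsilon> / ln (p_max M E) + C * (1 + \<bar>ln \<delta>\<bar> / \<delta>\<^sup>2))"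
      proof (rule order_trans[OF B.dissipation_time_upper_bound[OF c gap \<rho>(1,2) small \<delta>]])
        have "upper_constant \<rho> * (1 + \<bar>ln \<delta>\<bar> / \<delta>\<^sup>2) \<le> C * (1 + \<bar>ln \<delta>\<bar> / \<delta>\<^sup>2)"
          by (intro mult_right_mono) (auto simp: C_def)
        then show "ereal (real CARD('n) * ln \<epsilon> / ln (p_max M E) + upper_constant \<rho> * (1 + \<bar>ln \<delta>\<bar> / \<delta>\<^sup>2))
            \<le> ereal (real CARD('n) * ln \<epsilon> / ln (p_max M E) + C * (1 + \<bar>ln \<delta>\<bar> / \<delta>\<^sup>2))" by simp
      qed
      ultimately show ?case by blast
    qed
  qed
qed

end
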